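(* Let $k$ be a field and let $\mathscr{C}$ be a finite EI category (skeletal, with at least two objects) which is projective over $k$. Assume that $\mathscr{C}$ is GPT-closed. Then each morphism in $\mathscr{C}$ is a monomorphism.
   Context: A finite category is one with only finitely many morphisms (hence finitely many objects). A finite EI category is a finite category in which every endomorphism is an isomorphism; then $\mathrm{Hom}_{\mathscr{C}}(x,x)=\mathrm{Aut}_{\mathscr{C}}(x)$ is a finite group for each object $x$. Skeletal means that distinct objects are not isomorphic. $\mathscr{C}$ is projective over $k$ if for all objects $x,y$ the $k\mathrm{Aut}_{\mathscr{C}}(y)$-$k\mathrm{Aut}_{\mathscr{C}}(x)$-bimodule $k\mathrm{Hom}_{\mathscr{C}}(x,y)$ (the vector space with basis $\mathrm{Hom}_{\mathscr{C}}(x,y)$, with action by composition) is projective as a left module and as a right module. The category algebra $k\mathscr{C}$ is the $k$-vector space with basis the morphisms of $\mathscr{C}$, with product $\alpha*\beta=\alpha\circ\beta$ if $\alpha,\beta$ are composable and $0$ otherwise, and unit $\sum_x \mathrm{Id}_x$. The category $k\mathscr{C}$-mod of finite dimensional left $k\mathscr{C}$-modules is identified with the category of covariant functors from $\mathscr{C}$ to finite dimensional $k$-vector spaces. The tensor product $\hat{\otimes}$ on $k\mathscr{C}$-mod is $(M\hat{\otimes}N)(x)=M(x)\otimes_k N(x)$ for each object $x$, with $\alpha.(m\otimes n)=\alpha.m\otimes\alpha.n$ for $\alpha$ a morphism starting at $x$, $m\in M(x)$, $n\in N(x)$. For a finite dimensional algebra $A$, write $(-)^*$ for $\mathrm{Hom}_A(-,A)$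 and $\mathrm{Hom}_{A^{\mathrm{op}}}(-,A)$. A finite dimensional left $A$-module $G$ is Gorenstein-projective if $\mathrm{Ext}^i_A(G,A)=0=\mathrm{Ext}^i_{A^{\mathrm{op}}}(G^*,A)$ for all $i\geq1$ and the evaluation map $G\to G^{**}$ is bijective. $\mathscr{C}$ is GPT-closed if $X\hat{\otimes}Y$ is Gorenstein-projective whenever $X,Y$ are Gorenstein-projective $k\mathscr{C}$-modules. *)

theory Defs
  imports "HOL-Algebra.Module" "HOL-Algebra.AbelCoset" "HOL-Algebra.Elementary_Groups"
begin

section \<open>Modules over a ring that need not be commutative\<close>

locale left_module = R?: ring R + M?: abelian_group M
  for R :: "('a, 'y) ring_scheme" (structure) and M :: "('a, 'v, 'z) module_scheme" (structure) +
  assumes smult_closed: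
      "\<lbrakk>a \<in> carrier R; x \<in> carrier M\<rbrakk> \<Longrightarrow> a \<odot>\<^bsub>M\<^esub> x \<in> carrier M"
    and smult_l_distr:
      "\<lbrakk>a \<in> carrier R; b \<in> carrier R; x \<in> carrier M\<rbrakk> \<Longrightarrow>
        (a \<oplus> b) \<odot>\<^bsub>M\<^esub> x = a \<odot>\<^bsub>M\<^esub> x \<oplus>\<^bsub>M\<^esub> b \<odot>\<^bsub>M\<^esub> x"
    and smult_r_distr:
      "\<lbrakk>a \<in> carrier R; x \<in> carrier M; y \<in> carrier M\<rbrakk> \<Longrightarrow>
        a \<odot>\<^bsub>M\<^esub> (x \<oplus>\<^bsub>M\<^esub> y) = a \<odot>\<^bsub>M\<^esub> x \<oplus>\<^bsub>M\<^esub> a \<odot>\<^bsub>M\<^esub> y"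
    and smult_assoc1:
      "\<lbrakk>a \<in> carrier R; b \<in> carrier R; x \<in> carrier M\<rbrakk> \<Longrightarrow>
        (a \<otimes> b) \<odot>\<^bsub>M\<^esub> x = a \<odot>\<^bsub>M\<^esub> (b \<odot>\<^bsub>M\<^esub> x)"
    and smult_one: "x \<in> carrier M \<Longrightarrow> \<one> \<odot>\<^bsub>M\<^esub> x = x"

text \<open>Right modules over \<open>A\<close> are left modules over \<open>op_ring A\<close>.\<close>

definition op_ring :: "('a, 'z) ring_scheme \<Rightarrow> ('a, 'z) ring_scheme"
  where "op_ring A = A\<lparr>mult := \<lambda>a b. b \<otimes>\<^bsub>A\<^esub> a\<rparr>"

definition with_action :: "('v, 'z) ring_scheme \<Rightarrow> ('a \<Rightarrow> 'v \<Rightarrow> 'v) \<Rightarrow> ('a, 'v) module"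
  where "with_action M s =
    \<lparr>carrier = carrier M, mult = mult M, one = one M, zero = zero M, add = add M, smult = s\<rparr>"

definition regular_module :: "('a, 'z) ring_scheme \<Rightarrow> ('a, 'a) module"
  where "regular_module A = with_action A (mult A)"

text \<open>
  The free module with basis \<open>S\<close>; here and below the ring-multiplicative fields that the record
  type \<open>module\<close> inherits play no role.
\<close>

definition free_module :: "('a, 'z) ring_scheme \<Rightarrow> 's set \<Rightarrow> ('a, 's \<Rightarrow> 'a) module"
  where "free_module A S =
    \<lparr>carrier = {f. (\<forall>s. f s \<in> carrier A) \<and> (\<forall>s. s \<notin> S \<longrightarrow> f s = \<zero>\<^bsub>A\<^esub>) \<and> finite {s. f s \<noteq> \<zero>\<^bsub>A\<^esub>}},
     mult = undefined, one = undefined,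
     zero = (\<lambda>_. \<zero>\<^bsub>A\<^esub>),
     add = (\<lambda>f g s. f s \<oplus>\<^bsub>A\<^esub> g s),
     smult = (\<lambda>a f s. a \<otimes>\<^bsub>A\<^esub> f s)\<rparr>"

definition basis_vec :: "('a, 'z) ring_scheme \<Rightarrow> 's \<Rightarrow> 's \<Rightarrow> 'a"
  where "basis_vec A s = (\<lambda>t. if t = s then \<one>\<^bsub>A\<^esub> else \<zero>\<^bsub>A\<^esub>)"

definition mod_hom ::
    "('a, 'z) ring_scheme \<Rightarrow> ('a, 'v, 'y) module_scheme \<Rightarrow> ('a, 'w, 'x) module_scheme \<Rightarrow> ('v \<Rightarrow> 'w) set"
  where "mod_hom A M N =
    {f \<in> carrier M \<rightarrow> carrier N.
      (\<forall>x\<in>carrier M. \<forall>y\<in>carrier M. f (x \<oplus>\<^bsub>M\<^esub> y) = f x \<oplus>\<^bsub>N\<^esub> f y) \<and>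
      (\<forall>a\<in>carrier A. \<forall>x\<in>carrier M. f (a \<odot>\<^bsub>M\<^esub> x) = a \<odot>\<^bsub>N\<^esub> f x)}"

definition finitely_generated :: "('a, 'z) ring_scheme \<Rightarrow> ('a, 'v, 'y) module_scheme \<Rightarrow> bool"
  where "finitely_generated A M \<longleftrightarrow>
    (\<exists>B. finite B \<and> B \<subseteq> carrier M \<and>
      (\<forall>x\<in>carrier M. \<exists>c \<in> B \<rightarrow> carrier A. x = (\<Oplus>\<^bsub>M\<^esub>b\<in>B. c b \<odot>\<^bsub>M\<^esub> b)))"

text \<open>
  Projective means direct summand (retract) of a free module.  Basis sets inside the type of
  elements of \<open>P\<close> suffice, since \<open>P\<close> is a quotient of the free module on \<open>carrier P\<close>.
\<close>

definition projective_module :: "('a, 'z) ring_scheme \<Rightarrow> ('a, 'v, 'y) module_scheme \<Rightarrow> bool"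
  where "projective_module A P \<longleftrightarrow> left_module A P \<and>
    (\<exists>(S :: 'v set) i p.
      i \<in> mod_hom A P (free_module A S) \<and> p \<in> mod_hom A (free_module A S) P \<and>
      (\<forall>x\<in>carrier P. p (i x) = x))"


section \<open>Ext and Gorenstein-projective modules\<close>

text \<open>
  \<open>hom_group\<close> is the additive group of homomorphisms, written as a HOL-Algebra group.
  Homomorphisms are made \<open>undefined\<close> off the carrier so that equal maps are equal functions.
\<close>

definition hom_group ::
    "('a, 'z) ring_scheme \<Rightarrow> ('a, 'v, 'y) module_scheme \<Rightarrow> ('a, 'w, 'x) module_scheme \<Rightarrow> ('v \<Rightarrow> 'w) monoid"
  where "hom_group A M N =
    \<lparr>carrier = mod_hom A M N \<inter> extensional (carrier M),
     mult = (\<lambda>f g. \<lambda>x\<in>carrier M. f x \<oplus>\<^bsub>N\<^esub> g x),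
     one = (\<lambda>x\<in>carrier M. \<zero>\<^bsub>N\<^esub>)\<rparr>"

text \<open>
  \<open>\<dots> \<rightarrow> P 2 \<rightarrow> P 1 \<rightarrow> P 0 \<rightarrow> M \<rightarrow> 0\<close> with differentials \<open>d i : P (i + 1) \<rightarrow> P i\<close> and
  augmentation \<open>e : P 0 \<rightarrow> M\<close>.
\<close>

definition projective_resolution ::
    "('a, 'z) ring_scheme \<Rightarrow> ('a, 'v, 'y) module_scheme \<Rightarrow>
      (nat \<Rightarrow> ('a, 'p) module) \<Rightarrow> (nat \<Rightarrow> 'p \<Rightarrow> 'p) \<Rightarrow> ('p \<Rightarrow> 'v) \<Rightarrow> bool"
  where "projective_resolution A M P d e \<longleftrightarrow>
    (\<forall>i. projective_module A (P i)) \<and>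
    (\<forall>i. d i \<in> mod_hom A (P (Suc i)) (P i)) \<and>
    e \<in> mod_hom A (P 0) M \<and>
    e ` carrier (P 0) = carrier M \<and>
    a_kernel (P 0) M e = d 0 ` carrier (P 1) \<and>
    (\<forall>i. a_kernel (P (Suc i)) (P i) (d i) = d (Suc i) ` carrier (P (Suc (Suc i))))"

definition cocycles ::
    "('a, 'z) ring_scheme \<Rightarrow> (nat \<Rightarrow> ('a, 'p) module) \<Rightarrow> (nat \<Rightarrow> 'p \<Rightarrow> 'p) \<Rightarrow>
      ('a, 'w, 'y) module_scheme \<Rightarrow> nat \<Rightarrow> ('p \<Rightarrow> 'w) set"
  where "cocycles A P d N i =
    kernel (hom_group A (P i) N) (hom_group A (P (Suc i)) N)
      (\<lambda>f. compose (carrier (P (Suc i))) f (d i))"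

fun coboundaries ::
    "('a, 'z) ring_scheme \<Rightarrow> (nat \<Rightarrow> ('a, 'p) module) \<Rightarrow> (nat \<Rightarrow> 'p \<Rightarrow> 'p) \<Rightarrow>
      ('a, 'w, 'y) module_scheme \<Rightarrow> nat \<Rightarrow> ('p \<Rightarrow> 'w) set"
  where
    "coboundaries A P d N 0 = {\<one>\<^bsub>hom_group A (P 0) N\<^esub>}"
  | "coboundaries A P d N (Suc i) =
      (\<lambda>f. compose (carrier (P (Suc i))) f (d i)) ` carrier (hom_group A (P i) N)"

definition Ext_group ::
    "('a, 'z) ring_scheme \<Rightarrow> (nat \<Rightarrow> ('a, 'p) module) \<Rightarrow> (nat \<Rightarrow> 'p \<Rightarrow> 'p) \<Rightarrow>
      ('a, 'w, 'y) module_scheme \<Rightarrow> nat \<Rightarrow> ('p \<Rightarrow> 'w) set monoid"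
  where "Ext_group A P d N i =
    (hom_group A (P i) N)\<lparr>carrier := cocycles A P d N i\<rparr> Mod coboundaries A P d N i"

text \<open>
  Ext does not depend on the resolution.  A finitely generated module over a (left) Noetherian
  ring \<open>A\<close> has a resolution by modules \<open>A\<^sup>n\<close>, whose elements can be written in the type
  \<open>nat \<Rightarrow> 'a\<close>; so for such modules the quantification below is never vacuous.
\<close>

definition Ext_vanishes ::
    "('a, 'z) ring_scheme \<Rightarrow> nat \<Rightarrow> ('a, 'v, 'y) module_scheme \<Rightarrow> ('a, 'w, 'x) module_scheme \<Rightarrow> bool"
  where "Ext_vanishes A i M N \<longleftrightarrow>
    (\<forall>(P :: nat \<Rightarrow> ('a, nat \<Rightarrow> 'a) module) d e.
      projective_resolution A M P d e \<longrightarrow> trivial_group (Ext_group A P d N i))"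

text \<open>\<open>Hom\<^sub>A(M, A)\<close> with the action \<open>(f.a)(x) = f(x) a\<close>, as a left module over \<open>op_ring A\<close>.\<close>

definition dual_module ::
    "('a, 'z) ring_scheme \<Rightarrow> ('a, 'v, 'y) module_scheme \<Rightarrow> ('a, 'v \<Rightarrow> 'a) module"
  where "dual_module A M =
    \<lparr>carrier = mod_hom A M (regular_module A) \<inter> extensional (carrier M),
     mult = undefined, one = undefined,
     zero = (\<lambda>x\<in>carrier M. \<zero>\<^bsub>A\<^esub>),
     add = (\<lambda>f g. \<lambda>x\<in>carrier M. f x \<oplus>\<^bsub>A\<^esub> g x),
     smult = (\<lambda>a f. \<lambda>x\<in>carrier M. f x \<otimes>\<^bsub>A\<^esub> a)\<rparr>"

text \<open>
  Over a finite dimensional algebra \<open>A\<close>, finitely generated is the same as finite dimensional.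
  The bidual is a left module over \<open>op_ring (op_ring A) = A\<close>.
\<close>

definition Gorenstein_projective :: "('a, 'z) ring_scheme \<Rightarrow> ('a, 'v, 'y) module_scheme \<Rightarrow> bool"
  where "Gorenstein_projective A G \<longleftrightarrow>
    left_module A G \<and> finitely_generated A G \<and>
    (\<forall>i\<ge>1. Ext_vanishes A i G (regular_module A)) \<and>
    (\<forall>i\<ge>1. Ext_vanishes (op_ring A) i (dual_module A G) (regular_module (op_ring A))) \<and>
    bij_betw (\<lambda>x. \<lambda>f\<in>carrier (dual_module A G). f x)
      (carrier G) (carrier (dual_module (op_ring A) (dual_module A G)))"


section \<open>Finite EI categories\<close>

record ('o, 'm) cat =
  Obj :: "'o set"
  Mor :: "'m set"
  Dom :: "'m \<Rightarrow> 'o"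
  Cod :: "'m \<Rightarrow> 'o"
  Id :: "'o \<Rightarrow> 'm"
  Comp :: "'m \<Rightarrow> 'm \<Rightarrow> 'm" (infixl \<open>\<bullet>\<index>\<close> 70)

locale category =
  fixes C :: "('o, 'm, 'z) cat_scheme" (structure)
  assumes Dom_closed: "f \<in> Mor C \<Longrightarrow> Dom C f \<in> Obj C"
    and Cod_closed: "f \<in> Mor C \<Longrightarrow> Cod C f \<in> Obj C"
    and Id_closed: "x \<in> Obj C \<Longrightarrow> Id C x \<in> Mor C"
    and Dom_Id: "x \<in> Obj C \<Longrightarrow> Dom C (Id C x) = x"
    and Cod_Id: "x \<in> Obj C \<Longrightarrow> Cod C (Id C x) = x"
    and Comp_closed: "\<lbrakk>g \<in> Mor C; f \<in> Mor C; Dom C g = Cod C f\<rbrakk> \<Longrightarrow> g \<bullet> f \<in> Mor C"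
    and Dom_Comp: "\<lbrakk>g \<in> Mor C; f \<in> Mor C; Dom C g = Cod C f\<rbrakk> \<Longrightarrow> Dom C (g \<bullet> f) = Dom C f"
    and Cod_Comp: "\<lbrakk>g \<in> Mor C; f \<in> Mor C; Dom C g = Cod C f\<rbrakk> \<Longrightarrow> Cod C (g \<bullet> f) = Cod C g"
    and Comp_Id: "f \<in> Mor C \<Longrightarrow> f \<bullet> Id C (Dom C f) = f"
    and Id_Comp: "f \<in> Mor C \<Longrightarrow> Id C (Cod C f) \<bullet> f = f"
    and Comp_assoc:
      "\<lbrakk>h \<in> Mor C; g \<in> Mor C; f \<in> Mor C; Dom C h = Cod C g; Dom C g = Cod C f\<rbrakk> \<Longrightarrow>
        (h \<bullet> g) \<bullet> f = h \<bullet> (g \<bullet> f)"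

definition Hom_set :: "('o, 'm, 'z) cat_scheme \<Rightarrow> 'o \<Rightarrow> 'o \<Rightarrow> 'm set"
  where "Hom_set C x y = {f \<in> Mor C. Dom C f = x \<and> Cod C f = y}"

definition isomorphism :: "('o, 'm, 'z) cat_scheme \<Rightarrow> 'm \<Rightarrow> bool"
  where "isomorphism C f \<longleftrightarrow> f \<in> Mor C \<and>
    (\<exists>g \<in> Hom_set C (Cod C f) (Dom C f).
      g \<bullet>\<^bsub>C\<^esub> f = Id C (Dom C f) \<and> f \<bullet>\<^bsub>C\<^esub> g = Id C (Cod C f))"

definition monomorphism :: "('o, 'm, 'z) cat_scheme \<Rightarrow> 'm \<Rightarrow> bool"
  where "monomorphism C f \<longleftrightarrow> f \<in> Mor C \<and>
    (\<forall>w\<in>Obj C. \<forall>g \<in> Hom_set C w (Dom C f). \<forall>h \<in> Hom_set C w (Dom C f).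
      f \<bullet>\<^bsub>C\<^esub> g = f \<bullet>\<^bsub>C\<^esub> h \<longrightarrow> g = h)"

definition Aut :: "('o, 'm, 'z) cat_scheme \<Rightarrow> 'o \<Rightarrow> 'm set"
  where "Aut C x = {f \<in> Hom_set C x x. isomorphism C f}"

locale finite_EI_category = category +
  assumes finite_Mor: "finite (Mor C)"
    and endo_iso: "\<lbrakk>x \<in> Obj C; f \<in> Hom_set C x x\<rbrakk> \<Longrightarrow> isomorphism C f"

definition skeletal :: "('o, 'm, 'z) cat_scheme \<Rightarrow> bool"
  where "skeletal C \<longleftrightarrow>
    (\<forall>x\<in>Obj C. \<forall>y\<in>Obj C. (\<exists>f \<in> Hom_set C x y. isomorphism C f) \<longrightarrow> x = y)"


section \<open>The category algebra and projectivity over the base field\<close>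

text \<open>
  The bilinear extension of the partial composition: a basis morphism \<open>m\<close> gets the coefficient
  \<open>\<Sum> f(\<alpha>) g(\<beta>)\<close> over the composable pairs with \<open>\<alpha> \<circ> \<beta> = m\<close>.
\<close>

definition conv ::
    "('k, 'z) ring_scheme \<Rightarrow> ('o, 'm, 'y) cat_scheme \<Rightarrow> ('m \<Rightarrow> 'k) \<Rightarrow> ('m \<Rightarrow> 'k) \<Rightarrow> 'm \<Rightarrow> 'k"
  where "conv k C f g = (\<lambda>m.
    \<Oplus>\<^bsub>k\<^esub>p \<in> {(\<alpha>, \<beta>). \<alpha> \<in> Mor C \<and> \<beta> \<in> Mor C \<and> Dom C \<alpha> = Cod C \<beta> \<and> \<alpha> \<bullet>\<^bsub>C\<^esub> \<beta> = m}.
      f (fst p) \<otimes>\<^bsub>k\<^esub> g (snd p))"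

definition category_algebra ::
    "('k, 'z) ring_scheme \<Rightarrow> ('o, 'm, 'y) cat_scheme \<Rightarrow> ('m \<Rightarrow> 'k) ring"
  where "category_algebra k C =
    \<lparr>carrier = carrier (free_module k (Mor C)),
     mult = conv k C,
     one = (\<lambda>m. if m \<in> Id C ` Obj C then \<one>\<^bsub>k\<^esub> else \<zero>\<^bsub>k\<^esub>),
     zero = zero (free_module k (Mor C)),
     add = add (free_module k (Mor C))\<rparr>"

text \<open>The group algebra of \<open>Aut C x\<close>, viewed as a category with the single object \<open>x\<close>.\<close>

definition Aut_algebra ::
    "('k, 'z) ring_scheme \<Rightarrow> ('o, 'm, 'y) cat_scheme \<Rightarrow> 'o \<Rightarrow> ('m \<Rightarrow> 'k) ring"
  where "Aut_algebra k C x = category_algebra k (C\<lparr>Obj := {x}, Mor := Aut C x\<rparr>)"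

text \<open>
  The two module structures of the bimodule with basis \<open>Hom_set C x y\<close>.  Elements of
  \<open>Aut_algebra\<close> vanish outside the automorphisms, so both actions are given by \<open>conv k C\<close>.
\<close>

definition hom_left_module ::
    "('k, 'z) ring_scheme \<Rightarrow> ('o, 'm, 'y) cat_scheme \<Rightarrow> 'o \<Rightarrow> 'o \<Rightarrow> ('m \<Rightarrow> 'k, 'm \<Rightarrow> 'k) module"
  where "hom_left_module k C x y =
    with_action (free_module k (Hom_set C x y)) (\<lambda>a v. conv k C a v)"

definition hom_right_module ::
    "('k, 'z) ring_scheme \<Rightarrow> ('o, 'm, 'y) cat_scheme \<Rightarrow> 'o \<Rightarrow> 'o \<Rightarrow> ('m \<Rightarrow> 'k, 'm \<Rightarrow> 'k) module"
  where "hom_right_module k C x y =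
    with_action (free_module k (Hom_set C x y)) (\<lambda>a v. conv k C v a)"

definition projective_over :: "('k, 'z) ring_scheme \<Rightarrow> ('o, 'm, 'y) cat_scheme \<Rightarrow> bool"
  where "projective_over k C \<longleftrightarrow>
    (\<forall>x\<in>Obj C. \<forall>y\<in>Obj C.
      projective_module (Aut_algebra k C y) (hom_left_module k C x y) \<and>
      projective_module (op_ring (Aut_algebra k C x)) (hom_right_module k C x y))"


section \<open>Functors to vector spaces and modules over the category algebra\<close>

record ('o, 'm, 'k, 'v) vect_functor =
  obj_map :: "'o \<Rightarrow> ('k, 'v) module"
  mor_map :: "'m \<Rightarrow> 'v \<Rightarrow> 'v"

locale fd_functor = field k + category C
  for k :: "('k, 'z) ring_scheme" (structure) and C :: "('o, 'm, 'y) cat_scheme" +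
  fixes F :: "('o, 'm, 'k, 'v) vect_functor"
  assumes obj_module: "x \<in> Obj C \<Longrightarrow> module k (obj_map F x)"
    and obj_finite_dim: "x \<in> Obj C \<Longrightarrow> finitely_generated k (obj_map F x)"
    and mor_linear: "\<alpha> \<in> Mor C \<Longrightarrow>
      mor_map F \<alpha> \<in> mod_hom k (obj_map F (Dom C \<alpha>)) (obj_map F (Cod C \<alpha>))"
    and map_Id: "\<lbrakk>x \<in> Obj C; v \<in> carrier (obj_map F x)\<rbrakk> \<Longrightarrow> mor_map F (Id C x) v = v"
    and map_Comp:
      "\<lbrakk>\<beta> \<in> Mor C; \<alpha> \<in> Mor C; Dom C \<beta> = Cod C \<alpha>; v \<in> carrier (obj_map F (Dom C \<alpha>))\<rbrakk> \<Longrightarrow>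
        mor_map F (\<beta> \<bullet>\<^bsub>C\<^esub> \<alpha>) v = mor_map F \<beta> (mor_map F \<alpha> v)"

text \<open>
  The module \<open>\<Oplus>\<^sub>x F(x)\<close> over the category algebra, in which a morphism \<open>\<alpha>\<close> maps the summand at
  \<open>Dom \<alpha>\<close> to the one at \<open>Cod \<alpha>\<close> by \<open>F(\<alpha>)\<close> and annihilates the other summands.  The direct sum
  is a product because there are only finitely many objects.
\<close>

definition total_module ::
    "('o, 'm, 'y) cat_scheme \<Rightarrow> ('o, 'm, 'k, 'v) vect_functor \<Rightarrow> ('m \<Rightarrow> 'k, 'o \<Rightarrow> 'v) module"
  where "total_module C F =
    \<lparr>carrier = (\<Pi>\<^sub>E x\<in>Obj C. carrier (obj_map F x)),
     mult = undefined, one = undefined,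
     zero = (\<lambda>x\<in>Obj C. \<zero>\<^bsub>obj_map F x\<^esub>),
     add = (\<lambda>v w. \<lambda>x\<in>Obj C. v x \<oplus>\<^bsub>obj_map F x\<^esub> w x),
     smult = (\<lambda>a v. \<lambda>y\<in>Obj C.
       \<Oplus>\<^bsub>obj_map F y\<^esub>\<alpha> \<in> {\<alpha> \<in> Mor C. Cod C \<alpha> = y}.
         a \<alpha> \<odot>\<^bsub>obj_map F y\<^esub> mor_map F \<alpha> (v (Dom C \<alpha>)))\<rparr>"


section \<open>The objectwise tensor product\<close>

definition quotient_module :: "('a, 'v, 'y) module_scheme \<Rightarrow> 'v set \<Rightarrow> ('a, 'v set) module"
  where "quotient_module M N =
    \<lparr>carrier = a_rcosets\<^bsub>M\<^esub> N,
     mult = undefined, one = undefined,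
     zero = N,
     add = set_add M,
     smult = (\<lambda>a U. \<Union>x\<in>U. N +>\<^bsub>M\<^esub> (a \<odot>\<^bsub>M\<^esub> x))\<rparr>"

definition tensor_relations ::
    "('k, 'z) ring_scheme \<Rightarrow> ('k, 'v) module \<Rightarrow> ('k, 'w) module \<Rightarrow> ('v \<times> 'w \<Rightarrow> 'k) set"
  where "tensor_relations k V W =
    (let F = free_module k (carrier V \<times> carrier W); e = basis_vec k in
      {e (v \<oplus>\<^bsub>V\<^esub> v', w) \<ominus>\<^bsub>F\<^esub> (e (v, w) \<oplus>\<^bsub>F\<^esub> e (v', w)) | v v' w.
        v \<in> carrier V \<and> v' \<in> carrier V \<and> w \<in> carrier W} \<union>
      {e (v, w \<oplus>\<^bsub>W\<^esub> w') \<ominus>\<^bsub>F\<^esub> (e (v, w) \<oplus>\<^bsub>F\<^esub> e (v, w')) | v w w'.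
        v \<in> carrier V \<and> w \<in> carrier W \<and> w' \<in> carrier W} \<union>
      {e (c \<odot>\<^bsub>V\<^esub> v, w) \<ominus>\<^bsub>F\<^esub> c \<odot>\<^bsub>F\<^esub> e (v, w) | c v w.
        c \<in> carrier k \<and> v \<in> carrier V \<and> w \<in> carrier W} \<union>
      {e (v, c \<odot>\<^bsub>W\<^esub> w) \<ominus>\<^bsub>F\<^esub> c \<odot>\<^bsub>F\<^esub> e (v, w) | c v w.
        c \<in> carrier k \<and> v \<in> carrier V \<and> w \<in> carrier W})"

definition tensor_kernel ::
    "('k, 'z) ring_scheme \<Rightarrow> ('k, 'v) module \<Rightarrow> ('k, 'w) module \<Rightarrow> ('v \<times> 'w \<Rightarrow> 'k) set"
  where "tensor_kernel k V W =
    \<Inter>{H. submodule H k (free_module k (carrier V \<times> carrier W)) \<and> tensor_relations k V W \<subseteq> H}"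

definition tensor_space ::
    "('k, 'z) ring_scheme \<Rightarrow> ('k, 'v) module \<Rightarrow> ('k, 'w) module \<Rightarrow> ('k, ('v \<times> 'w \<Rightarrow> 'k) set) module"
  where "tensor_space k V W =
    quotient_module (free_module k (carrier V \<times> carrier W)) (tensor_kernel k V W)"

definition pure_tensor ::
    "('k, 'z) ring_scheme \<Rightarrow> ('k, 'v) module \<Rightarrow> ('k, 'w) module \<Rightarrow> 'v \<Rightarrow> 'w \<Rightarrow> ('v \<times> 'w \<Rightarrow> 'k) set"
  where "pure_tensor k V W v w =
    tensor_kernel k V W +>\<^bsub>free_module k (carrier V \<times> carrier W)\<^esub> basis_vec k (v, w)"

text \<open>
  The map \<open>V \<otimes> W \<rightarrow> V' \<otimes> W'\<close> with \<open>v \<otimes> w \<mapsto> f v \<otimes> g w\<close>: its value on a coset is computed from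
  an arbitrary representative \<open>t\<close>, that is, a formal linear combination of pairs \<open>(v, w)\<close>.
\<close>

definition tensor_map ::
    "('k, 'z) ring_scheme \<Rightarrow> ('k, 'v) module \<Rightarrow> ('k, 'w) module \<Rightarrow>
      ('k, 'v1) module \<Rightarrow> ('k, 'w1) module \<Rightarrow> ('v \<Rightarrow> 'v1) \<Rightarrow> ('w \<Rightarrow> 'w1) \<Rightarrow>
      ('v \<times> 'w \<Rightarrow> 'k) set \<Rightarrow> ('v1 \<times> 'w1 \<Rightarrow> 'k) set"
  where "tensor_map k V W V' W' f g U =
    the_elem ((\<lambda>t. \<Oplus>\<^bsub>tensor_space k V' W'\<^esub>p \<in> {p. t p \<noteq> \<zero>\<^bsub>k\<^esub>}.
      t p \<odot>\<^bsub>tensor_space k V' W'\<^esub> pure_tensor k V' W' (f (fst p)) (g (snd p))) ` U)"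

definition tensor_functor ::
    "('k, 'z) ring_scheme \<Rightarrow> ('o, 'm, 'y) cat_scheme \<Rightarrow>
      ('o, 'm, 'k, 'v) vect_functor \<Rightarrow> ('o, 'm, 'k, 'w) vect_functor \<Rightarrow>
      ('o, 'm, 'k, ('v \<times> 'w \<Rightarrow> 'k) set) vect_functor"
  where "tensor_functor k C F G =
    \<lparr>obj_map = (\<lambda>x. tensor_space k (obj_map F x) (obj_map G x)),
     mor_map = (\<lambda>\<alpha>. tensor_map k
       (obj_map F (Dom C \<alpha>)) (obj_map G (Dom C \<alpha>)) (obj_map F (Cod C \<alpha>)) (obj_map G (Cod C \<alpha>))
       (mor_map F \<alpha>) (mor_map G \<alpha>))\<rparr>"

text \<open>
  Every finite dimensional \<open>k\<close>-vector space is isomorphic to one whose elements have the type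
  \<open>nat \<Rightarrow> 'k\<close>, so \<open>F\<close> and \<open>G\<close> range over all finite dimensional modules up to isomorphism.
\<close>

definition GPT_closed :: "('k, 'z) ring_scheme \<Rightarrow> ('o, 'm, 'y) cat_scheme \<Rightarrow> bool"
  where "GPT_closed k C \<longleftrightarrow>
    (\<forall>(F :: ('o, 'm, 'k, nat \<Rightarrow> 'k) vect_functor) (G :: ('o, 'm, 'k, nat \<Rightarrow> 'k) vect_functor).
      fd_functor k C F \<and> fd_functor k C G \<and>
      Gorenstein_projective (category_algebra k C) (total_module C F) \<and>
      Gorenstein_projective (category_algebra k C) (total_module C G) \<longrightarrow>
      Gorenstein_projective (category_algebra k C) (total_module C (tensor_functor k C F G)))"

end

theory Submission
  imports Defs
begin

text \<open>
  Objects are ordered by the existence of a morphism; this is a partial order because \<open>C\<close> is EI and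
  skeletal (\<open>antisymmetric\<close>).  Write \<open>A\<close> for the category algebra and \<open>P\<^sub>w = k Hom(w, -)\<close>.

  The obstruction.  Let \<open>y\<close> be an object such that all morphisms into objects strictly below \<open>y\<close> are
  monomorphisms, let \<open>\<alpha> : z \<rightarrow> y\<close> with \<open>z \<noteq> y\<close>, and let \<open>\<beta>, \<gamma> : w \<rightarrow> z\<close> satisfy
  \<open>\<alpha> \<circ> \<beta> = \<alpha> \<circ> \<gamma>\<close>.  The module \<open>P\<^sub>w\<close> is projective, hence Gorenstein-projective
  (\<open>Gorenstein_projective_rep\<close>), so \<open>M = P\<^sub>w \<otimes> P\<^sub>w\<close> is Gorenstein-projective by hypothesis.  On basis
  elements of \<open>M\<close> strictly below \<open>y\<close>, which are pairs of parallel morphisms, let \<open>\<tau>\<close> be \<open>1\<close> if the two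
  morphisms agree and \<open>0\<close> otherwise.  Composition with a monomorphism preserves \<open>\<tau>\<close>
  (\<open>\<tau>_mono\<close>), so below \<open>y\<close> the functional \<open>\<tau>\<close> is natural.  If it extended to \<open>M(y)\<close>, compatibly with
  \<open>\<alpha>\<close>, it would take equal values on \<open>\<beta> \<otimes> \<beta>\<close> and \<open>\<beta> \<otimes> \<gamma>\<close>, which \<open>\<alpha>\<close> maps to the same element,
  and so \<open>\<beta> = \<gamma>\<close>.

  The extension problem.  Multiplying by the norm element of \<open>k Aut(y)\<close>, the failure of \<open>\<tau>\<close> to
  extend becomes a derivation \<open>h : A \<times> M \<rightarrow> k Aut(y)\<close>, where \<open>k Aut(y)\<close> is an \<open>A\<close>-module concentrated at
  \<open>y\<close> (\<open>h_mult\<close>).  Such a derivation is an extension of \<open>M\<close> by \<open>k Aut(y)\<close>, and it is inner if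
  \<open>Ext\<^sup>1(M, k Aut(y)) = 0\<close> (\<open>derivation_inner\<close>).  An inner derivation yields the contradiction above
  (\<open>monomorphism_if_mono_below\<close>), and induction along the order of objects finishes the proof.

  Vanishing of \<open>Ext\<close>.  By definition \<open>Ext\<^sup>i(M, A) = 0\<close> for \<open>i \<ge> 1\<close>, and the modules with this property
  in place of \<open>A\<close> are closed under direct summands of finite powers, under extensions and under
  cokernels of injections, hence contain all finitely generated modules of finite projective
  dimension.  Projectivity of
  \<open>C\<close> makes \<open>k Aut(y)\<close> one of them: it is a quotient of \<open>P\<^sub>y\<close>, and the kernel is filtered by the
  \<open>k Hom(y, z)\<close> with \<open>z\<close> strictly above \<open>y\<close>, which are summands of powers of \<open>k Aut(z)\<close>
  (\<open>Hom_exact_Aut\<close>).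

  Since \<open>Ext\<close> is given by resolutions through modules \<open>A\<^sup>n\<close>, its vanishing is informative only if \<open>M\<close>
  has such a resolution; it exists because \<open>A\<close> is finite dimensional and thus Noetherian
  (\<open>left_noetherian_A\<close>, \<open>free_resolution_exists\<close>).
\<close>

section \<open>Left modules and their homomorphisms\<close>

lemma left_moduleI:
  assumes "ring A" "abelian_group M"
    and "\<And>a x. \<lbrakk>a \<in> carrier A; x \<in> carrier M\<rbrakk> \<Longrightarrow> a \<odot>\<^bsub>M\<^esub> x \<in> carrier M"
    and "\<And>a b x. \<lbrakk>a \<in> carrier A; b \<in> carrier A; x \<in> carrier M\<rbrakk> \<Longrightarrow>
        (a \<oplus>\<^bsub>A\<^esub> b) \<odot>\<^bsub>M\<^esub> x = a \<odot>\<^bsub>M\<^esub> x \<oplus>\<^bsub>M\<^esub> b \<odot>\<^bsub>M\<^esub> x"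
    and "\<And>a x y. \<lbrakk>a \<in> carrier A; x \<in> carrier M; y \<in> carrier M\<rbrakk> \<Longrightarrow>
        a \<odot>\<^bsub>M\<^esub> (x \<oplus>\<^bsub>M\<^esub> y) = a \<odot>\<^bsub>M\<^esub> x \<oplus>\<^bsub>M\<^esub> a \<odot>\<^bsub>M\<^esub> y"
    and "\<And>a b x. \<lbrakk>a \<in> carrier A; b \<in> carrier A; x \<in> carrier M\<rbrakk> \<Longrightarrow>
        (a \<otimes>\<^bsub>A\<^esub> b) \<odot>\<^bsub>M\<^esub> x = a \<odot>\<^bsub>M\<^esub> (b \<odot>\<^bsub>M\<^esub> x)"
    and "\<And>x. x \<in> carrier M \<Longrightarrow> \<one>\<^bsub>A\<^esub> \<odot>\<^bsub>M\<^esub> x = x"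
  shows "left_module A M"
  using assms unfolding left_module_def left_module_axioms_def by blast

context left_module
begin

lemma smult_zero_left [simp]: "x \<in> carrier M \<Longrightarrow> \<zero> \<odot>\<^bsub>M\<^esub> x = \<zero>\<^bsub>M\<^esub>"
  by (metis R.l_zero R.zero_closed M.add.r_cancel_one smult_closed smult_l_distr)

lemma smult_zero_right [simp]: "a \<in> carrier R \<Longrightarrow> a \<odot>\<^bsub>M\<^esub> \<zero>\<^bsub>M\<^esub> = \<zero>\<^bsub>M\<^esub>"
  by (metis M.l_zero M.zero_closed M.add.r_cancel_one smult_closed smult_r_distr)

lemma smult_minus_one: "x \<in> carrier M \<Longrightarrow> (\<ominus> \<one>) \<odot>\<^bsub>M\<^esub> x = \<ominus>\<^bsub>M\<^esub> x"
  by (metis M.minus_equality R.add.inv_closed R.l_neg R.one_closed smult_closed smult_l_distr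
      smult_one smult_zero_left)

lemma eq_if_diff_zero: "\<lbrakk>x \<in> carrier M; y \<in> carrier M; x \<ominus>\<^bsub>M\<^esub> y = \<zero>\<^bsub>M\<^esub>\<rbrakk> \<Longrightarrow> x = y"
  by (metis M.a_inv_closed M.minus_equality M.minus_minus a_minus_def)

lemma smult_finsum:
  assumes "a \<in> carrier R" "f \<in> I \<rightarrow> carrier M"
  shows "a \<odot>\<^bsub>M\<^esub> (\<Oplus>\<^bsub>M\<^esub>i\<in>I. f i) = (\<Oplus>\<^bsub>M\<^esub>i\<in>I. a \<odot>\<^bsub>M\<^esub> f i)"
  using assms(2)
proof (induction I rule: infinite_finite_induct)
  case (insert i I)
  then show ?case
    using assms(1) by (simp add: smult_r_distr smult_closed Pi_iff)
qed (simp_all add: assms(1))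

end

text \<open>
  The module axioms are inherited along an injection that respects the operations; inverses exist
  because they are multiples by \<open>-1\<close>.
\<close>

lemma left_module_embed:
  assumes N: "left_module A N" and inj: "inj_on j (carrier M)"
    and j: "\<And>x. x \<in> carrier M \<Longrightarrow> j x \<in> carrier N"
    and zero: "\<zero>\<^bsub>M\<^esub> \<in> carrier M" "j \<zero>\<^bsub>M\<^esub> = \<zero>\<^bsub>N\<^esub>"
    and add: "\<And>x y. \<lbrakk>x \<in> carrier M; y \<in> carrier M\<rbrakk> \<Longrightarrow> x \<oplus>\<^bsub>M\<^esub> y \<in> carrier M"
      "\<And>x y. \<lbrakk>x \<in> carrier M; y \<in> carrier M\<rbrakk> \<Longrightarrow> j (x \<oplus>\<^bsub>M\<^esub> y) = j x \<oplus>\<^bsub>N\<^esub> j y"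
    and smult: "\<And>a x. \<lbrakk>a \<in> carrier A; x \<in> carrier M\<rbrakk> \<Longrightarrow> a \<odot>\<^bsub>M\<^esub> x \<in> carrier M"
      "\<And>a x. \<lbrakk>a \<in> carrier A; x \<in> carrier M\<rbrakk> \<Longrightarrow> j (a \<odot>\<^bsub>M\<^esub> x) = a \<odot>\<^bsub>N\<^esub> j x"
  shows "left_module A M"
proof -
  interpret N: left_module A N by (rule N)
  have eqI: "x = y" if "j x = j y" "x \<in> carrier M" "y \<in> carrier M" for x y
    using inj that by (auto dest: inj_onD)
  have ag: "abelian_group M"
  proof (rule abelian_groupI)
    fix x assume x: "x \<in> carrier M"
    have "(\<ominus>\<^bsub>A\<^esub> \<one>\<^bsub>A\<^esub>) \<odot>\<^bsub>M\<^esub> x \<oplus>\<^bsub>M\<^esub> x = \<zero>\<^bsub>M\<^esub>"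
      by (rule eqI) (use x in \<open>simp_all add: add smult zero j N.smult_minus_one N.M.l_neg\<close>)
    then show "\<exists>y\<in>carrier M. y \<oplus>\<^bsub>M\<^esub> x = \<zero>\<^bsub>M\<^esub>"
      using smult(1)[OF _ x] by blast
  qed (auto intro!: eqI simp: add zero j N.M.a_ac)
  show ?thesis
    by (rule left_moduleI[OF N.R.ring_axioms ag])
      (auto intro!: eqI simp: add smult j N.smult_l_distr N.smult_r_distr N.smult_assoc1
        N.smult_one)
qed

lemma left_module_imp_module: "cring k \<Longrightarrow> left_module k M \<Longrightarrow> module k M"
  unfolding left_module_def left_module_axioms_def by (auto intro: moduleI)

lemma regular_module_simps [simp]:
  "carrier (regular_module A) = carrier A" "zero (regular_module A) = zero A"
  "add (regular_module A) = add A" "smult (regular_module A) = mult A"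
  by (simp_all add: regular_module_def with_action_def)

lemma left_module_regular:
  assumes "ring A" shows "left_module A (regular_module A)"
proof -
  interpret ring A by (rule assms)
  have "abelian_group (regular_module A)"
    by (rule abelian_groupI) (auto simp: a_ac intro: l_neg)
  then show ?thesis
    by (intro left_moduleI) (auto simp: assms l_distr r_distr m_assoc)
qed

lemma mod_homI:
  assumes "\<And>x. x \<in> carrier M \<Longrightarrow> f x \<in> carrier N"
    and "\<And>x y. \<lbrakk>x \<in> carrier M; y \<in> carrier M\<rbrakk> \<Longrightarrow> f (x \<oplus>\<^bsub>M\<^esub> y) = f x \<oplus>\<^bsub>N\<^esub> f y"
    and "\<And>a x. \<lbrakk>a \<in> carrier A; x \<in> carrier M\<rbrakk> \<Longrightarrow> f (a \<odot>\<^bsub>M\<^esub> x) = a \<odot>\<^bsub>N\<^esub> f x"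
  shows "f \<in> mod_hom A M N"
  using assms unfolding mod_hom_def by auto

lemma mod_hom_closed: "f \<in> mod_hom A M N \<Longrightarrow> x \<in> carrier M \<Longrightarrow> f x \<in> carrier N"
  unfolding mod_hom_def by auto

lemma mod_hom_add:
  "\<lbrakk>f \<in> mod_hom A M N; x \<in> carrier M; y \<in> carrier M\<rbrakk> \<Longrightarrow> f (x \<oplus>\<^bsub>M\<^esub> y) = f x \<oplus>\<^bsub>N\<^esub> f y"
  unfolding mod_hom_def by auto

lemma mod_hom_smult:
  "\<lbrakk>f \<in> mod_hom A M N; a \<in> carrier A; x \<in> carrier M\<rbrakk> \<Longrightarrow> f (a \<odot>\<^bsub>M\<^esub> x) = a \<odot>\<^bsub>N\<^esub> f x"
  unfolding mod_hom_def by auto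

lemma mod_hom_zero:
  assumes "left_module A M" "left_module A N" "f \<in> mod_hom A M N"
  shows "f \<zero>\<^bsub>M\<^esub> = \<zero>\<^bsub>N\<^esub>"
proof -
  interpret M: left_module A M by fact
  interpret N: left_module A N by fact
  have "f \<zero>\<^bsub>M\<^esub> = f \<zero>\<^bsub>M\<^esub> \<oplus>\<^bsub>N\<^esub> f \<zero>\<^bsub>M\<^esub>"
    using mod_hom_add[OF assms(3), of "\<zero>\<^bsub>M\<^esub>" "\<zero>\<^bsub>M\<^esub>"] by simp
  then show ?thesis
    using mod_hom_closed[OF assms(3), of "\<zero>\<^bsub>M\<^esub>"] by simp
qed

lemma mod_hom_minus:
  assumes "left_module A M" "left_module A N" "f \<in> mod_hom A M N" "x \<in> carrier M"
  shows "f (\<ominus>\<^bsub>M\<^esub> x) = \<ominus>\<^bsub>N\<^esub> f x"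
proof -
  interpret M: left_module A M by fact
  interpret N: left_module A N by fact
  show ?thesis
    using mod_hom_smult[OF assms(3) _ assms(4), of "\<ominus>\<^bsub>A\<^esub> \<one>\<^bsub>A\<^esub>"] assms(4)
      mod_hom_closed[OF assms(3,4)]
    by (simp add: M.smult_minus_one N.smult_minus_one)
qed

lemma mod_hom_diff:
  assumes "left_module A M" "left_module A N" "f \<in> mod_hom A M N" "x \<in> carrier M" "y \<in> carrier M"
  shows "f (x \<ominus>\<^bsub>M\<^esub> y) = f x \<ominus>\<^bsub>N\<^esub> f y"
proof -
  interpret M: left_module A M by fact
  interpret N: left_module A N by fact
  show ?thesis
    using assms by (simp add: a_minus_def mod_hom_add mod_hom_minus)
qed

lemma mod_hom_id: "(\<lambda>x. x) \<in> mod_hom A M M"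
  by (rule mod_homI) auto

lemma mod_hom_compose:
  "f \<in> mod_hom A L M \<Longrightarrow> g \<in> mod_hom A M N \<Longrightarrow> (\<lambda>x. g (f x)) \<in> mod_hom A L N"
  by (rule mod_homI) (auto simp: mod_hom_closed mod_hom_add mod_hom_smult)

lemma mod_hom_sum:
  assumes "left_module A N" "f \<in> mod_hom A M N" "g \<in> mod_hom A M N"
  shows "(\<lambda>x. f x \<oplus>\<^bsub>N\<^esub> g x) \<in> mod_hom A M N"
proof -
  interpret N: left_module A N by fact
  show ?thesis
    using assms(2,3)
    by (intro mod_homI) (auto simp: mod_hom_closed mod_hom_add mod_hom_smult N.smult_r_distr N.M.a_ac)
qed

lemma mod_hom_zero_map:
  assumes "left_module A N" shows "(\<lambda>x. \<zero>\<^bsub>N\<^esub>) \<in> mod_hom A M N"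
proof -
  interpret N: left_module A N by fact
  show ?thesis by (rule mod_homI) auto
qed

lemma mod_hom_uminus:
  assumes "left_module A N" "f \<in> mod_hom A M N"
  shows "(\<lambda>x. \<ominus>\<^bsub>N\<^esub> f x) \<in> mod_hom A M N"
proof -
  interpret N: left_module A N by fact
  have "a \<odot>\<^bsub>N\<^esub> (\<ominus>\<^bsub>N\<^esub> x) = \<ominus>\<^bsub>N\<^esub> (a \<odot>\<^bsub>N\<^esub> x)" if "a \<in> carrier A" "x \<in> carrier N" for a x
    by (metis that N.M.add.inv_closed N.M.l_neg N.M.minus_equality N.smult_closed N.smult_r_distr
        N.smult_zero_right)
  then show ?thesis
    using assms(2)
    by (intro mod_homI) (auto simp: mod_hom_closed mod_hom_add mod_hom_smult N.M.minus_add)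
qed

lemma mod_hom_difference:
  assumes "left_module A N" "f \<in> mod_hom A M N" "g \<in> mod_hom A M N"
  shows "(\<lambda>x. f x \<ominus>\<^bsub>N\<^esub> g x) \<in> mod_hom A M N"
  using mod_hom_sum[OF assms(1,2) mod_hom_uminus[OF assms(1,3)]] by (simp add: a_minus_def)

lemma mod_hom_cong:
  assumes "left_module A M" "f \<in> mod_hom A M N" "\<And>x. x \<in> carrier M \<Longrightarrow> g x = f x"
  shows "g \<in> mod_hom A M N"
proof -
  interpret M: left_module A M by fact
  show ?thesis
    using assms(2,3)
    by (intro mod_homI) (auto simp: mod_hom_closed mod_hom_add mod_hom_smult M.smult_closed)
qed

lemma mod_hom_finite_sum:
  assumes "left_module A M" "left_module A N" "\<And>i. i \<in> I \<Longrightarrow> f i \<in> mod_hom A M N"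
  shows "(\<lambda>x. \<Oplus>\<^bsub>N\<^esub>i\<in>I. f i x) \<in> mod_hom A M N"
proof -
  interpret N: left_module A N by fact
  show ?thesis
    using assms(3)
  proof (induction I rule: infinite_finite_induct)
    case (insert i I)
    have 1: "(\<Oplus>\<^bsub>N\<^esub>i\<in>insert i I. f i x) = f i x \<oplus>\<^bsub>N\<^esub> (\<Oplus>\<^bsub>N\<^esub>i\<in>I. f i x)"
      if "x \<in> carrier M" for x
      using insert.hyps mod_hom_closed[OF insert.prems that] by (simp add: Pi_iff)
    have 2: "(\<lambda>x. f i x \<oplus>\<^bsub>N\<^esub> (\<Oplus>\<^bsub>N\<^esub>i\<in>I. f i x)) \<in> mod_hom A M N"
      using insert by (intro mod_hom_sum[OF assms(2)]) auto
    show ?case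
      by (rule mod_hom_cong[OF assms(1) 2 1])
  qed (simp_all add: mod_hom_zero_map[OF assms(2)])
qed

section \<open>Free modules and projective lifting\<close>

lemma free_module_simps [simp]:
  "zero (free_module A S) = (\<lambda>_. \<zero>\<^bsub>A\<^esub>)"
  "add (free_module A S) = (\<lambda>f g s. f s \<oplus>\<^bsub>A\<^esub> g s)"
  "smult (free_module A S) = (\<lambda>a f s. a \<otimes>\<^bsub>A\<^esub> f s)"
  by (simp_all add: free_module_def)

lemma free_module_carrier:
  "f \<in> carrier (free_module A S) \<longleftrightarrow>
    (\<forall>s. f s \<in> carrier A) \<and> (\<forall>s. s \<notin> S \<longrightarrow> f s = \<zero>\<^bsub>A\<^esub>) \<and> finite {s. f s \<noteq> \<zero>\<^bsub>A\<^esub>}"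
  by (simp add: free_module_def)

lemma free_module_carrier_finite:
  assumes "finite S"
  shows "f \<in> carrier (free_module A S) \<longleftrightarrow>
    (\<forall>s. f s \<in> carrier A) \<and> (\<forall>s. s \<notin> S \<longrightarrow> f s = \<zero>\<^bsub>A\<^esub>)"
proof -
  have "finite {s. f s \<noteq> \<zero>\<^bsub>A\<^esub>}" if "\<forall>s. s \<notin> S \<longrightarrow> f s = \<zero>\<^bsub>A\<^esub>"
    by (rule finite_subset[OF _ assms]) (use that in auto)
  then show ?thesis by (auto simp: free_module_carrier)
qed

lemma left_module_free:
  assumes "ring A" shows "left_module A (free_module A S)"
proof -
  interpret ring A by (rule assms)
  have closed: "(\<lambda>s. f s \<oplus>\<^bsub>A\<^esub> g s) \<in> carrier (free_module A S)"
    if "f \<in> carrier (free_module A S)" "g \<in> carrier (free_module A S)" for f g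
  proof -
    have "finite {s. f s \<oplus>\<^bsub>A\<^esub> g s \<noteq> \<zero>\<^bsub>A\<^esub>}"
      by (rule finite_subset[of _ "{s. f s \<noteq> \<zero>\<^bsub>A\<^esub>} \<union> {s. g s \<noteq> \<zero>\<^bsub>A\<^esub>}"])
        (use that in \<open>auto simp: free_module_carrier\<close>)
    then show ?thesis
      using that by (simp add: free_module_carrier)
  qed
  have sclosed: "(\<lambda>s. a \<otimes>\<^bsub>A\<^esub> f s) \<in> carrier (free_module A S)"
    if "f \<in> carrier (free_module A S)" "a \<in> carrier A" for f a
  proof -
    have "finite {s. a \<otimes>\<^bsub>A\<^esub> f s \<noteq> \<zero>\<^bsub>A\<^esub>}"
      by (rule finite_subset[of _ "{s. f s \<noteq> \<zero>\<^bsub>A\<^esub>}"])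
        (use that in \<open>auto simp: free_module_carrier\<close>)
    then show ?thesis
      using that by (simp add: free_module_carrier)
  qed
  have "abelian_group (free_module A S)"
  proof (rule abelian_groupI)
    fix f assume f: "f \<in> carrier (free_module A S)"
    have "(\<lambda>s. (\<ominus>\<^bsub>A\<^esub> \<one>\<^bsub>A\<^esub>) \<otimes>\<^bsub>A\<^esub> f s) \<oplus>\<^bsub>free_module A S\<^esub> f = \<zero>\<^bsub>free_module A S\<^esub>"
      using f by (auto simp: free_module_carrier l_minus l_neg fun_eq_iff)
    then show "\<exists>g\<in>carrier (free_module A S). g \<oplus>\<^bsub>free_module A S\<^esub> f = \<zero>\<^bsub>free_module A S\<^esub>"
      using sclosed[OF f, of "\<ominus>\<^bsub>A\<^esub> \<one>\<^bsub>A\<^esub>"] by auto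
  qed (simp add: closed, auto simp: free_module_carrier a_ac fun_eq_iff)
  then show ?thesis
    by (rule left_moduleI[OF assms])
      (simp add: sclosed, auto simp: free_module_carrier l_distr r_distr m_assoc fun_eq_iff)
qed

lemma free_module_finsum_apply:
  assumes "ring A" "f \<in> I \<rightarrow> carrier (free_module A S)"
  shows "(\<Oplus>\<^bsub>free_module A S\<^esub>i\<in>I. f i) s = (\<Oplus>\<^bsub>A\<^esub>i\<in>I. f i s)"
proof -
  interpret ring A by (rule assms)
  interpret F: left_module A "free_module A S" by (rule left_module_free[OF assms(1)])
  show ?thesis
    using assms(2)
  proof (induction I rule: infinite_finite_induct)
    case (insert i I)
    have "(\<lambda>i. f i s) \<in> I \<rightarrow> carrier A" "f i s \<in> carrier A"
      using insert.prems by (auto simp: free_module_carrier Pi_iff)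
    then show ?case
      using insert by (simp add: Pi_iff)
  qed simp_all
qed

lemma basis_vec_closed:
  assumes "ring A" "s \<in> S" shows "basis_vec A s \<in> carrier (free_module A S)"
proof -
  interpret ring A by (rule assms)
  have "finite {t. basis_vec A s t \<noteq> \<zero>\<^bsub>A\<^esub>}"
    by (rule finite_subset[of _ "{s}"]) (auto simp: basis_vec_def)
  then show ?thesis
    using assms(2) by (auto simp: free_module_carrier basis_vec_def)
qed

lemma free_module_induct:
  assumes A: "ring A" and t: "t \<in> carrier (free_module A S)"
    and zero: "Q (\<lambda>_. \<zero>\<^bsub>A\<^esub>)"
    and add: "\<And>t u. \<lbrakk>t \<in> carrier (free_module A S); u \<in> carrier (free_module A S); Q t; Q u\<rbrakk> \<Longrightarrow>
      Q (t \<oplus>\<^bsub>free_module A S\<^esub> u)"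
    and basis: "\<And>a s. \<lbrakk>a \<in> carrier A; s \<in> S\<rbrakk> \<Longrightarrow> Q (a \<odot>\<^bsub>free_module A S\<^esub> basis_vec A s)"
  shows "Q t"
proof -
  interpret ring A by (rule A)
  interpret F: left_module A "free_module A S" by (rule left_module_free[OF A])
  have "Q t" if "finite F" "t \<in> carrier (free_module A S)" "{s. t s \<noteq> \<zero>\<^bsub>A\<^esub>} \<subseteq> F" for F t
    using that
  proof (induction F arbitrary: t rule: finite_induct)
    case empty
    then have "t = (\<lambda>_. \<zero>\<^bsub>A\<^esub>)" by auto
    then show ?case using zero by simp
  next
    case (insert x F)
    show ?case
    proof (cases "t x = \<zero>\<^bsub>A\<^esub>")
      case True
      then show ?thesis using insert by (intro insert.IH) auto
    next
      case False
      define u where "u = t(x := \<zero>\<^bsub>A\<^esub>)"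
      have x: "x \<in> S" and tx: "t x \<in> carrier A"
        using False insert.prems(1) by (auto simp: free_module_carrier)
      have sub: "{s. u s \<noteq> \<zero>\<^bsub>A\<^esub>} \<subseteq> {s. t s \<noteq> \<zero>\<^bsub>A\<^esub>}" "{s. u s \<noteq> \<zero>\<^bsub>A\<^esub>} \<subseteq> F"
        using insert.prems(2) by (auto simp: u_def)
      have u: "u \<in> carrier (free_module A S)"
        using insert.prems(1) finite_subset[OF sub(1)] by (auto simp: free_module_carrier u_def)
      have eq: "t = u \<oplus>\<^bsub>free_module A S\<^esub> (t x \<odot>\<^bsub>free_module A S\<^esub> basis_vec A x)"
        using insert.prems(1) by (auto simp: u_def basis_vec_def free_module_carrier fun_eq_iff)
      show ?thesis
        by (subst eq, rule add[OF u _ insert.IH[OF u sub(2)] basis[OF tx x]])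
          (rule F.smult_closed[OF tx basis_vec_closed[OF A x]])
    qed
  qed
  then show ?thesis
    using t by (auto simp: free_module_carrier)
qed

definition free_lift ::
    "('a, 'z) ring_scheme \<Rightarrow> ('a, 'v, 'y) module_scheme \<Rightarrow> ('s \<Rightarrow> 'v) \<Rightarrow> ('s \<Rightarrow> 'a) \<Rightarrow> 'v"
  where "free_lift A M q t = (\<Oplus>\<^bsub>M\<^esub>s\<in>{s. t s \<noteq> \<zero>\<^bsub>A\<^esub>}. t s \<odot>\<^bsub>M\<^esub> q s)"

lemma free_lift_eq:
  assumes M: "left_module A M" and q: "q \<in> S \<rightarrow> carrier M"
    and t: "t \<in> carrier (free_module A S)"
    and F: "finite F" "{s. t s \<noteq> \<zero>\<^bsub>A\<^esub>} \<subseteq> F" "F \<subseteq> S"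
  shows "free_lift A M q t = (\<Oplus>\<^bsub>M\<^esub>s\<in>F. t s \<odot>\<^bsub>M\<^esub> q s)"
proof -
  interpret left_module A M by (rule M)
  show ?thesis
    unfolding free_lift_def
    by (rule M.add.finprod_mono_neutral_cong_left)
      (use q t F in \<open>auto simp: free_module_carrier Pi_iff intro!: smult_closed smult_zero_left\<close>)
qed

lemma free_lift_hom:
  assumes M: "left_module A M" and q: "q \<in> S \<rightarrow> carrier M"
  shows "free_lift A M q \<in> mod_hom A (free_module A S) M"
proof -
  interpret left_module A M by (rule M)
  interpret F: left_module A "free_module A S" by (rule left_module_free[OF R.ring_axioms])
  have supp: "finite {s. t s \<noteq> \<zero>\<^bsub>A\<^esub>}" "{s. t s \<noteq> \<zero>\<^bsub>A\<^esub>} \<subseteq> S" "\<And>s. t s \<in> carrier A"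
    if "t \<in> carrier (free_module A S)" for t
    using that by (auto simp: free_module_carrier)
  show ?thesis
  proof (rule mod_homI)
    fix t assume t: "t \<in> carrier (free_module A S)"
    show "free_lift A M q t \<in> carrier M"
      unfolding free_lift_def using supp[OF t] q
      by (intro M.finsum_closed) (auto simp: Pi_iff intro!: smult_closed)
    fix a assume a: "a \<in> carrier A"
    let ?F = "{s. t s \<noteq> \<zero>\<^bsub>A\<^esub>}"
    have at: "a \<odot>\<^bsub>free_module A S\<^esub> t \<in> carrier (free_module A S)"
      by (rule F.smult_closed[OF a t])
    have "free_lift A M q (a \<odot>\<^bsub>free_module A S\<^esub> t) =
        (\<Oplus>\<^bsub>M\<^esub>s\<in>?F. (a \<odot>\<^bsub>free_module A S\<^esub> t) s \<odot>\<^bsub>M\<^esub> q s)"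
      by (rule free_lift_eq[OF M q at supp(1)[OF t] _ supp(2)[OF t]]) (auto simp: a)
    also have "\<dots> = (\<Oplus>\<^bsub>M\<^esub>s\<in>?F. a \<odot>\<^bsub>M\<^esub> (t s \<odot>\<^bsub>M\<^esub> q s))"
      by (rule M.finsum_cong') (use supp[OF t] q a in \<open>auto simp: Pi_iff smult_assoc1 intro!: smult_closed\<close>)
    also have "\<dots> = a \<odot>\<^bsub>M\<^esub> free_lift A M q t"
      unfolding free_lift_def
      by (rule smult_finsum[symmetric, OF a]) (use supp[OF t] q in \<open>auto simp: Pi_iff intro!: smult_closed\<close>)
    finally show "free_lift A M q (a \<odot>\<^bsub>free_module A S\<^esub> t) = a \<odot>\<^bsub>M\<^esub> free_lift A M q t" .
  next
    fix t u assume t: "t \<in> carrier (free_module A S)" and u: "u \<in> carrier (free_module A S)"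
    let ?F = "{s. t s \<noteq> \<zero>\<^bsub>A\<^esub>} \<union> {s. u s \<noteq> \<zero>\<^bsub>A\<^esub>}"
    have F: "finite ?F" "?F \<subseteq> S" using supp[OF t] supp[OF u] by auto
    have tu: "t \<oplus>\<^bsub>free_module A S\<^esub> u \<in> carrier (free_module A S)"
      by (rule F.M.a_closed[OF t u])
    have "free_lift A M q (t \<oplus>\<^bsub>free_module A S\<^esub> u) = 
        (\<Oplus>\<^bsub>M\<^esub>s\<in>?F. (t \<oplus>\<^bsub>free_module A S\<^esub> u) s \<odot>\<^bsub>M\<^esub> q s)"
      by (rule free_lift_eq[OF M q tu F(1) _ F(2)]) auto
    also have "\<dots> = (\<Oplus>\<^bsub>M\<^esub>s\<in>?F. t s \<odot>\<^bsub>M\<^esub> q s \<oplus>\<^bsub>M\<^esub> u s \<odot>\<^bsub>M\<^esub> q s)"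
      by (rule M.finsum_cong')
        (use F(2) supp[OF t] supp[OF u] q in \<open>auto simp: Pi_iff subset_iff smult_l_distr intro!: smult_closed M.a_closed\<close>)
    also have "\<dots> = (\<Oplus>\<^bsub>M\<^esub>s\<in>?F. t s \<odot>\<^bsub>M\<^esub> q s) \<oplus>\<^bsub>M\<^esub> (\<Oplus>\<^bsub>M\<^esub>s\<in>?F. u s \<odot>\<^bsub>M\<^esub> q s)"
      by (rule M.finsum_addf)
        (use F(2) supp[OF t] supp[OF u] q in \<open>auto simp: Pi_iff subset_iff intro!: smult_closed\<close>)
    also have "\<dots> = free_lift A M q t \<oplus>\<^bsub>M\<^esub> free_lift A M q u"
      using free_lift_eq[OF M q t F(1) _ F(2)] free_lift_eq[OF M q u F(1) _ F(2)] by simp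
    finally show "free_lift A M q (t \<oplus>\<^bsub>free_module A S\<^esub> u) = free_lift A M q t \<oplus>\<^bsub>M\<^esub> free_lift A M q u" .
  qed
qed

lemma free_lift_basis:
  assumes M: "left_module A M" and q: "q \<in> S \<rightarrow> carrier M" and s: "s \<in> S"
  shows "free_lift A M q (basis_vec A s) = q s"
proof -
  interpret left_module A M by (rule M)
  have "free_lift A M q (basis_vec A s) = (\<Oplus>\<^bsub>M\<^esub>t\<in>{s}. basis_vec A s t \<odot>\<^bsub>M\<^esub> q t)"
    by (rule free_lift_eq[OF M q basis_vec_closed[OF R.ring_axioms s]])
      (use s in \<open>auto simp: basis_vec_def\<close>)
  then show ?thesis
    using q s by (auto simp: basis_vec_def smult_one Pi_iff)
qed

lemma mod_hom_free_eqI: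
  assumes M: "left_module A M"
    and f: "f \<in> mod_hom A (free_module A S) M" and g: "g \<in> mod_hom A (free_module A S) M"
    and eq: "\<And>s. s \<in> S \<Longrightarrow> f (basis_vec A s) = g (basis_vec A s)"
    and t: "t \<in> carrier (free_module A S)"
  shows "f t = g t"
proof -
  interpret left_module A M by (rule M)
  have F: "left_module A (free_module A S)" by (rule left_module_free[OF R.ring_axioms])
  show ?thesis
  proof (rule free_module_induct[where Q = "\<lambda>t. f t = g t", OF R.ring_axioms t])
    show "f (\<lambda>_. \<zero>\<^bsub>A\<^esub>) = g (\<lambda>_. \<zero>\<^bsub>A\<^esub>)"
      using mod_hom_zero[OF F M f] mod_hom_zero[OF F M g] by simp
    show "f (t \<oplus>\<^bsub>free_module A S\<^esub> u) = g (t \<oplus>\<^bsub>free_module A S\<^esub> u)"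
      if "t \<in> carrier (free_module A S)" "u \<in> carrier (free_module A S)" "f t = g t" "f u = g u"
      for t u
      using that mod_hom_add[OF f] mod_hom_add[OF g] by metis
    show "f (a \<odot>\<^bsub>free_module A S\<^esub> basis_vec A s) = g (a \<odot>\<^bsub>free_module A S\<^esub> basis_vec A s)"
      if "a \<in> carrier A" "s \<in> S" for a s
      using that mod_hom_smult[OF f] mod_hom_smult[OF g] eq basis_vec_closed[OF R.ring_axioms]
      by metis
  qed
qed

lemma mod_hom_free_unique:
  assumes "left_module A M" and f: "f \<in> mod_hom A (free_module A S) M"
    and "t \<in> carrier (free_module A S)"
  shows "f t = free_lift A M (\<lambda>s. f (basis_vec A s)) t"
proof -
  interpret left_module A M by fact
  have q: "(\<lambda>s. f (basis_vec A s)) \<in> S \<rightarrow> carrier M"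
    by (auto intro: mod_hom_closed[OF f] basis_vec_closed[OF R.ring_axioms])
  show ?thesis
    by (rule mod_hom_free_eqI[OF assms(1) f free_lift_hom[OF assms(1) q] _ assms(3)])
      (simp add: free_lift_basis[OF assms(1) q])
qed

text \<open>
  Projectivity asks for a basis set inside the type of elements of the module, so the free module on
  \<open>S\<close> is exhibited as a retract of the free module on its own set of basis vectors.
\<close>

lemma projective_free:
  assumes A: "ring A" shows "projective_module A (free_module A S)"
proof -
  interpret ring A by (rule A)
  let ?F = "free_module A S"
  let ?T = "basis_vec A ` S"
  have F: "left_module A ?F" by (rule left_module_free[OF A])
  have FT: "left_module A (free_module A ?T)" by (rule left_module_free[OF A])
  define i where "i = free_lift A (free_module A ?T) (\<lambda>s. basis_vec A (basis_vec A s))"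
  define p where "p = free_lift A ?F (\<lambda>b. b)"
  have q1: "(\<lambda>s. basis_vec A (basis_vec A s)) \<in> S \<rightarrow> carrier (free_module A ?T)"
    by (auto intro: basis_vec_closed[OF A])
  have q2: "(\<lambda>b. b) \<in> ?T \<rightarrow> carrier ?F"
    by (auto intro: basis_vec_closed[OF A])
  have i: "i \<in> mod_hom A ?F (free_module A ?T)" unfolding i_def by (rule free_lift_hom[OF FT q1])
  have p: "p \<in> mod_hom A (free_module A ?T) ?F" unfolding p_def by (rule free_lift_hom[OF F q2])
  have "p (i t) = t" if "t \<in> carrier ?F" for t
  proof (rule mod_hom_free_eqI[OF F mod_hom_compose[OF i p] mod_hom_id _ that])
    fix s assume "s \<in> S"
    then show "p (i (basis_vec A s)) = basis_vec A s"
      unfolding i_def p_def by (simp add: free_lift_basis[OF FT q1] free_lift_basis[OF F q2])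
  qed
  then show ?thesis
    unfolding projective_module_def using F i p by blast
qed

lemma projective_lift:
  fixes P :: "('a, 'v, 'y) module_scheme"
  assumes P: "projective_module A P" and Q: "left_module A Q" and N: "left_module A N"
    and g: "g \<in> mod_hom A Q N" and f: "f \<in> mod_hom A P N"
    and im: "\<And>x. x \<in> carrier P \<Longrightarrow> f x \<in> g ` carrier Q"
  shows "\<exists>h\<in>mod_hom A P Q. \<forall>x\<in>carrier P. g (h x) = f x"
proof -
  interpret Q: left_module A Q by (rule Q)
  obtain S :: "'v set" and i p where i: "i \<in> mod_hom A P (free_module A S)" and p: "p \<in> mod_hom A (free_module A S) P"
    and pi: "\<And>x. x \<in> carrier P \<Longrightarrow> p (i x) = x"
    using P unfolding projective_module_def by blast
  have "\<exists>q. q \<in> carrier Q \<and> g q = f (p (basis_vec A s))" if "s \<in> S" for s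
    using im[OF mod_hom_closed[OF p basis_vec_closed[OF Q.R.ring_axioms that]]] by force
  then obtain q where q: "\<And>s. s \<in> S \<Longrightarrow> q s \<in> carrier Q"
    "\<And>s. s \<in> S \<Longrightarrow> g (q s) = f (p (basis_vec A s))"
    by metis
  have q': "q \<in> S \<rightarrow> carrier Q" using q by auto
  let ?l = "free_lift A Q q"
  have l: "?l \<in> mod_hom A (free_module A S) Q" by (rule free_lift_hom[OF Q q'])
  have "g (?l t) = f (p t)" if "t \<in> carrier (free_module A S)" for t
    by (rule mod_hom_free_eqI[OF N mod_hom_compose[OF l g] mod_hom_compose[OF p f] _ that])
      (simp add: free_lift_basis[OF Q q'] q)
  then have "\<forall>x\<in>carrier P. g (?l (i x)) = f x"
    using mod_hom_closed[OF i] pi by simp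
  then show ?thesis
    by (intro bexI[OF _ mod_hom_compose[OF i l]])
qed

section \<open>Exactness of Hom complexes and Ext\<close>

lemma projective_imp_left_module: "projective_module A P \<Longrightarrow> left_module A P"
  by (simp add: projective_module_def)

text \<open>
  The sequence \<open>Hom(P i, N) \<rightarrow> Hom(P (i + 1), N) \<rightarrow> Hom(P (i + 2), N)\<close> is exact in the middle,
  that is, \<open>Ext\<close> in degree \<open>i + 1\<close> vanishes.
\<close>

definition Hom_exact_at ::
    "('a, 'z) ring_scheme \<Rightarrow> (nat \<Rightarrow> ('a, 'p) module) \<Rightarrow> (nat \<Rightarrow> 'p \<Rightarrow> 'p) \<Rightarrow>
      ('a, 'w, 'y) module_scheme \<Rightarrow> nat \<Rightarrow> bool"
  where "Hom_exact_at A P d N i \<longleftrightarrow>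
    (\<forall>f\<in>mod_hom A (P (Suc i)) N.
      (\<forall>x\<in>carrier (P (Suc (Suc i))). f (d (Suc i) x) = \<zero>\<^bsub>N\<^esub>) \<longrightarrow>
      (\<exists>g\<in>mod_hom A (P i) N. \<forall>x\<in>carrier (P (Suc i)). f x = g (d i x)))"

lemma Hom_exact_atD:
  assumes "Hom_exact_at A P d N i" "f \<in> mod_hom A (P (Suc i)) N"
    and "\<And>x. x \<in> carrier (P (Suc (Suc i))) \<Longrightarrow> f (d (Suc i) x) = \<zero>\<^bsub>N\<^esub>"
  obtains g where "g \<in> mod_hom A (P i) N" "\<And>x. x \<in> carrier (P (Suc i)) \<Longrightarrow> f x = g (d i x)"
  using assms unfolding Hom_exact_at_def by blast

lemma group_hom_group:
  assumes L: "left_module A L" and N: "left_module A N"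
  shows "group (hom_group A L N)"
proof -
  interpret L: left_module A L by fact
  interpret N: left_module A N by fact
  have restr: "restrict f (carrier L) \<in> carrier (hom_group A L N)" if "f \<in> mod_hom A L N" for f
    using mod_hom_cong[OF L that] by (simp add: hom_group_def)
  have hom: "f \<in> mod_hom A L N" "f \<in> extensional (carrier L)" if "f \<in> carrier (hom_group A L N)" for f
    using that by (auto simp: hom_group_def)
  show ?thesis
  proof (rule groupI)
    fix f g assume fg: "f \<in> carrier (hom_group A L N)" "g \<in> carrier (hom_group A L N)"
    show "f \<otimes>\<^bsub>hom_group A L N\<^esub> g \<in> carrier (hom_group A L N)"
      using restr[OF mod_hom_sum[OF N hom(1)[OF fg(1)] hom(1)[OF fg(2)]]]
      by (simp add: hom_group_def)
    fix h assume h: "h \<in> carrier (hom_group A L N)"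
    show "f \<otimes>\<^bsub>hom_group A L N\<^esub> g \<otimes>\<^bsub>hom_group A L N\<^esub> h =
        f \<otimes>\<^bsub>hom_group A L N\<^esub> (g \<otimes>\<^bsub>hom_group A L N\<^esub> h)"
      using fg h by (auto simp: hom_group_def mod_hom_closed N.M.a_assoc intro!: restrict_ext)
  next
    show "\<one>\<^bsub>hom_group A L N\<^esub> \<in> carrier (hom_group A L N)"
      using restr[OF mod_hom_zero_map[OF N]] by (simp add: hom_group_def)
  next
    fix f assume f: "f \<in> carrier (hom_group A L N)"
    show "\<one>\<^bsub>hom_group A L N\<^esub> \<otimes>\<^bsub>hom_group A L N\<^esub> f = f"
      using hom[OF f] by (auto simp: hom_group_def mod_hom_closed extensional_def fun_eq_iff)
    have "restrict (\<lambda>x. \<ominus>\<^bsub>N\<^esub> f x) (carrier L) \<otimes>\<^bsub>hom_group A L N\<^esub> f = \<one>\<^bsub>hom_group A L N\<^esub>"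
      using hom[OF f] by (auto simp: hom_group_def mod_hom_closed N.M.l_neg intro!: restrict_ext)
    then show "\<exists>g\<in>carrier (hom_group A L N). g \<otimes>\<^bsub>hom_group A L N\<^esub> f = \<one>\<^bsub>hom_group A L N\<^esub>"
      using restr[OF mod_hom_uminus[OF N hom(1)[OF f]]] by blast
  qed
qed

lemma mem_cocycles:
  "f \<in> cocycles A P d N j \<longleftrightarrow> f \<in> mod_hom A (P j) N \<and> f \<in> extensional (carrier (P j)) \<and>
    (\<forall>x\<in>carrier (P (Suc j)). f (d j x) = \<zero>\<^bsub>N\<^esub>)"
  by (auto simp: cocycles_def kernel_def hom_group_def compose_def fun_eq_iff)

lemma subgroup_cocycles:
  assumes L: "left_module A (P j)" and L': "left_module A (P (Suc j))" and N: "left_module A N"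
    and d: "d j \<in> mod_hom A (P (Suc j)) (P j)"
  shows "subgroup (cocycles A P d N j) (hom_group A (P j) N)"
proof -
  let ?\<phi> = "\<lambda>f. compose (carrier (P (Suc j))) f (d j)"
  interpret L': left_module A "P (Suc j)" by fact
  have "?\<phi> \<in> hom (hom_group A (P j) N) (hom_group A (P (Suc j)) N)"
  proof (rule homI)
    fix f assume "f \<in> carrier (hom_group A (P j) N)"
    then have f: "f \<in> mod_hom A (P j) N" by (simp add: hom_group_def)
    have "?\<phi> f \<in> mod_hom A (P (Suc j)) N"
      by (rule mod_hom_cong[OF L' mod_hom_compose[OF d f]]) (simp add: compose_def)
    then show "?\<phi> f \<in> carrier (hom_group A (P (Suc j)) N)"
      by (simp add: hom_group_def)
  next
    fix f g
    show "?\<phi> (f \<otimes>\<^bsub>hom_group A (P j) N\<^esub> g) = ?\<phi> f \<otimes>\<^bsub>hom_group A (P (Suc j)) N\<^esub> ?\<phi> g"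
      using mod_hom_closed[OF d] by (auto simp: hom_group_def compose_def fun_eq_iff)
  qed
  then have "group_hom (hom_group A (P j) N) (hom_group A (P (Suc j)) N) ?\<phi>"
    by (intro group_hom.intro group_hom_axioms.intro group_hom_group L L' N)
  then show ?thesis
    unfolding cocycles_def by (rule group_hom.subgroup_kernel)
qed

text \<open>
  The class of a cocycle \<open>f\<close> is the coset of the coboundaries that contains \<open>f\<close>, so the quotient is
  trivial if and only if every cocycle is a coboundary.  Passing between maps on the carrier and
  extensional functions does not change either condition.
\<close>

lemma trivial_Ext_group_iff:
  assumes L: "\<And>i. left_module A (P i)" and N: "left_module A N"
    and d: "\<And>i. d i \<in> mod_hom A (P (Suc i)) (P i)"
    and dd: "\<And>i x. x \<in> carrier (P (Suc (Suc i))) \<Longrightarrow> d i (d (Suc i) x) = \<zero>\<^bsub>P i\<^esub>"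
  shows "trivial_group (Ext_group A P d N (Suc i)) \<longleftrightarrow> Hom_exact_at A P d N i"
proof -
  interpret N: left_module A N by fact
  let ?H = "hom_group A (P (Suc i)) N"
  let ?Z = "cocycles A P d N (Suc i)"
  let ?B = "coboundaries A P d N (Suc i)"
  interpret H: group ?H by (rule group_hom_group[OF L N])
  have Z: "subgroup ?Z ?H" by (intro subgroup_cocycles L N d)
  interpret ZG: group "?H\<lparr>carrier := ?Z\<rparr>" by (rule subgroup.subgroup_is_group[OF Z H.is_group])
  have mem_B: "f \<in> ?B \<longleftrightarrow> f \<in> extensional (carrier (P (Suc i))) \<and>
      (\<exists>g\<in>mod_hom A (P i) N. \<forall>x\<in>carrier (P (Suc i)). f x = g (d i x))" for f
  proof (intro iffI conjI)
    assume "f \<in> extensional (carrier (P (Suc i))) \<and>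
      (\<exists>g\<in>mod_hom A (P i) N. \<forall>x\<in>carrier (P (Suc i)). f x = g (d i x))"
    then obtain g where f: "f \<in> extensional (carrier (P (Suc i)))" and g: "g \<in> mod_hom A (P i) N"
      and fg: "\<And>x. x \<in> carrier (P (Suc i)) \<Longrightarrow> f x = g (d i x)" by blast
    have "restrict g (carrier (P i)) \<in> mod_hom A (P i) N"
      by (rule mod_hom_cong[OF L g]) simp
    moreover have "f = compose (carrier (P (Suc i))) (restrict g (carrier (P i))) (d i)"
      using f fg mod_hom_closed[OF d] by (auto simp: compose_def extensional_def fun_eq_iff)
    ultimately show "f \<in> ?B"
      by (auto simp: hom_group_def intro!: image_eqI)
  qed (auto simp: hom_group_def compose_def)
  have BZ: "?B \<subseteq> ?Z"
  proof
    fix f assume f: "f \<in> ?B"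
    then obtain g where g: "g \<in> mod_hom A (P i) N"
      and fg: "\<And>x. x \<in> carrier (P (Suc i)) \<Longrightarrow> f x = g (d i x)" 
      and ext: "f \<in> extensional (carrier (P (Suc i)))" by (auto simp only: mem_B)
    have "f \<in> mod_hom A (P (Suc i)) N"
      by (rule mod_hom_cong[OF L mod_hom_compose[OF d g] fg])
    moreover have "f (d (Suc i) x) = \<zero>\<^bsub>N\<^esub>" if "x \<in> carrier (P (Suc (Suc i)))" for x
      using fg[OF mod_hom_closed[OF d that]] dd[OF that] mod_hom_zero[OF L N g] by simp
    ultimately show "f \<in> ?Z"
      using ext by (simp add: mem_cocycles)
  qed
  have "trivial_group (Ext_group A P d N (Suc i)) \<longleftrightarrow> ?Z \<subseteq> ?B"
  proof
    assume triv: "trivial_group (Ext_group A P d N (Suc i))"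
    show "?Z \<subseteq> ?B"
    proof
      fix f assume f: "f \<in> ?Z"
      then have "?B #>\<^bsub>?H\<lparr>carrier := ?Z\<rparr>\<^esub> f = ?B"
        using triv by (auto simp: trivial_group_def Ext_group_def FactGroup_def RCOSETS_def
            simp del: coboundaries.simps)
      moreover have "\<one>\<^bsub>?H\<^esub> \<in> ?B"
        unfolding mem_B using mod_hom_zero_map[OF N] by (auto simp: hom_group_def intro!: bexI)
      then have "\<one>\<^bsub>?H\<^esub> \<otimes>\<^bsub>?H\<^esub> f \<in> ?B #>\<^bsub>?H\<lparr>carrier := ?Z\<rparr>\<^esub> f"
        by (auto simp: r_coset_def simp del: coboundaries.simps)
      moreover have "\<one>\<^bsub>?H\<^esub> \<otimes>\<^bsub>?H\<^esub> f = f"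
        using f subgroup.subset[OF Z] by (intro H.l_one) auto
      ultimately show "f \<in> ?B" by simp
    qed
  next
    assume "?Z \<subseteq> ?B"
    then have eq: "?B = carrier (?H\<lparr>carrier := ?Z\<rparr>)" using BZ by auto
    have sub: "subgroup ?Z (?H\<lparr>carrier := ?Z\<rparr>)"
      using ZG.subgroup_self by simp
    have norm: "?Z \<lhd> ?H\<lparr>carrier := ?Z\<rparr>"
      by (rule ZG.normalI) (use sub subgroup.subset[OF Z] in \<open>auto simp: subset_iff H.coset_join2[OF _ Z] H.coset_join3[OF _ Z]\<close>)
    have "carrier (?H\<lparr>carrier := ?Z\<rparr> Mod ?Z) = {?Z}"
      using ZG.coset_join2[OF _ sub] ZG.one_closed by (force simp: FactGroup_def RCOSETS_def)
    then show "trivial_group (Ext_group A P d N (Suc i))"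
      using normal.factorgroup_is_group[OF norm] eq
      by (simp add: trivial_group_def Ext_group_def FactGroup_def del: coboundaries.simps)
  qed
  also have "\<dots> \<longleftrightarrow> Hom_exact_at A P d N i"
  proof
    assume ZB: "?Z \<subseteq> ?B"
    show "Hom_exact_at A P d N i"
      unfolding Hom_exact_at_def
    proof (intro ballI impI)
      fix f assume f: "f \<in> mod_hom A (P (Suc i)) N"
        and cocycle: "\<forall>x\<in>carrier (P (Suc (Suc i))). f (d (Suc i) x) = \<zero>\<^bsub>N\<^esub>"
      have "restrict f (carrier (P (Suc i))) \<in> ?Z"
        using mod_hom_cong[OF L f] cocycle mod_hom_closed[OF d] by (simp add: mem_cocycles)
      then have "restrict f (carrier (P (Suc i))) \<in> ?B"
        using ZB by blast
      then show "\<exists>g\<in>mod_hom A (P i) N. \<forall>x\<in>carrier (P (Suc i)). f x = g (d i x)"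
        unfolding mem_B by auto
    qed
  next
    assume "Hom_exact_at A P d N i"
    then show "?Z \<subseteq> ?B"
      unfolding Hom_exact_at_def by (auto simp only: mem_B mem_cocycles)
  qed
  finally show ?thesis .
qed

locale projective_complex =
  fixes A :: "('a, 'z) ring_scheme" and P :: "nat \<Rightarrow> ('a, 'p) module" and d :: "nat \<Rightarrow> 'p \<Rightarrow> 'p"
  assumes proj: "projective_module A (P i)"
    and d_hom: "d i \<in> mod_hom A (P (Suc i)) (P i)"
    and d_d: "x \<in> carrier (P (Suc (Suc i))) \<Longrightarrow> d i (d (Suc i) x) = \<zero>\<^bsub>P i\<^esub>"
begin

lemma P_left_module: "left_module A (P i)"
  by (rule projective_imp_left_module[OF proj])

definition Hom_exact :: "('a, 'w, 'y) module_scheme \<Rightarrow> bool"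
  where "Hom_exact N \<longleftrightarrow> (\<forall>i. Hom_exact_at A P d N i)"

lemma Hom_exactD:
  assumes "Hom_exact N" "f \<in> mod_hom A (P (Suc i)) N"
    and "\<And>x. x \<in> carrier (P (Suc (Suc i))) \<Longrightarrow> f (d (Suc i) x) = \<zero>\<^bsub>N\<^esub>"
  obtains g where "g \<in> mod_hom A (P i) N" "\<And>x. x \<in> carrier (P (Suc i)) \<Longrightarrow> f x = g (d i x)"
proof -
  have "Hom_exact_at A P d N i"
    using assms(1) by (simp add: Hom_exact_def)
  from Hom_exact_atD[OF this assms(2,3)] show ?thesis
    using that by blast
qed

lemma Hom_exactI:
  assumes "\<And>i f. \<lbrakk>f \<in> mod_hom A (P (Suc i)) N;
      \<And>x. x \<in> carrier (P (Suc (Suc i))) \<Longrightarrow> f (d (Suc i) x) = \<zero>\<^bsub>N\<^esub>\<rbrakk> \<Longrightarrow>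
      \<exists>g\<in>mod_hom A (P i) N. \<forall>x\<in>carrier (P (Suc i)). f x = g (d i x)"
  shows "Hom_exact N"
  using assms unfolding Hom_exact_def Hom_exact_at_def by blast

text \<open>
  For \<open>0 \<rightarrow> N' \<rightarrow> N \<rightarrow> N'' \<rightarrow> 0\<close> exact, these are the parts of the long exact sequence that bound the
  middle term by the outer ones and the right term by the other two.  Both are diagram chases: maps
  from the projective modules of the complex into \<open>N''\<close> lift along \<open>\<pi>\<close>, and maps into the kernel of
  \<open>\<pi>\<close> lift along \<open>\<iota>\<close>.
\<close>

lemma Hom_exact_extension:
  assumes N': "left_module A N'" and N: "left_module A N" and N'': "left_module A N''"
    and \<iota>: "\<iota> \<in> mod_hom A N' N" "inj_on \<iota> (carrier N')"
    and \<pi>: "\<pi> \<in> mod_hom A N N''" "\<pi> ` carrier N = carrier N''"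
    and exact: "\<And>x. x \<in> carrier N \<Longrightarrow> \<pi> x = \<zero>\<^bsub>N''\<^esub> \<Longrightarrow> x \<in> \<iota> ` carrier N'"
    and H': "Hom_exact N'" and H'': "Hom_exact N''"
  shows "Hom_exact N"
proof (rule Hom_exactI)
  interpret N': left_module A N' by fact
  interpret N: left_module A N by fact
  interpret N'': left_module A N'' by fact
  fix i f assume f: "f \<in> mod_hom A (P (Suc i)) N"
    and cocycle: "\<And>x. x \<in> carrier (P (Suc (Suc i))) \<Longrightarrow> f (d (Suc i) x) = \<zero>\<^bsub>N\<^esub>"
  obtain h where h: "h \<in> mod_hom A (P i) N''" 
    and fh: "\<And>x. x \<in> carrier (P (Suc i)) \<Longrightarrow> \<pi> (f x) = h (d i x)"
    using Hom_exactD[OF H'' mod_hom_compose[OF f \<pi>(1)]] cocycle mod_hom_zero[OF N N'' \<pi>(1)] by metis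
  obtain h' where h': "h' \<in> mod_hom A (P i) N" and hh': "\<And>x. x \<in> carrier (P i) \<Longrightarrow> \<pi> (h' x) = h x"
    using projective_lift[OF proj N N'' \<pi>(1) h] mod_hom_closed[OF h] \<pi>(2) by blast
  let ?u = "\<lambda>x. f x \<ominus>\<^bsub>N\<^esub> h' (d i x)"
  have u: "?u \<in> mod_hom A (P (Suc i)) N"
    by (rule mod_hom_difference[OF N f mod_hom_compose[OF d_hom h']])
  have "\<pi> (?u x) = \<zero>\<^bsub>N''\<^esub>" if x: "x \<in> carrier (P (Suc i))" for x
  proof -
    have "\<pi> (?u x) = \<pi> (f x) \<ominus>\<^bsub>N''\<^esub> \<pi> (h' (d i x))"
      by (intro mod_hom_diff[OF N N'' \<pi>(1)] mod_hom_closed[OF f] mod_hom_closed[OF h']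
          mod_hom_closed[OF d_hom] x)
    also have "\<dots> = h (d i x) \<ominus>\<^bsub>N''\<^esub> h (d i x)"
      using fh[OF x] hh'[OF mod_hom_closed[OF d_hom x]] by simp
    finally show ?thesis
      using mod_hom_closed[OF h mod_hom_closed[OF d_hom x]] by (simp add: a_minus_def N''.M.r_neg)
  qed
  then have "?u x \<in> \<iota> ` carrier N'" if "x \<in> carrier (P (Suc i))" for x
    using exact mod_hom_closed[OF u] that by blast
  then obtain v where v: "v \<in> mod_hom A (P (Suc i)) N'"
    and vu: "\<And>x. x \<in> carrier (P (Suc i)) \<Longrightarrow> \<iota> (v x) = ?u x"
    using projective_lift[OF proj N' N \<iota>(1) u] by blast
  have "v (d (Suc i) x) = \<zero>\<^bsub>N'\<^esub>" if x: "x \<in> carrier (P (Suc (Suc i)))" for x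
  proof -
    have dx: "d (Suc i) x \<in> carrier (P (Suc i))" by (rule mod_hom_closed[OF d_hom x])
    have "\<iota> (v (d (Suc i) x)) = \<iota> \<zero>\<^bsub>N'\<^esub>"
      using vu[OF dx] cocycle[OF x] d_d[OF x] mod_hom_zero[OF P_left_module N h']
        mod_hom_zero[OF N' N \<iota>(1)] by (simp add: a_minus_def)
    then show ?thesis
      using \<iota>(2) mod_hom_closed[OF v dx] by (auto dest: inj_onD)
  qed
  then obtain g where g: "g \<in> mod_hom A (P i) N'"
    and vg: "\<And>x. x \<in> carrier (P (Suc i)) \<Longrightarrow> v x = g (d i x)"
    using Hom_exactD[OF H' v] by blast
  let ?w = "\<lambda>x. \<iota> (g x) \<oplus>\<^bsub>N\<^esub> h' x"
  have "f x = ?w (d i x)" if x: "x \<in> carrier (P (Suc i))" for x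
  proof -
    have "\<iota> (g (d i x)) = f x \<ominus>\<^bsub>N\<^esub> h' (d i x)"
      using vu[OF x] vg[OF x] by simp
    then show ?thesis
      using mod_hom_closed[OF f x] mod_hom_closed[OF h' mod_hom_closed[OF d_hom x]]
      by (simp add: a_minus_def N.M.a_assoc N.M.l_neg)
  qed
  then show "\<exists>g\<in>mod_hom A (P i) N. \<forall>x\<in>carrier (P (Suc i)). f x = g (d i x)"
    by (intro bexI[OF _ mod_hom_sum[OF N mod_hom_compose[OF g \<iota>(1)] h']]) auto
qed

lemma Hom_exact_quotient:
  assumes N': "left_module A N'" and N: "left_module A N" and N'': "left_module A N''"
    and \<iota>: "\<iota> \<in> mod_hom A N' N" "inj_on \<iota> (carrier N')"
    and \<pi>: "\<pi> \<in> mod_hom A N N''" "\<pi> ` carrier N = carrier N''"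
    and \<pi>\<iota>: "\<And>x. x \<in> carrier N' \<Longrightarrow> \<pi> (\<iota> x) = \<zero>\<^bsub>N''\<^esub>"
    and exact: "\<And>x. x \<in> carrier N \<Longrightarrow> \<pi> x = \<zero>\<^bsub>N''\<^esub> \<Longrightarrow> x \<in> \<iota> ` carrier N'"
    and H': "Hom_exact N'" and H: "Hom_exact N"
  shows "Hom_exact N''"
proof (rule Hom_exactI)
  interpret N': left_module A N' by fact
  interpret N: left_module A N by fact
  interpret N'': left_module A N'' by fact
  fix i f assume f: "f \<in> mod_hom A (P (Suc i)) N''"
    and cocycle: "\<And>x. x \<in> carrier (P (Suc (Suc i))) \<Longrightarrow> f (d (Suc i) x) = \<zero>\<^bsub>N''\<^esub>"
  obtain u where u: "u \<in> mod_hom A (P (Suc i)) N"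
    and fu: "\<And>x. x \<in> carrier (P (Suc i)) \<Longrightarrow> \<pi> (u x) = f x"
    using projective_lift[OF proj N N'' \<pi>(1) f] mod_hom_closed[OF f] \<pi>(2) by blast
  have ud: "(\<lambda>x. u (d (Suc i) x)) \<in> mod_hom A (P (Suc (Suc i))) N"
    by (rule mod_hom_compose[OF d_hom u])
  have "u (d (Suc i) x) \<in> \<iota> ` carrier N'" if x: "x \<in> carrier (P (Suc (Suc i)))" for x
    using exact[OF mod_hom_closed[OF ud x]] fu[OF mod_hom_closed[OF d_hom x]] cocycle[OF x] by simp
  then obtain v where v: "v \<in> mod_hom A (P (Suc (Suc i))) N'"
    and vu: "\<And>x. x \<in> carrier (P (Suc (Suc i))) \<Longrightarrow> \<iota> (v x) = u (d (Suc i) x)"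
    using projective_lift[OF proj N' N \<iota>(1) ud] by blast
  have "v (d (Suc (Suc i)) x) = \<zero>\<^bsub>N'\<^esub>" if x: "x \<in> carrier (P (Suc (Suc (Suc i))))" for x
  proof -
    have dx: "d (Suc (Suc i)) x \<in> carrier (P (Suc (Suc i)))" by (rule mod_hom_closed[OF d_hom x])
    have "\<iota> (v (d (Suc (Suc i)) x)) = \<iota> \<zero>\<^bsub>N'\<^esub>"
      using vu[OF dx] d_d[OF x] mod_hom_zero[OF P_left_module N u] mod_hom_zero[OF N' N \<iota>(1)]
      by simp
    then show ?thesis
      using \<iota>(2) mod_hom_closed[OF v dx] by (auto dest: inj_onD)
  qed
  then obtain w where w: "w \<in> mod_hom A (P (Suc i)) N'"
    and vw: "\<And>x. x \<in> carrier (P (Suc (Suc i))) \<Longrightarrow> v x = w (d (Suc i) x)"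
    using Hom_exactD[OF H' v] by blast
  let ?z = "\<lambda>x. u x \<ominus>\<^bsub>N\<^esub> \<iota> (w x)"
  have z: "?z \<in> mod_hom A (P (Suc i)) N"
    by (rule mod_hom_difference[OF N u mod_hom_compose[OF w \<iota>(1)]])
  have "?z (d (Suc i) x) = \<zero>\<^bsub>N\<^esub>" if x: "x \<in> carrier (P (Suc (Suc i)))" for x
    using vu[OF x] vw[OF x] mod_hom_closed[OF ud x] by (simp add: a_minus_def N.M.r_neg)
  then obtain g where g: "g \<in> mod_hom A (P i) N"
    and zg: "\<And>x. x \<in> carrier (P (Suc i)) \<Longrightarrow> ?z x = g (d i x)"
    using Hom_exactD[OF H z] by blast
  have "f x = \<pi> (g (d i x))" if x: "x \<in> carrier (P (Suc i))" for x
  proof -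
    have wx: "w x \<in> carrier N'" by (rule mod_hom_closed[OF w x])
    have "\<pi> (?z x) = \<pi> (u x) \<ominus>\<^bsub>N''\<^esub> \<pi> (\<iota> (w x))"
      by (intro mod_hom_diff[OF N N'' \<pi>(1)] mod_hom_closed[OF u x] mod_hom_closed[OF \<iota>(1) wx])
    then show ?thesis
      using \<pi>\<iota>[OF wx] fu[OF x] mod_hom_closed[OF f x] zg[OF x] by (simp add: a_minus_def)
  qed
  then show "\<exists>g\<in>mod_hom A (P i) N''. \<forall>x\<in>carrier (P (Suc i)). f x = g (d i x)"
    by (intro bexI[OF _ mod_hom_compose[OF g \<pi>(1)]]) auto
qed

text \<open>A finite dual basis exhibits \<open>N\<close> as a direct summand of a finite direct power of \<open>Q\<close>.\<close>

lemma Hom_exact_dual_basis: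
  assumes N: "left_module A N" and Q: "left_module A Q"
    and \<phi>: "\<And>s. s \<in> S \<Longrightarrow> \<phi> s \<in> mod_hom A N Q" and \<psi>: "\<And>s. s \<in> S \<Longrightarrow> \<psi> s \<in> mod_hom A Q N"
    and dual: "\<And>x. x \<in> carrier N \<Longrightarrow> x = (\<Oplus>\<^bsub>N\<^esub>s\<in>S. \<psi> s (\<phi> s x))"
    and H: "Hom_exact Q"
  shows "Hom_exact N"
proof (rule Hom_exactI)
  interpret N: left_module A N by fact
  fix i f assume f: "f \<in> mod_hom A (P (Suc i)) N"
    and cocycle: "\<And>x. x \<in> carrier (P (Suc (Suc i))) \<Longrightarrow> f (d (Suc i) x) = \<zero>\<^bsub>N\<^esub>"
  have "\<exists>g. g \<in> mod_hom A (P i) Q \<and> (\<forall>x\<in>carrier (P (Suc i)). \<phi> s (f x) = g (d i x))"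
    if s: "s \<in> S" for s
    using Hom_exactD[OF H mod_hom_compose[OF f \<phi>[OF s]]] cocycle mod_hom_zero[OF N Q \<phi>[OF s]]
    by metis
  then obtain g where g: "\<And>s. s \<in> S \<Longrightarrow> g s \<in> mod_hom A (P i) Q"
    and fg: "\<And>s x. s \<in> S \<Longrightarrow> x \<in> carrier (P (Suc i)) \<Longrightarrow> \<phi> s (f x) = g s (d i x)"
    by metis
  have "f x = (\<Oplus>\<^bsub>N\<^esub>s\<in>S. \<psi> s (g s (d i x)))" if x: "x \<in> carrier (P (Suc i))" for x
  proof (subst dual[OF mod_hom_closed[OF f x]], rule N.M.finsum_cong')
    show "(\<lambda>s. \<psi> s (g s (d i x))) \<in> S \<rightarrow> carrier N"
      using x by (auto intro: mod_hom_closed[OF \<psi>] mod_hom_closed[OF g] mod_hom_closed[OF d_hom])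
  qed (simp_all add: fg x)
  moreover have "(\<lambda>y. \<Oplus>\<^bsub>N\<^esub>s\<in>S. \<psi> s (g s y)) \<in> mod_hom A (P i) N"
    by (rule mod_hom_finite_sum[OF P_left_module N mod_hom_compose[OF g \<psi>]])
  ultimately show "\<exists>g\<in>mod_hom A (P i) N. \<forall>x\<in>carrier (P (Suc i)). f x = g (d i x)"
    by (intro bexI[of _ "\<lambda>y. \<Oplus>\<^bsub>N\<^esub>s\<in>S. \<psi> s (g s y)"]) auto
qed

end

lemma projective_resolutionD:
  assumes "projective_resolution A M P d e"
  shows "projective_module A (P i)" "d i \<in> mod_hom A (P (Suc i)) (P i)" "e \<in> mod_hom A (P 0) M"
    and "e ` carrier (P 0) = carrier M"
    and "\<lbrakk>x \<in> carrier (P 0); e x = \<zero>\<^bsub>M\<^esub>\<rbrakk> \<Longrightarrow> x \<in> d 0 ` carrier (P (Suc 0))"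
    and "x \<in> carrier (P (Suc 0)) \<Longrightarrow> e (d 0 x) = \<zero>\<^bsub>M\<^esub>"
    and "\<lbrakk>x \<in> carrier (P (Suc i)); d i x = \<zero>\<^bsub>P i\<^esub>\<rbrakk> \<Longrightarrow> x \<in> d (Suc i) ` carrier (P (Suc (Suc i)))"
    and "x \<in> carrier (P (Suc (Suc i))) \<Longrightarrow> d i (d (Suc i) x) = \<zero>\<^bsub>P i\<^esub>"
proof -
  have k: "a_kernel (P 0) M e = d 0 ` carrier (P 1)"
    "\<And>i. a_kernel (P (Suc i)) (P i) (d i) = d (Suc i) ` carrier (P (Suc (Suc i)))"
    using assms unfolding projective_resolution_def by auto
  show "\<lbrakk>x \<in> carrier (P 0); e x = \<zero>\<^bsub>M\<^esub>\<rbrakk> \<Longrightarrow> x \<in> d 0 ` carrier (P (Suc 0))"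
    "x \<in> carrier (P (Suc 0)) \<Longrightarrow> e (d 0 x) = \<zero>\<^bsub>M\<^esub>"
    using k(1) by (auto simp: a_kernel_def')
  show "\<lbrakk>x \<in> carrier (P (Suc i)); d i x = \<zero>\<^bsub>P i\<^esub>\<rbrakk> \<Longrightarrow> x \<in> d (Suc i) ` carrier (P (Suc (Suc i)))"
    "x \<in> carrier (P (Suc (Suc i))) \<Longrightarrow> d i (d (Suc i) x) = \<zero>\<^bsub>P i\<^esub>"
    using k(2)[of i] by (auto simp: a_kernel_def')
qed (use assms in \<open>auto simp: projective_resolution_def\<close>)

lemma projective_resolution_complex:
  "projective_resolution A M P d e \<Longrightarrow> projective_complex A P d"
  by (auto intro: projective_complex.intro dest: projective_resolutionD)

lemma Ext_vanishes_iff: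
  fixes M :: "('a, 'v, 'y) module_scheme"
  assumes N: "left_module A N"
  shows "Ext_vanishes A (Suc i) M N \<longleftrightarrow>
    (\<forall>(P :: nat \<Rightarrow> ('a, nat \<Rightarrow> 'a) module) d e.
      projective_resolution A M P d e \<longrightarrow> Hom_exact_at A P d N i)"
proof -
  have "trivial_group (Ext_group A P d N (Suc i)) \<longleftrightarrow> Hom_exact_at A P d N i"
    if "projective_resolution A M P d e" for P :: "nat \<Rightarrow> ('a, nat \<Rightarrow> 'a) module" and d e
  proof -
    interpret projective_complex A P d by (rule projective_resolution_complex[OF that])
    show ?thesis by (intro trivial_Ext_group_iff P_left_module N d_hom d_d)
  qed
  then show ?thesis unfolding Ext_vanishes_def by blast
qed

text \<open>
  A resolution of a projective module splits: inductively each differential \<open>d i\<close> has a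
  quasi-inverse \<open>s\<close> with \<open>d i \<circ> s \<circ> d i = d i\<close>, so \<open>x\<close> and \<open>s (d i x)\<close> differ by a boundary, and
  every cocycle \<open>f\<close> equals \<open>f \<circ> s \<circ> d i\<close>.
\<close>

lemma Hom_exact_at_of_projective:
  assumes G: "projective_module A G" and N: "left_module A N"
    and res: "projective_resolution A G P d e"
  shows "Hom_exact_at A P d N i"
proof -
  interpret projective_complex A P d by (rule projective_resolution_complex[OF res])
  note res_D = projective_resolutionD[OF res]
  note e = res_D(3)
  have Gm: "left_module A G" by (rule projective_imp_left_module[OF G])
  interpret G: left_module A G by (rule Gm)
  have lift: "\<exists>s\<in>mod_hom A (P i) (P (Suc i)). \<forall>x\<in>carrier (P i). d i (s x) = x \<ominus>\<^bsub>P i\<^esub> c x"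
    if c: "c \<in> mod_hom A (P i) (P i)"
      and im: "\<And>x. x \<in> carrier (P i) \<Longrightarrow> x \<ominus>\<^bsub>P i\<^esub> c x \<in> d i ` carrier (P (Suc i))" for i c
    by (rule projective_lift[OF proj P_left_module P_left_module d_hom
          mod_hom_difference[OF P_left_module mod_hom_id c] im])
  have "\<exists>s\<in>mod_hom A (P i) (P (Suc i)). \<forall>x\<in>carrier (P (Suc i)). d i (s (d i x)) = d i x"
  proof (induction i)
    case 0
    interpret P0: left_module A "P 0" by (rule P_left_module)
    obtain \<sigma> where \<sigma>: "\<sigma> \<in> mod_hom A G (P 0)" and e\<sigma>: "\<And>x. x \<in> carrier G \<Longrightarrow> e (\<sigma> x) = x"
      using projective_lift[OF G P_left_module Gm e mod_hom_id] res_D(4) by blast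
    have c: "(\<lambda>x. \<sigma> (e x)) \<in> mod_hom A (P 0) (P 0)" by (rule mod_hom_compose[OF e \<sigma>])
    have "e (x \<ominus>\<^bsub>P 0\<^esub> \<sigma> (e x)) = \<zero>\<^bsub>G\<^esub>" if x: "x \<in> carrier (P 0)" for x
      using mod_hom_diff[OF P_left_module Gm e x mod_hom_closed[OF c x]] e\<sigma>[OF mod_hom_closed[OF e x]]
        mod_hom_closed[OF e x] by (simp add: a_minus_def G.M.r_neg)
    then have "x \<ominus>\<^bsub>P 0\<^esub> \<sigma> (e x) \<in> d 0 ` carrier (P (Suc 0))" if x: "x \<in> carrier (P 0)" for x
      using x mod_hom_closed[OF c x] by (intro res_D(5)) auto
    then obtain s where s: "s \<in> mod_hom A (P 0) (P (Suc 0))"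
      and ds: "\<And>x. x \<in> carrier (P 0) \<Longrightarrow> d 0 (s x) = x \<ominus>\<^bsub>P 0\<^esub> \<sigma> (e x)"
      using lift[OF c] by blast
    have "d 0 (s (d 0 x)) = d 0 x" if x: "x \<in> carrier (P (Suc 0))" for x
      using ds[OF mod_hom_closed[OF d_hom x]] res_D(6)[OF x] mod_hom_zero[OF Gm P_left_module \<sigma>]
        mod_hom_closed[OF d_hom x] by (simp add: a_minus_def)
    then show ?case using s by blast
  next
    case (Suc i)
    interpret Pi: left_module A "P i" by (rule P_left_module)
    interpret PSi: left_module A "P (Suc i)" by (rule P_left_module)
    obtain s where s: "s \<in> mod_hom A (P i) (P (Suc i))"
      and dsd: "\<And>x. x \<in> carrier (P (Suc i)) \<Longrightarrow> d i (s (d i x)) = d i x"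
      using Suc by blast
    have c: "(\<lambda>x. s (d i x)) \<in> mod_hom A (P (Suc i)) (P (Suc i))" by (rule mod_hom_compose[OF d_hom s])
    have "d i (x \<ominus>\<^bsub>P (Suc i)\<^esub> s (d i x)) = \<zero>\<^bsub>P i\<^esub>" if x: "x \<in> carrier (P (Suc i))" for x
      using mod_hom_diff[OF P_left_module P_left_module d_hom x mod_hom_closed[OF c x]] dsd[OF x]
        mod_hom_closed[OF d_hom x] by (simp add: a_minus_def Pi.M.r_neg)
    then have "x \<ominus>\<^bsub>P (Suc i)\<^esub> s (d i x) \<in> d (Suc i) ` carrier (P (Suc (Suc i)))"
      if x: "x \<in> carrier (P (Suc i))" for x
      using x mod_hom_closed[OF c x] by (intro res_D(7)) auto
    then obtain s' where s': "s' \<in> mod_hom A (P (Suc i)) (P (Suc (Suc i)))"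
      and ds': "\<And>x. x \<in> carrier (P (Suc i)) \<Longrightarrow> d (Suc i) (s' x) = x \<ominus>\<^bsub>P (Suc i)\<^esub> s (d i x)"
      using lift[OF c] by blast
    have "d (Suc i) (s' (d (Suc i) x)) = d (Suc i) x" if x: "x \<in> carrier (P (Suc (Suc i)))" for x
      using ds'[OF mod_hom_closed[OF d_hom x]] d_d[OF x] mod_hom_zero[OF P_left_module P_left_module s]
        mod_hom_closed[OF d_hom x] by (simp add: a_minus_def)
    then show ?case using s' by blast
  qed
  then obtain s where s: "s \<in> mod_hom A (P i) (P (Suc i))"
    and dsd: "\<And>x. x \<in> carrier (P (Suc i)) \<Longrightarrow> d i (s (d i x)) = d i x"
    by blast
  interpret N: left_module A N by (rule N)
  interpret Pi: left_module A "P i" by (rule P_left_module)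
  interpret PSi: left_module A "P (Suc i)" by (rule P_left_module)
  show ?thesis
    unfolding Hom_exact_at_def
  proof (intro ballI impI bexI[OF _ mod_hom_compose[OF s]])
    fix f x assume f: "f \<in> mod_hom A (P (Suc i)) N"
      and cocycle: "\<forall>x\<in>carrier (P (Suc (Suc i))). f (d (Suc i) x) = \<zero>\<^bsub>N\<^esub>"
      and x: "x \<in> carrier (P (Suc i))"
    have sx: "s (d i x) \<in> carrier (P (Suc i))"
      by (intro mod_hom_closed[OF s] mod_hom_closed[OF d_hom] x)
    have "d i (x \<ominus>\<^bsub>P (Suc i)\<^esub> s (d i x)) = \<zero>\<^bsub>P i\<^esub>"
      using mod_hom_diff[OF P_left_module P_left_module d_hom x sx] dsd[OF x]
        mod_hom_closed[OF d_hom x] by (simp add: a_minus_def Pi.M.r_neg)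
    then have "x \<ominus>\<^bsub>P (Suc i)\<^esub> s (d i x) \<in> d (Suc i) ` carrier (P (Suc (Suc i)))"
      using x sx by (intro res_D(7)) auto
    then have "f (x \<ominus>\<^bsub>P (Suc i)\<^esub> s (d i x)) = \<zero>\<^bsub>N\<^esub>"
      using cocycle by auto
    then show "f x = f (s (d i x))"
      using mod_hom_diff[OF P_left_module N f x sx] mod_hom_closed[OF f x] mod_hom_closed[OF f sx]
      by (metis N.eq_if_diff_zero)
  qed
qed

corollary Ext_vanishes_projective:
  assumes "projective_module A G" "left_module A N" "i \<ge> 1"
  shows "Ext_vanishes A i G N"
proof -
  obtain j where "i = Suc j" using assms(3) by (cases i) auto
  then show ?thesis
    using Ext_vanishes_iff[OF assms(2)] Hom_exact_at_of_projective[OF assms(1,2)] by blast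
qed

section \<open>Direct summands of the regular module\<close>

lemma op_ring_simps [simp]:
  "carrier (op_ring A) = carrier A" "zero (op_ring A) = zero A" "one (op_ring A) = one A"
  "add (op_ring A) = add A" "a \<otimes>\<^bsub>op_ring A\<^esub> b = b \<otimes>\<^bsub>A\<^esub> a"
  by (simp_all add: op_ring_def)

lemma ring_op_ring: "ring A \<Longrightarrow> ring (op_ring A)"
proof -
  assume "ring A"
  then interpret ring A .
  show ?thesis
  proof (rule ringI)
    show "abelian_group (op_ring A)"
      by (rule abelian_groupI) (auto simp: a_ac intro: l_neg)
    show "Group.monoid (op_ring A)"
      by (rule monoidI) (auto simp: m_assoc)
  qed (auto simp: l_distr r_distr)
qed

text \<open>
  The regular module is the free module on one element; that element is an arbitrary value of the
  type of elements of \<open>G\<close>, as the definition of projectivity requires.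
\<close>

lemma projective_retract_regular:
  fixes G :: "('a, 'v, 'y) module_scheme"
  assumes G: "left_module A G" and j: "j \<in> mod_hom A G (regular_module A)"
    and q: "q \<in> mod_hom A (regular_module A) G" and qj: "\<And>x. x \<in> carrier G \<Longrightarrow> q (j x) = x"
  shows "projective_module A G"
proof -
  interpret G: left_module A G by (rule G)
  note A = G.R.ring_axioms
  have R: "left_module A (regular_module A)" by (rule left_module_regular[OF A])
  let ?F = "free_module A {undefined :: 'v}"
  have F: "left_module A ?F" by (rule left_module_free[OF A])
  have o: "(\<lambda>_. \<one>\<^bsub>A\<^esub>) \<in> {undefined :: 'v} \<rightarrow> carrier (regular_module A)" by simp
  define r where "r = free_lift A (regular_module A) (\<lambda>_ :: 'v. \<one>\<^bsub>A\<^esub>)"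
  have r: "r \<in> mod_hom A ?F (regular_module A)"
    unfolding r_def by (rule free_lift_hom[OF R o])
  define i where "i = (\<lambda>a. a \<odot>\<^bsub>?F\<^esub> basis_vec A undefined)"
  interpret F: left_module A ?F by (rule F)
  have b: "basis_vec A undefined \<in> carrier ?F" by (rule basis_vec_closed[OF A]) simp
  have i: "i \<in> mod_hom A (regular_module A) ?F"
    unfolding i_def
    by (rule mod_homI)
      (use b in \<open>simp_all del: free_module_simps add: F.smult_closed F.smult_l_distr F.smult_assoc1\<close>)
  have ri: "r (i a) = a" if "a \<in> carrier A" for a
  proof -
    have "r (i a) = a \<odot>\<^bsub>regular_module A\<^esub> r (basis_vec A undefined)"
      unfolding i_def by (rule mod_hom_smult[OF r that b])
    then show ?thesis
      using that unfolding r_def by (simp add: free_lift_basis[OF R o])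
  qed
  have "q (r (i (j x))) = x" if "x \<in> carrier G" for x
    using ri[of "j x"] mod_hom_closed[OF j that] qj[OF that] by simp
  then show ?thesis
    unfolding projective_module_def
    using G mod_hom_compose[OF j i] mod_hom_compose[OF r q] by blast
qed

lemma dual_module_simps:
  "f \<in> carrier (dual_module A M) \<longleftrightarrow>
    f \<in> mod_hom A M (regular_module A) \<and> f \<in> extensional (carrier M)"
  "\<zero>\<^bsub>dual_module A M\<^esub> = (\<lambda>x\<in>carrier M. \<zero>\<^bsub>A\<^esub>)"
  "f \<oplus>\<^bsub>dual_module A M\<^esub> g = (\<lambda>x\<in>carrier M. f x \<oplus>\<^bsub>A\<^esub> g x)"
  "a \<odot>\<^bsub>dual_module A M\<^esub> f = (\<lambda>x\<in>carrier M. f x \<otimes>\<^bsub>A\<^esub> a)"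
  by (auto simp: dual_module_def)

text \<open>
  Let \<open>u = q \<one>\<close>.  Every \<open>f\<close> in the dual satisfies \<open>f x = f (j x \<odot> u) = j x \<otimes> f u\<close>, that is,
  \<open>f = j.(f u)\<close>.  So the dual is the summand of the right regular module with the inclusion
  \<open>f \<mapsto> f u\<close>, and a functional \<open>\<Phi>\<close> on the dual is evaluation at \<open>\<Phi> j \<odot> u\<close>.
\<close>

lemma Gorenstein_projective_retract_regular:
  fixes G :: "('a, 'v, 'y) module_scheme"
  assumes G: "left_module A G" and j: "j \<in> mod_hom A G (regular_module A)"
    and q: "q \<in> mod_hom A (regular_module A) G" and qj: "\<And>x. x \<in> carrier G \<Longrightarrow> q (j x) = x"
  shows "Gorenstein_projective A G"
proof -
  interpret G: left_module A G by (rule G)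
  note A = G.R.ring_axioms
  have R: "left_module A (regular_module A)" by (rule left_module_regular[OF A])
  have opA: "ring (op_ring A)" by (rule ring_op_ring[OF A])
  have opR: "left_module (op_ring A) (regular_module (op_ring A))"
    by (rule left_module_regular[OF opA])
  let ?D = "dual_module A G"
  define u where "u = q \<one>\<^bsub>A\<^esub>"
  have u: "u \<in> carrier G"
    unfolding u_def by (rule mod_hom_closed[OF q]) simp
  have jc: "j x \<in> carrier A" if "x \<in> carrier G" for x
    using mod_hom_closed[OF j that] by simp
  have ju: "j x \<odot>\<^bsub>G\<^esub> u = x" if "x \<in> carrier G" for x
    using mod_hom_smult[OF q jc[OF that], of "\<one>\<^bsub>A\<^esub>"] qj[OF that] jc[OF that] by (simp add: u_def)
  have fg: "finitely_generated A G"
    unfolding finitely_generated_def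
  proof (intro exI[of _ "{u}"] conjI ballI)
    fix x assume x: "x \<in> carrier G"
    show "\<exists>c\<in>{u} \<rightarrow> carrier A. x = (\<Oplus>\<^bsub>G\<^esub>b\<in>{u}. c b \<odot>\<^bsub>G\<^esub> b)"
      using u jc[OF x] ju[OF x] x by (intro bexI[of _ "\<lambda>_. j x"]) auto
  qed (use u in auto)
  let ?j = "restrict j (carrier G)"
  have jD: "?j \<in> carrier ?D"
    unfolding dual_module_simps using mod_hom_cong[OF G j] by simp
  have f_eq: "f x = j x \<otimes>\<^bsub>A\<^esub> f u" if "f \<in> carrier ?D" "x \<in> carrier G" for f x
    using that mod_hom_smult[of f A G "regular_module A" "j x" u] jc ju u
    by (simp add: dual_module_simps)
  have D_hom: "f \<in> mod_hom A G (regular_module A)" if "f \<in> carrier ?D" for f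
    using that by (simp add: dual_module_simps)
  have D_closed: "f x \<in> carrier A" if "f \<in> carrier ?D" "x \<in> carrier G" for f x
    using mod_hom_closed[OF D_hom] that by simp
  have D_eqI: "f = g" if "f \<in> carrier ?D" "g \<in> carrier ?D" "f u = g u" for f g
  proof (rule extensionalityI[of _ "carrier G"])
    show "f x = g x" if "x \<in> carrier G" for x
      using f_eq[OF \<open>f \<in> carrier ?D\<close> that] f_eq[OF \<open>g \<in> carrier ?D\<close> that] \<open>f u = g u\<close> by simp
  qed (use that in \<open>simp_all add: dual_module_simps\<close>)
  have D_smult: "a \<odot>\<^bsub>?D\<^esub> f \<in> carrier ?D" if "a \<in> carrier A" "f \<in> carrier ?D" for a f
  proof -
    have "(\<lambda>x. f x \<otimes>\<^bsub>A\<^esub> a) \<in> mod_hom A G (regular_module A)"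
      by (rule mod_homI)
        (simp_all add: that(1) D_closed[OF that(2)] mod_hom_add[OF D_hom[OF that(2)]]
          mod_hom_smult[OF D_hom[OF that(2)]] G.R.l_distr G.R.m_assoc)
    then show ?thesis
      unfolding dual_module_simps using mod_hom_cong[OF G, of _ "regular_module A"] by simp
  qed
  have D_add: "f \<oplus>\<^bsub>?D\<^esub> g \<in> carrier ?D" if "f \<in> carrier ?D" "g \<in> carrier ?D" for f g
    using mod_hom_cong[OF G mod_hom_sum[OF R D_hom[OF that(1)] D_hom[OF that(2)]]]
    unfolding dual_module_simps by simp
  have D: "left_module (op_ring A) ?D"
  proof (rule left_module_embed[OF opR, where j = "\<lambda>f. f u"])
    show "inj_on (\<lambda>f. f u) (carrier ?D)"
      by (auto intro: inj_onI D_eqI)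
    show "\<zero>\<^bsub>?D\<^esub> \<in> carrier ?D"
      unfolding dual_module_simps using mod_hom_cong[OF G mod_hom_zero_map[OF R]] by simp
    show "f \<oplus>\<^bsub>?D\<^esub> g \<in> carrier ?D" if "f \<in> carrier ?D" "g \<in> carrier ?D" for f g
      by (rule D_add[OF that])
    show "a \<odot>\<^bsub>?D\<^esub> f \<in> carrier ?D" if "a \<in> carrier (op_ring A)" "f \<in> carrier ?D" for a f
      using D_smult that by simp
  qed (use u D_closed in \<open>simp_all add: dual_module_simps(2-4)\<close>)
  have j': "(\<lambda>f. f u) \<in> mod_hom (op_ring A) ?D (regular_module (op_ring A))"
    by (rule mod_homI) (use u D_closed in \<open>simp_all add: dual_module_simps(2-4)\<close>)
  have q': "(\<lambda>a. a \<odot>\<^bsub>?D\<^esub> ?j) \<in> mod_hom (op_ring A) (regular_module (op_ring A)) ?D"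
  proof (rule mod_homI)
    fix a b assume "a \<in> carrier (regular_module (op_ring A))" "b \<in> carrier (regular_module (op_ring A))"
    then show "(a \<oplus>\<^bsub>regular_module (op_ring A)\<^esub> b) \<odot>\<^bsub>?D\<^esub> ?j =
        a \<odot>\<^bsub>?D\<^esub> ?j \<oplus>\<^bsub>?D\<^esub> b \<odot>\<^bsub>?D\<^esub> ?j"
      using jc by (auto simp: dual_module_simps(2-4) G.R.r_distr fun_eq_iff)
  next
    fix a b assume "a \<in> carrier (op_ring A)" "b \<in> carrier (regular_module (op_ring A))"
    then show "(a \<odot>\<^bsub>regular_module (op_ring A)\<^esub> b) \<odot>\<^bsub>?D\<^esub> ?j = a \<odot>\<^bsub>?D\<^esub> (b \<odot>\<^bsub>?D\<^esub> ?j)"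
      using jc by (auto simp: dual_module_simps(2-4) G.R.m_assoc fun_eq_iff)
  qed (use D_smult jD in simp)
  have "f u \<odot>\<^bsub>?D\<^esub> ?j = f" if "f \<in> carrier ?D" for f
    using f_eq[OF that] that by (auto simp: dual_module_simps extensional_def fun_eq_iff)
  then have D_proj: "projective_module (op_ring A) ?D"
    by (intro projective_retract_regular[OF D j' q']) auto
  have bij: "bij_betw (\<lambda>x. \<lambda>f\<in>carrier ?D. f x) (carrier G) (carrier (dual_module (op_ring A) ?D))"
  proof (rule bij_betwI')
    fix x y assume x: "x \<in> carrier G" and y: "y \<in> carrier G"
    show "(\<lambda>f\<in>carrier ?D. f x) = (\<lambda>f\<in>carrier ?D. f y) \<longleftrightarrow> x = y"
    proof
      assume "(\<lambda>f\<in>carrier ?D. f x) = (\<lambda>f\<in>carrier ?D. f y)"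
      then have "j x = j y"
        using jD x y by (auto dest: fun_cong[of _ _ ?j])
      then have "j x \<odot>\<^bsub>G\<^esub> u = j y \<odot>\<^bsub>G\<^esub> u" by (rule arg_cong)
      then show "x = y" unfolding ju[OF x] ju[OF y] .
    qed simp
  next
    fix x assume x: "x \<in> carrier G"
    have hom: "(\<lambda>f. f x) \<in> mod_hom (op_ring A) ?D (regular_module (op_ring A))"
      by (rule mod_homI) (use x D_closed in \<open>simp_all add: dual_module_simps(2-4)\<close>)
    have "(\<lambda>f\<in>carrier ?D. f x) \<in> mod_hom (op_ring A) ?D (regular_module (op_ring A))"
      by (rule mod_hom_cong[OF D hom]) simp
    then show "(\<lambda>f\<in>carrier ?D. f x) \<in> carrier (dual_module (op_ring A) ?D)"
      by (simp add: dual_module_simps(1)[of _ "op_ring A"])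
  next
    fix \<Phi> assume \<Phi>: "\<Phi> \<in> carrier (dual_module (op_ring A) ?D)"
    have hom: "\<Phi> \<in> mod_hom (op_ring A) ?D (regular_module (op_ring A))"
      and ext: "\<Phi> \<in> extensional (carrier ?D)"
      using \<Phi> by (simp_all add: dual_module_simps(1)[of _ "op_ring A"])
    have \<Phi>j: "\<Phi> ?j \<in> carrier A" using mod_hom_closed[OF hom jD] by simp
    have "\<Phi> f = f (\<Phi> ?j \<odot>\<^bsub>G\<^esub> u)" if f: "f \<in> carrier ?D" for f
    proof -
      have fu: "f u \<in> carrier A" by (rule D_closed[OF f u])
      have "\<Phi> f = \<Phi> (f u \<odot>\<^bsub>?D\<^esub> ?j)"
        using f_eq[OF f] f by (intro arg_cong[of _ _ \<Phi>]) 
          (auto simp: dual_module_simps extensional_def fun_eq_iff)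
      also have "\<dots> = \<Phi> ?j \<otimes>\<^bsub>A\<^esub> f u"
        using mod_hom_smult[OF hom _ jD, of "f u"] fu by simp
      also have "\<dots> = f (\<Phi> ?j \<odot>\<^bsub>G\<^esub> u)"
        using mod_hom_smult[OF D_hom[OF f] \<Phi>j u] by simp
      finally show ?thesis .
    qed
    then have "\<Phi> = (\<lambda>f\<in>carrier ?D. f (\<Phi> ?j \<odot>\<^bsub>G\<^esub> u))"
      using ext by (auto simp: extensional_def fun_eq_iff)
    then show "\<exists>x\<in>carrier G. \<Phi> = (\<lambda>f\<in>carrier ?D. f x)"
      using G.smult_closed[OF \<Phi>j u] by blast
  qed
  show ?thesis
    unfolding Gorenstein_projective_def
    using G fg bij Ext_vanishes_projective[OF projective_retract_regular[OF G j q qj] R]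
      Ext_vanishes_projective[OF D_proj opR] by blast
qed

section \<open>Free resolutions over Noetherian rings\<close>

lemma submodule_generated_by_finite_set:
  assumes M: "left_module A M" and B: "finite B" "B \<subseteq> H" and H: "H \<subseteq> carrier M"
    and zero: "\<zero>\<^bsub>M\<^esub> \<in> H" and add: "\<And>x y. \<lbrakk>x \<in> H; y \<in> H\<rbrakk> \<Longrightarrow> x \<oplus>\<^bsub>M\<^esub> y \<in> H"
    and smult: "\<And>a x. \<lbrakk>a \<in> carrier A; x \<in> H\<rbrakk> \<Longrightarrow> a \<odot>\<^bsub>M\<^esub> x \<in> H"
    and gen: "\<And>x. x \<in> H \<Longrightarrow> \<exists>c\<in>B \<rightarrow> carrier A. x = (\<Oplus>\<^bsub>M\<^esub>b\<in>B. c b \<odot>\<^bsub>M\<^esub> b)"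
  shows "\<exists>(n :: nat) f. f \<in> mod_hom A (free_module A {..<n}) M \<and> f ` carrier (free_module A {..<n}) = H"
proof -
  interpret M: left_module A M by (rule M)
  obtain q where q: "bij_betw q {..<card B} B"
    using ex_bij_betw_nat_finite[OF B(1)] by (auto simp: atLeast0LessThan)
  let ?n = "card B"
  let ?F = "free_module A {..<?n}"
  have qB: "q s \<in> B" if "s < ?n" for s using bij_betwE[OF q] that by auto
  have q': "q \<in> {..<?n} \<rightarrow> carrier M" using qB B(2) H by auto
  have lift: "free_lift A M q t = (\<Oplus>\<^bsub>M\<^esub>s\<in>{..<?n}. t s \<odot>\<^bsub>M\<^esub> q s)" if "t \<in> carrier ?F" for t
    by (rule free_lift_eq[OF M q' that]) (use that in \<open>auto simp: free_module_carrier\<close>)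
  have sum_closed: "(\<Oplus>\<^bsub>M\<^esub>s\<in>F. t s \<odot>\<^bsub>M\<^esub> q s) \<in> H"
    if F: "finite F" "F \<subseteq> {..<?n}" and t: "\<And>s. t s \<in> carrier A" for F t
    using F
  proof (induction F rule: finite_induct)
    case (insert s F)
    have tq: "t s \<odot>\<^bsub>M\<^esub> q s \<in> H" if "s < ?n" for s
      using qB[OF that] B(2) by (intro smult t) auto
    have "(\<lambda>s. t s \<odot>\<^bsub>M\<^esub> q s) \<in> F \<rightarrow> carrier M" "t s \<odot>\<^bsub>M\<^esub> q s \<in> carrier M"
      using tq insert.prems H by auto
    then show ?case
      using insert tq[of s] by (simp add: add)
  qed (simp add: zero)
  have "x \<in> free_lift A M q ` carrier ?F" if x: "x \<in> H" for x
  proof -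
    obtain c where c: "c \<in> B \<rightarrow> carrier A" and xc: "x = (\<Oplus>\<^bsub>M\<^esub>b\<in>B. c b \<odot>\<^bsub>M\<^esub> b)"
      using gen[OF x] by blast
    let ?t = "\<lambda>s. if s < ?n then c (q s) else \<zero>\<^bsub>A\<^esub>"
    have t: "?t \<in> carrier ?F"
      using c qB by (auto simp: free_module_carrier_finite)
    have "(\<Oplus>\<^bsub>M\<^esub>b\<in>q ` {..<?n}. c b \<odot>\<^bsub>M\<^esub> b) = (\<Oplus>\<^bsub>M\<^esub>s\<in>{..<?n}. c (q s) \<odot>\<^bsub>M\<^esub> q s)"
      by (rule M.M.finsum_reindex)
        (use q c B(2) H qB in \<open>auto simp: bij_betw_def Pi_iff intro!: M.smult_closed\<close>)
    also have "\<dots> = (\<Oplus>\<^bsub>M\<^esub>s\<in>{..<?n}. ?t s \<odot>\<^bsub>M\<^esub> q s)"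
      by (rule M.M.finsum_cong')
        (use q' qB c in \<open>auto simp: Pi_iff intro!: M.smult_closed\<close>)
    finally have "x = free_lift A M q ?t"
      using q xc lift[OF t] by (simp add: bij_betw_def)
    then show ?thesis using t by blast
  qed
  moreover have "free_lift A M q t \<in> H" if "t \<in> carrier ?F" for t
    using lift[OF that] sum_closed[of "{..<?n}" t] that by (simp add: free_module_carrier)
  ultimately show ?thesis
    using free_lift_hom[OF M q'] by blast
qed

text \<open>
  Stated for all \<open>A\<^sup>n\<close> rather than for left ideals, since kernels of maps between finitely generated
  free modules are what a resolution has to cover.
\<close>

definition left_noetherian :: "('a, 'z) ring_scheme \<Rightarrow> bool"
  where "left_noetherian A \<longleftrightarrow> (\<forall>(n :: nat) H.
    H \<subseteq> carrier (free_module A {..<n}) \<and> \<zero>\<^bsub>free_module A {..<n}\<^esub> \<in> H \<and>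
    (\<forall>x\<in>H. \<forall>y\<in>H. x \<oplus>\<^bsub>free_module A {..<n}\<^esub> y \<in> H) \<and>
    (\<forall>a\<in>carrier A. \<forall>x\<in>H. a \<odot>\<^bsub>free_module A {..<n}\<^esub> x \<in> H) \<longrightarrow>
    (\<exists>B. finite B \<and> B \<subseteq> H \<and>
      (\<forall>x\<in>H. \<exists>c\<in>B \<rightarrow> carrier A. x = (\<Oplus>\<^bsub>free_module A {..<n}\<^esub>b\<in>B. c b \<odot>\<^bsub>free_module A {..<n}\<^esub> b))))"

lemma left_noetherianD:
  assumes "left_noetherian A" and "H \<subseteq> carrier (free_module A {..<n :: nat})"
    and "\<zero>\<^bsub>free_module A {..<n}\<^esub> \<in> H"
    and "\<And>x y. \<lbrakk>x \<in> H; y \<in> H\<rbrakk> \<Longrightarrow> x \<oplus>\<^bsub>free_module A {..<n}\<^esub> y \<in> H"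
    and "\<And>a x. \<lbrakk>a \<in> carrier A; x \<in> H\<rbrakk> \<Longrightarrow> a \<odot>\<^bsub>free_module A {..<n}\<^esub> x \<in> H"
  obtains B where "finite B" "B \<subseteq> H" "\<forall>x\<in>H.
    \<exists>c\<in>B \<rightarrow> carrier A. x = (\<Oplus>\<^bsub>free_module A {..<n}\<^esub>b\<in>B. c b \<odot>\<^bsub>free_module A {..<n}\<^esub> b)"
proof -
  have "H \<subseteq> carrier (free_module A {..<n}) \<and> \<zero>\<^bsub>free_module A {..<n}\<^esub> \<in> H \<and>
    (\<forall>x\<in>H. \<forall>y\<in>H. x \<oplus>\<^bsub>free_module A {..<n}\<^esub> y \<in> H) \<and>
    (\<forall>a\<in>carrier A. \<forall>x\<in>H. a \<odot>\<^bsub>free_module A {..<n}\<^esub> x \<in> H)"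
    using assms(2-5) by (intro conjI ballI)
  from assms(1)[unfolded left_noetherian_def, THEN spec, THEN spec, THEN mp, OF this]
  show ?thesis using that by (elim exE conjE) (rule that)
qed

lemma kernel_covered_by_free:
  assumes A: "left_noetherian A" and ring: "ring A" and N: "left_module A N"
    and g: "g \<in> mod_hom A (free_module A {..<n :: nat}) N"
  shows "\<exists>(m :: nat) f. f \<in> mod_hom A (free_module A {..<m}) (free_module A {..<n}) \<and>
    f ` carrier (free_module A {..<m}) = a_kernel (free_module A {..<n}) N g"
proof -
  let ?F = "\<lambda>n :: nat. free_module A {..<n}"
  interpret N: left_module A N by (rule N)
  have F: "left_module A (?F n)" by (rule left_module_free[OF ring])
  interpret F: left_module A "?F n" by (rule F)
  let ?H = "a_kernel (?F n) N g"
  have memH: "x \<in> ?H \<longleftrightarrow> x \<in> carrier (?F n) \<and> g x = \<zero>\<^bsub>N\<^esub>" for x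
    by (simp add: a_kernel_def')
  have H: "?H \<subseteq> carrier (?F n)" "\<zero>\<^bsub>?F n\<^esub> \<in> ?H"
    using mod_hom_zero[OF F N g] F.M.zero_closed by (auto simp only: memH)
  have add: "x \<oplus>\<^bsub>?F n\<^esub> y \<in> ?H" if "x \<in> ?H" "y \<in> ?H" for x y
    using that mod_hom_add[OF g, of x y] F.M.a_closed[of x y] by (simp only: memH) simp
  have smult: "a \<odot>\<^bsub>?F n\<^esub> x \<in> ?H" if "a \<in> carrier A" "x \<in> ?H" for a x
    using that mod_hom_smult[OF g, of a x] F.smult_closed[of a x] by (simp only: memH) simp
  obtain B where B: "finite B" "B \<subseteq> ?H" and gen: "\<forall>x\<in>?H.
      \<exists>c\<in>B \<rightarrow> carrier A. x = (\<Oplus>\<^bsub>?F n\<^esub>b\<in>B. c b \<odot>\<^bsub>?F n\<^esub> b)"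
    by (rule left_noetherianD[OF A H add smult])
  show ?thesis
    by (rule submodule_generated_by_finite_set[OF F B H add smult gen[THEN bspec]])
qed

lemma free_resolution_exists:
  fixes A :: "('a, 'z) ring_scheme"
  assumes A: "left_noetherian A" and M: "left_module A M" and fg: "finitely_generated A M"
  shows "\<exists>(P :: nat \<Rightarrow> ('a, nat \<Rightarrow> 'a) module) d e. projective_resolution A M P d e"
proof -
  interpret M: left_module A M by (rule M)
  note ring = M.R.ring_axioms
  let ?F = "\<lambda>n :: nat. free_module A {..<n}"
  obtain n0 e where e: "e \<in> mod_hom A (?F n0) M" and e_surj: "e ` carrier (?F n0) = carrier M"
  proof -
    obtain B where B: "finite B" "B \<subseteq> carrier M"
      and gen: "\<And>x. x \<in> carrier M \<Longrightarrow> \<exists>c\<in>B \<rightarrow> carrier A. x = (\<Oplus>\<^bsub>M\<^esub>b\<in>B. c b \<odot>\<^bsub>M\<^esub> b)"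
      using fg unfolding finitely_generated_def by blast
    have "\<exists>(n :: nat) f. f \<in> mod_hom A (?F n) M \<and> f ` carrier (?F n) = carrier M"
      by (rule submodule_generated_by_finite_set[OF M B subset_refl M.M.zero_closed M.M.a_closed
            M.smult_closed gen])
    then show ?thesis using that by blast
  qed
  \<comment> \<open>A state \<open>(n, m, f)\<close> records one differential \<open>f : A\<^sup>m \<rightarrow> A\<^sup>n\<close> of the resolution.\<close>
  define ok where "ok i x \<longleftrightarrow> (case x of (n, m, f) \<Rightarrow> f \<in> mod_hom A (?F m) (?F n) \<and>
      (i = 0 \<longrightarrow> n = n0 \<and> f ` carrier (?F m) = a_kernel (?F n0) M e))"
    for i :: nat and x :: "nat \<times> nat \<times> ((nat \<Rightarrow> 'a) \<Rightarrow> (nat \<Rightarrow> 'a))"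
  define follows where "follows x y \<longleftrightarrow> (case x of (n, m, f) \<Rightarrow> case y of (m', l, g) \<Rightarrow>
      m' = m \<and> g ` carrier (?F l) = a_kernel (?F m) (?F n) f)"
    for x y :: "nat \<times> nat \<times> ((nat \<Rightarrow> 'a) \<Rightarrow> (nat \<Rightarrow> 'a))"
  have "\<exists>s. \<forall>i. ok i (s i) \<and> follows (s i) (s (Suc i))"
  proof (rule dependent_nat_choice)
    show "\<exists>x. ok 0 x"
      using kernel_covered_by_free[OF A ring M e] by (auto simp: ok_def)
    show "\<exists>y. ok (Suc i) y \<and> follows x y" if "ok i x" for x i
    proof -
      obtain n m f where x: "x = (n, m, f)" by (cases x)
      then have "f \<in> mod_hom A (?F m) (?F n)" using that by (simp add: ok_def)
      then obtain l g where "g \<in> mod_hom A (?F l) (?F m)" 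
        "g ` carrier (?F l) = a_kernel (?F m) (?F n) f"
        using kernel_covered_by_free[OF A ring left_module_free[OF ring]] by blast
      then show ?thesis
        by (intro exI[of _ "(m, l, g)"]) (simp add: x ok_def follows_def)
    qed
  qed
  then obtain s where s: "\<And>i. ok i (s i)" "\<And>i. follows (s i) (s (Suc i))" by blast
  define P where "P i = ?F (fst (s i))" for i
  define d where "d i = snd (snd (s i))" for i
  have P_Suc: "P (Suc i) = ?F (fst (snd (s i)))" for i
    using s(2)[of i] by (auto simp: follows_def P_def split: prod.splits)
  have "projective_resolution A M P d e"
    unfolding projective_resolution_def
  proof (intro conjI allI)
    have P0: "P 0 = ?F n0"
      using s(1)[of 0] by (auto simp: ok_def P_def split: prod.splits)
    show "projective_module A (P i)" for i
      unfolding P_def by (rule projective_free[OF ring])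
    show "d i \<in> mod_hom A (P (Suc i)) (P i)" for i
      unfolding P_Suc using s(1)[of i] by (auto simp: ok_def P_def d_def split: prod.splits)
    show "e \<in> mod_hom A (P 0) M" "e ` carrier (P 0) = carrier M"
      using P0 e e_surj by auto
    have "P 1 = ?F (fst (snd (s 0)))"
      using P_Suc[of 0] by simp
    then show "a_kernel (P 0) M e = d 0 ` carrier (P 1)"
      unfolding P0 using s(1)[of 0] by (auto simp: ok_def d_def split: prod.splits)
    show "a_kernel (P (Suc i)) (P i) (d i) = d (Suc i) ` carrier (P (Suc (Suc i)))" for i
      unfolding P_Suc using s(2)[of i]
      by (auto simp: P_def d_def follows_def split: prod.splits)
  qed
  then show ?thesis by blast
qed

section \<open>Derivations and first extensions\<close>

text \<open>
  A derivation \<open>h\<close> describes a module structure on \<open>M \<times> N\<close>, an extension of \<open>M\<close> by \<open>N\<close>; if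
  \<open>Ext\<close> in degree one vanishes then this extension splits, and linearity of a splitting
  \<open>m \<mapsto> (m, s m)\<close> says that \<open>h a m = s (a m) - a (s m)\<close>, that is, that \<open>h\<close> is inner.  The map \<open>\<theta>\<close> below
  is the second component of a lift \<open>P 0 \<rightarrow> M \<times> N\<close> of \<open>e\<close>.  It is linear on the boundaries, where it
  agrees with a linear map \<open>g\<close> on all of \<open>P 0\<close>; the difference \<open>\<eta>\<close> is constant on the fibres of \<open>e\<close>
  and so descends to \<open>s\<close>.
\<close>

lemma derivation_inner:
  fixes M :: "('a, 'v, 'y) module_scheme" and N :: "('a, 'w, 'x) module_scheme"
  assumes M: "left_module A M" and N: "left_module A N"
    and res: "projective_resolution A M P d e" and ext: "Hom_exact_at A P d N 0"
    and h: "\<And>a m. \<lbrakk>a \<in> carrier A; m \<in> carrier M\<rbrakk> \<Longrightarrow> h a m \<in> carrier N"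
    and h_left: "\<And>a b m. \<lbrakk>a \<in> carrier A; b \<in> carrier A; m \<in> carrier M\<rbrakk> \<Longrightarrow>
      h (a \<oplus>\<^bsub>A\<^esub> b) m = h a m \<oplus>\<^bsub>N\<^esub> h b m"
    and h_right: "\<And>a m n. \<lbrakk>a \<in> carrier A; m \<in> carrier M; n \<in> carrier M\<rbrakk> \<Longrightarrow>
      h a (m \<oplus>\<^bsub>M\<^esub> n) = h a m \<oplus>\<^bsub>N\<^esub> h a n"
    and h_mult: "\<And>a b m. \<lbrakk>a \<in> carrier A; b \<in> carrier A; m \<in> carrier M\<rbrakk> \<Longrightarrow>
      h (a \<otimes>\<^bsub>A\<^esub> b) m = a \<odot>\<^bsub>N\<^esub> h b m \<oplus>\<^bsub>N\<^esub> h a (b \<odot>\<^bsub>M\<^esub> m)"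
  shows "\<exists>s. (\<forall>m\<in>carrier M. s m \<in> carrier N) \<and>
    (\<forall>a\<in>carrier A. \<forall>m\<in>carrier M. s (a \<odot>\<^bsub>M\<^esub> m) = a \<odot>\<^bsub>N\<^esub> s m \<oplus>\<^bsub>N\<^esub> h a m)"
proof -
  interpret M: left_module A M by (rule M)
  interpret N: left_module A N by (rule N)
  interpret projective_complex A P d by (rule projective_resolution_complex[OF res])
  note res_D = projective_resolutionD[OF res]
  note e = res_D(3)
  have h_zero: "h a \<zero>\<^bsub>M\<^esub> = \<zero>\<^bsub>N\<^esub>" if "a \<in> carrier A" for a
    using h_right[OF that, of "\<zero>\<^bsub>M\<^esub>" "\<zero>\<^bsub>M\<^esub>"] h[OF that, of "\<zero>\<^bsub>M\<^esub>"] by simp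
  have h_one: "h \<one>\<^bsub>A\<^esub> m = \<zero>\<^bsub>N\<^esub>" if "m \<in> carrier M" for m
    using h_mult[of "\<one>\<^bsub>A\<^esub>" "\<one>\<^bsub>A\<^esub>" m] h[of "\<one>\<^bsub>A\<^esub>" m] that by (simp add: M.smult_one N.smult_one)
  define E :: "('a, 'v \<times> 'w) module" where "E = \<lparr>carrier = carrier M \<times> carrier N,
    mult = undefined, one = undefined, zero = (\<zero>\<^bsub>M\<^esub>, \<zero>\<^bsub>N\<^esub>),
    add = (\<lambda>x y. (fst x \<oplus>\<^bsub>M\<^esub> fst y, snd x \<oplus>\<^bsub>N\<^esub> snd y)),
    smult = (\<lambda>a x. (a \<odot>\<^bsub>M\<^esub> fst x, a \<odot>\<^bsub>N\<^esub> snd x \<oplus>\<^bsub>N\<^esub> h a (fst x)))\<rparr>"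
  have E_simps: "carrier E = carrier M \<times> carrier N" "\<zero>\<^bsub>E\<^esub> = (\<zero>\<^bsub>M\<^esub>, \<zero>\<^bsub>N\<^esub>)"
    "x \<oplus>\<^bsub>E\<^esub> y = (fst x \<oplus>\<^bsub>M\<^esub> fst y, snd x \<oplus>\<^bsub>N\<^esub> snd y)"
    "a \<odot>\<^bsub>E\<^esub> x = (a \<odot>\<^bsub>M\<^esub> fst x, a \<odot>\<^bsub>N\<^esub> snd x \<oplus>\<^bsub>N\<^esub> h a (fst x))" for x y a
    by (simp_all add: E_def)
  have "abelian_group E"
  proof (rule abelian_groupI)
    fix x assume "x \<in> carrier E"
    then have "(\<ominus>\<^bsub>M\<^esub> fst x, \<ominus>\<^bsub>N\<^esub> snd x) \<in> carrier E \<and>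
        (\<ominus>\<^bsub>M\<^esub> fst x, \<ominus>\<^bsub>N\<^esub> snd x) \<oplus>\<^bsub>E\<^esub> x = \<zero>\<^bsub>E\<^esub>"
      by (auto simp: E_simps M.M.l_neg N.M.l_neg)
    then show "\<exists>y\<in>carrier E. y \<oplus>\<^bsub>E\<^esub> x = \<zero>\<^bsub>E\<^esub>" by blast
  qed (auto simp: E_simps M.M.a_ac N.M.a_ac)
  then have E: "left_module A E"
  proof (rule left_moduleI[OF M.R.ring_axioms])
    fix x assume x: "x \<in> carrier E"
    then have fst_x: "fst x \<in> carrier M" and snd_x: "snd x \<in> carrier N" by (auto simp: E_simps)
    show "\<one>\<^bsub>A\<^esub> \<odot>\<^bsub>E\<^esub> x = x"
      using fst_x snd_x by (simp add: E_simps M.smult_one N.smult_one h_one)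
    fix a assume a: "a \<in> carrier A"
    show "a \<odot>\<^bsub>E\<^esub> x \<in> carrier E"
      using a fst_x snd_x by (simp add: E_simps M.smult_closed N.smult_closed h)
    show "a \<odot>\<^bsub>E\<^esub> (x \<oplus>\<^bsub>E\<^esub> y) = a \<odot>\<^bsub>E\<^esub> x \<oplus>\<^bsub>E\<^esub> a \<odot>\<^bsub>E\<^esub> y" if "y \<in> carrier E" for y
    proof -
      have "fst y \<in> carrier M" "snd y \<in> carrier N" using that by (auto simp: E_simps)
      then show ?thesis
        using a fst_x snd_x
        by (simp add: E_simps M.smult_r_distr N.smult_r_distr h_right h N.smult_closed N.M.a_ac)
    qed
    fix b assume b: "b \<in> carrier A"
    show "(a \<oplus>\<^bsub>A\<^esub> b) \<odot>\<^bsub>E\<^esub> x = a \<odot>\<^bsub>E\<^esub> x \<oplus>\<^bsub>E\<^esub> b \<odot>\<^bsub>E\<^esub> x"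
      using a b fst_x snd_x
      by (simp add: E_simps M.smult_l_distr N.smult_l_distr h_left h N.smult_closed N.M.a_ac)
    show "(a \<otimes>\<^bsub>A\<^esub> b) \<odot>\<^bsub>E\<^esub> x = a \<odot>\<^bsub>E\<^esub> (b \<odot>\<^bsub>E\<^esub> x)"
      using a b fst_x snd_x
      by (simp add: E_simps M.smult_assoc1 N.smult_assoc1 h_mult h N.smult_closed M.smult_closed
          N.smult_r_distr N.M.a_assoc)
  qed
  have "fst \<in> mod_hom A E M"
    by (rule mod_homI) (auto simp: E_simps)
  moreover have "e x \<in> fst ` carrier E" if "x \<in> carrier (P 0)" for x
    using mod_hom_closed[OF e that] by (auto simp: E_simps intro!: image_eqI[of _ _ "(e x, \<zero>\<^bsub>N\<^esub>)"])
  ultimately obtain l where l: "l \<in> mod_hom A (P 0) E"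
    and fst_l: "\<And>x. x \<in> carrier (P 0) \<Longrightarrow> fst (l x) = e x"
    using projective_lift[OF proj E M _ e] by blast
  define \<theta> where "\<theta> x = snd (l x)" for x
  have \<theta>: "\<theta> x \<in> carrier N" if "x \<in> carrier (P 0)" for x
    using mod_hom_closed[OF l that] by (auto simp: \<theta>_def E_simps)
  have \<theta>_add: "\<theta> (x \<oplus>\<^bsub>P 0\<^esub> y) = \<theta> x \<oplus>\<^bsub>N\<^esub> \<theta> y" if "x \<in> carrier (P 0)" "y \<in> carrier (P 0)" for x y
    using mod_hom_add[OF l that] by (simp add: \<theta>_def E_simps)
  have \<theta>_smult: "\<theta> (a \<odot>\<^bsub>P 0\<^esub> x) = a \<odot>\<^bsub>N\<^esub> \<theta> x \<oplus>\<^bsub>N\<^esub> h a (e x)"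
    if "a \<in> carrier A" "x \<in> carrier (P 0)" for a x
    using mod_hom_smult[OF l that] fst_l[OF that(2)] by (simp add: \<theta>_def E_simps)
  have \<theta>d: "(\<lambda>x. \<theta> (d 0 x)) \<in> mod_hom A (P (Suc 0)) N"
  proof (rule mod_homI)
    fix x assume x: "x \<in> carrier (P (Suc 0))"
    have dx: "d 0 x \<in> carrier (P 0)" by (rule mod_hom_closed[OF d_hom x])
    then show "\<theta> (d 0 x) \<in> carrier N" by (rule \<theta>)
    show "\<theta> (d 0 (x \<oplus>\<^bsub>P (Suc 0)\<^esub> y)) = \<theta> (d 0 x) \<oplus>\<^bsub>N\<^esub> \<theta> (d 0 y)" if "y \<in> carrier (P (Suc 0))" for y
      using mod_hom_add[OF d_hom x that] \<theta>_add[OF dx mod_hom_closed[OF d_hom that]] by simp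
    show "\<theta> (d 0 (a \<odot>\<^bsub>P (Suc 0)\<^esub> x)) = a \<odot>\<^bsub>N\<^esub> \<theta> (d 0 x)" if "a \<in> carrier A" for a
      using mod_hom_smult[OF d_hom that x] \<theta>_smult[OF that dx] res_D(6)[OF x] h_zero[OF that]
        N.smult_closed[OF that \<theta>[OF dx]] by simp
  qed
  have "\<theta> (d 0 (d (Suc 0) x)) = \<zero>\<^bsub>N\<^esub>" if "x \<in> carrier (P (Suc (Suc 0)))" for x
    using d_d[OF that] mod_hom_zero[OF P_left_module E l] by (simp add: \<theta>_def E_simps)
  then obtain g where g: "g \<in> mod_hom A (P 0) N"
    and \<theta>g: "\<forall>x\<in>carrier (P (Suc 0)). \<theta> (d 0 x) = g (d 0 x)"
    using ext[unfolded Hom_exact_at_def, rule_format, OF \<theta>d] by blast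
  define \<eta> where "\<eta> x = \<theta> x \<ominus>\<^bsub>N\<^esub> g x" for x
  have \<eta>: "\<eta> x \<in> carrier N" if "x \<in> carrier (P 0)" for x
    using \<theta>[OF that] mod_hom_closed[OF g that] by (simp add: \<eta>_def)
  interpret P0: left_module A "P 0" by (rule P_left_module)
  have \<eta>_add: "\<eta> (x \<oplus>\<^bsub>P 0\<^esub> y) = \<eta> x \<oplus>\<^bsub>N\<^esub> \<eta> y" if "x \<in> carrier (P 0)" "y \<in> carrier (P 0)" for x y
    using \<theta>_add[OF that] mod_hom_add[OF g that] \<theta> mod_hom_closed[OF g] that
    by (simp add: \<eta>_def a_minus_def N.M.minus_add N.M.a_ac)
  have \<eta>_smult: "\<eta> (a \<odot>\<^bsub>P 0\<^esub> x) = a \<odot>\<^bsub>N\<^esub> \<eta> x \<oplus>\<^bsub>N\<^esub> h a (e x)"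
    if "a \<in> carrier A" "x \<in> carrier (P 0)" for a x
  proof -
    have "a \<odot>\<^bsub>N\<^esub> (\<ominus>\<^bsub>N\<^esub> g x) = \<ominus>\<^bsub>N\<^esub> (a \<odot>\<^bsub>N\<^esub> g x)"
      using mod_hom_smult[OF mod_hom_uminus[OF N g] that] mod_hom_smult[OF g that] by simp
    then show ?thesis
      using \<theta>_smult[OF that] mod_hom_smult[OF g that] \<theta>[OF that(2)] mod_hom_closed[OF g that(2)] that
        h[OF that(1) mod_hom_closed[OF e that(2)]]
      by (simp add: \<eta>_def a_minus_def N.smult_r_distr N.smult_closed N.M.a_ac)
  qed
  have \<eta>_eq: "\<eta> x = \<eta> y" if x: "x \<in> carrier (P 0)" and y: "y \<in> carrier (P 0)" and "e x = e y" for x y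
  proof -
    let ?z = "x \<ominus>\<^bsub>P 0\<^esub> y"
    have "e ?z = \<zero>\<^bsub>M\<^esub>"
      using mod_hom_diff[OF P_left_module M e x y] \<open>e x = e y\<close> mod_hom_closed[OF e y]
      by (simp add: a_minus_def M.M.r_neg)
    then have "?z \<in> d 0 ` carrier (P (Suc 0))"
      using x y by (intro res_D(5)) auto
    then have "\<eta> ?z = \<zero>\<^bsub>N\<^esub>"
      using \<theta>g mod_hom_closed[OF g] mod_hom_closed[OF d_hom] by (auto simp: \<eta>_def a_minus_def N.M.r_neg)
    moreover have "?z \<oplus>\<^bsub>P 0\<^esub> y = x"
      using x y by (simp add: a_minus_def P0.M.a_assoc P0.M.l_neg)
    ultimately show ?thesis
      using \<eta>_add[of ?z y] \<eta>[OF y] x y by simp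
  qed
  define p where "p m = (SOME x. x \<in> carrier (P 0) \<and> e x = m)" for m
  have p: "p m \<in> carrier (P 0)" "e (p m) = m" if "m \<in> carrier M" for m
  proof -
    have "\<exists>x. x \<in> carrier (P 0) \<and> e x = m" using res_D(4) that by (metis imageE)
    from someI_ex[OF this] show "p m \<in> carrier (P 0)" "e (p m) = m"
      unfolding p_def by auto
  qed
  have "\<eta> (p (a \<odot>\<^bsub>M\<^esub> m)) = a \<odot>\<^bsub>N\<^esub> \<eta> (p m) \<oplus>\<^bsub>N\<^esub> h a m" if a: "a \<in> carrier A" and m: "m \<in> carrier M" for a m
  proof -
    have "\<eta> (p (a \<odot>\<^bsub>M\<^esub> m)) = \<eta> (a \<odot>\<^bsub>P 0\<^esub> p m)"
      by (rule \<eta>_eq) (use a m in \<open>simp_all add: p M.smult_closed P0.smult_closed mod_hom_smult[OF e]\<close>)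
    then show ?thesis
      using \<eta>_smult[OF a p(1)[OF m]] p(2)[OF m] by simp
  qed
  then show ?thesis
    using \<eta> p(1) by (intro exI[of _ "\<lambda>m. \<eta> (p m)"]) auto
qed

section \<open>The category algebra\<close>

locale EI_category_over_field = field k + finite_EI_category C
  for k :: "('k, 'z) ring_scheme" (structure) and C :: "('o, 'm, 'y) cat_scheme"
begin

abbreviation A :: "('m \<Rightarrow> 'k) ring"
  where "A \<equiv> category_algebra k C"

abbreviation cv :: "('m \<Rightarrow> 'k) \<Rightarrow> ('m \<Rightarrow> 'k) \<Rightarrow> 'm \<Rightarrow> 'k"
  where "cv \<equiv> conv k C"

abbreviation V :: "'m set \<Rightarrow> ('k, 'm \<Rightarrow> 'k) module"
  where "V X \<equiv> free_module k X"

abbreviation e :: "'m \<Rightarrow> 'm \<Rightarrow> 'k"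
  where "e \<equiv> basis_vec k"

definition pairs :: "'m \<Rightarrow> ('m \<times> 'm) set"
  where "pairs m = {p \<in> Mor C \<times> Mor C. Dom C (fst p) = Cod C (snd p) \<and> fst p \<bullet>\<^bsub>C\<^esub> snd p = m}"

lemma V_carrier:
  "X \<subseteq> Mor C \<Longrightarrow> f \<in> carrier (V X) \<longleftrightarrow> (\<forall>m. f m \<in> carrier k) \<and> (\<forall>m. m \<notin> X \<longrightarrow> f m = \<zero>)"
  by (rule free_module_carrier_finite) (rule finite_subset[OF _ finite_Mor])

lemma V_closed: "f \<in> carrier (V X) \<Longrightarrow> f m \<in> carrier k"
  by (simp add: free_module_carrier)

lemma V_zero: "f \<in> carrier (V X) \<Longrightarrow> m \<notin> X \<Longrightarrow> f m = \<zero>"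
  by (simp add: free_module_carrier)

lemma V_mono: "X \<subseteq> Y \<Longrightarrow> f \<in> carrier (V X) \<Longrightarrow> f \<in> carrier (V Y)"
  by (auto simp: free_module_carrier)

lemma e_closed: "m \<in> X \<Longrightarrow> e m \<in> carrier (V X)"
  by (rule basis_vec_closed[OF ring_axioms])

lemma A_simps:
  "carrier A = carrier (V (Mor C))" "mult A = cv" "zero A = (\<lambda>_. \<zero>)" "add A = (\<lambda>f g m. f m \<oplus> g m)"
  "one A = (\<lambda>m. if m \<in> Id C ` Obj C then \<one> else \<zero>)"
  by (simp_all add: category_algebra_def)

lemma finite_pairs: "finite (pairs m)"
  by (rule finite_subset[of _ "Mor C \<times> Mor C"]) (auto simp: pairs_def finite_Mor)

lemma conv_eq: "cv f g m = (\<Oplus>p\<in>pairs m. f (fst p) \<otimes> g (snd p))"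
proof -
  have "{(\<alpha>, \<beta>). \<alpha> \<in> Mor C \<and> \<beta> \<in> Mor C \<and> Dom C \<alpha> = Cod C \<beta> \<and> \<alpha> \<bullet>\<^bsub>C\<^esub> \<beta> = m} = pairs m"
    by (auto simp: pairs_def)
  then show ?thesis by (simp add: conv_def)
qed

lemma pairs_empty: "m \<notin> Mor C \<Longrightarrow> pairs m = {}"
  by (auto simp: pairs_def intro: Comp_closed)

lemma conv_cong:
  assumes "\<And>\<alpha> \<beta>. (\<alpha>, \<beta>) \<in> pairs m \<Longrightarrow> f \<alpha> \<otimes> g \<beta> = f' \<alpha> \<otimes> g' \<beta>"
    and "\<And>\<alpha>. f' \<alpha> \<in> carrier k" "\<And>\<beta>. g' \<beta> \<in> carrier k"
  shows "cv f g m = cv f' g' m"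
  unfolding conv_eq by (rule finsum_cong') (use assms in auto)

lemma conv_zeroI:
  assumes "\<And>\<alpha> \<beta>. (\<alpha>, \<beta>) \<in> pairs m \<Longrightarrow> f \<alpha> \<otimes> g \<beta> = \<zero>"
  shows "cv f g m = \<zero>"
proof -
  have "cv f g m = (\<Oplus>p\<in>pairs m. \<zero>)"
    unfolding conv_eq by (rule finsum_cong') (use assms in auto)
  then show ?thesis by simp
qed

lemma conv_val_closed:
  assumes "\<And>\<alpha>. f \<alpha> \<in> carrier k" "\<And>\<beta>. g \<beta> \<in> carrier k"
  shows "cv f g m \<in> carrier k"
  unfolding conv_eq using assms by (intro finsum_closed) auto

lemma conv_closed:
  assumes "f \<in> carrier (V X)" "g \<in> carrier (V Y)"
  shows "cv f g \<in> carrier (V (Mor C))"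
  using conv_val_closed[of f g] V_closed[OF assms(1)] V_closed[OF assms(2)]
  by (auto simp: V_carrier conv_eq pairs_empty)

lemma conv_add_left:
  assumes "\<And>m. f m \<in> carrier k" "\<And>m. f' m \<in> carrier k" "\<And>m. g m \<in> carrier k"
  shows "cv (\<lambda>m. f m \<oplus> f' m) g m = cv f g m \<oplus> cv f' g m"
proof -
  have "cv (\<lambda>m. f m \<oplus> f' m) g m = (\<Oplus>p\<in>pairs m. f (fst p) \<otimes> g (snd p) \<oplus> f' (fst p) \<otimes> g (snd p))"
    unfolding conv_eq by (rule finsum_cong') (use assms in \<open>auto simp: l_distr\<close>)
  then show ?thesis
    unfolding conv_eq using assms by (simp add: finsum_addf Pi_iff)
qed

lemma conv_add_right:
  assumes "\<And>m. f m \<in> carrier k" "\<And>m. g m \<in> carrier k" "\<And>m. g' m \<in> carrier k"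
  shows "cv f (\<lambda>m. g m \<oplus> g' m) m = cv f g m \<oplus> cv f g' m"
proof -
  have "cv f (\<lambda>m. g m \<oplus> g' m) m = (\<Oplus>p\<in>pairs m. f (fst p) \<otimes> g (snd p) \<oplus> f (fst p) \<otimes> g' (snd p))"
    unfolding conv_eq by (rule finsum_cong') (use assms in \<open>auto simp: r_distr\<close>)
  then show ?thesis
    unfolding conv_eq using assms by (simp add: finsum_addf Pi_iff)
qed

lemma conv_smult_left:
  assumes "c \<in> carrier k" "\<And>m. f m \<in> carrier k" "\<And>m. g m \<in> carrier k"
  shows "cv (\<lambda>m. c \<otimes> f m) g m = c \<otimes> cv f g m"
proof -
  have "cv (\<lambda>m. c \<otimes> f m) g m = (\<Oplus>p\<in>pairs m. c \<otimes> (f (fst p) \<otimes> g (snd p)))"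
    unfolding conv_eq by (rule finsum_cong') (use assms in \<open>auto simp: m_assoc\<close>)
  then show ?thesis
    unfolding conv_eq using assms finite_pairs by (simp add: finsum_rdistr Pi_iff)
qed

lemma conv_smult_right:
  assumes "c \<in> carrier k" "\<And>m. f m \<in> carrier k" "\<And>m. g m \<in> carrier k"
  shows "cv f (\<lambda>m. c \<otimes> g m) m = c \<otimes> cv f g m"
proof -
  have "cv f (\<lambda>m. c \<otimes> g m) m = (\<Oplus>p\<in>pairs m. c \<otimes> (f (fst p) \<otimes> g (snd p)))"
    unfolding conv_eq by (rule finsum_cong') (use assms in \<open>auto simp: m_lcomm\<close>)
  then show ?thesis
    unfolding conv_eq using assms finite_pairs by (simp add: finsum_rdistr Pi_iff)
qed

lemma conv_zero_left [simp]: "(\<And>m. g m \<in> carrier k) \<Longrightarrow> cv (\<lambda>_. \<zero>) g = (\<lambda>_. \<zero>)"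
  by (auto intro!: conv_zeroI)

lemma conv_zero_right [simp]: "(\<And>m. f m \<in> carrier k) \<Longrightarrow> cv f (\<lambda>_. \<zero>) = (\<lambda>_. \<zero>)"
  by (auto intro!: conv_zeroI)

lemma e_val: "e \<alpha> m = (if m = \<alpha> then \<one> else \<zero>)"
  by (simp add: basis_vec_def)

lemma e_val_closed [simp]: "e \<alpha> m \<in> carrier k"
  by (simp add: basis_vec_def)

lemma conv_basis:
  assumes "\<alpha> \<in> Mor C" "\<beta> \<in> Mor C"
  shows "cv (e \<alpha>) (e \<beta>) = (if Dom C \<alpha> = Cod C \<beta> then e (\<alpha> \<bullet>\<^bsub>C\<^esub> \<beta>) else (\<lambda>_. \<zero>))"
proof
  fix m
  show "cv (e \<alpha>) (e \<beta>) m = (if Dom C \<alpha> = Cod C \<beta> then e (\<alpha> \<bullet>\<^bsub>C\<^esub> \<beta>) else (\<lambda>_. \<zero>)) m"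
  proof (cases "Dom C \<alpha> = Cod C \<beta> \<and> m = \<alpha> \<bullet>\<^bsub>C\<^esub> \<beta>")
    case True
    then have mem: "(\<alpha>, \<beta>) \<in> pairs m" using assms by (auto simp: pairs_def)
    have "cv (e \<alpha>) (e \<beta>) m = (\<Oplus>p\<in>pairs m. if (\<alpha>, \<beta>) = p then \<one> else \<zero>)"
      unfolding conv_eq by (rule finsum_cong') (auto simp: e_val)
    also have "\<dots> = \<one>"
      using finsum_singleton[OF mem finite_pairs, of "\<lambda>_. \<one>"] by simp
    finally show ?thesis using True by (simp add: e_val)
  next
    case False
    then have "cv (e \<alpha>) (e \<beta>) m = \<zero>"
      by (intro conv_zeroI) (auto simp: e_val pairs_def)
    then show ?thesis using False by (auto simp: e_val)
  qed
qed

lemma V_induct [consumes 1, case_names zero add basis]: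
  assumes "f \<in> carrier (V X)" "Q (\<lambda>_. \<zero>)"
    and "\<And>f g. \<lbrakk>f \<in> carrier (V X); g \<in> carrier (V X); Q f; Q g\<rbrakk> \<Longrightarrow> Q (\<lambda>m. f m \<oplus> g m)"
    and "\<And>c m. \<lbrakk>c \<in> carrier k; m \<in> X\<rbrakk> \<Longrightarrow> Q (\<lambda>m'. c \<otimes> e m m')"
  shows "Q f"
  by (rule free_module_induct[OF ring_axioms assms(1), where Q = Q])
    (use assms(2-) in simp_all)

text \<open>Both sides are additive and homogeneous in each factor, and on morphisms they agree.\<close>

lemma conv_assoc:
  assumes f: "f \<in> carrier (V (Mor C))" and g: "g \<in> carrier (V (Mor C))" and h: "h \<in> carrier (V (Mor C))"
  shows "cv (cv f g) h = cv f (cv g h)"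
proof -
  note cl = V_closed[OF f] V_closed[OF g] V_closed[OF h]
  have triple: "cv (cv (e \<alpha>) (e \<beta>)) (e \<gamma>) = cv (e \<alpha>) (cv (e \<beta>) (e \<gamma>))"
    if "\<alpha> \<in> Mor C" "\<beta> \<in> Mor C" "\<gamma> \<in> Mor C" for \<alpha> \<beta> \<gamma>
    using that by (simp add: conv_basis Comp_closed Dom_Comp Cod_Comp Comp_assoc)
  have 1: "cv (cv (e \<alpha>) (e \<beta>)) h = cv (e \<alpha>) (cv (e \<beta>) h)" if "\<alpha> \<in> Mor C" "\<beta> \<in> Mor C" for \<alpha> \<beta>
    using h
  proof (induction h rule: V_induct)
    case (add f g)
    note cl = V_closed[OF add.hyps(1)] V_closed[OF add.hyps(2)]
    show ?case
      by (simp add: fun_eq_iff conv_add_right cl conv_val_closed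
          add.IH[unfolded fun_eq_iff] cong: conv_cong)
  next
    case (basis c \<gamma>)
    then show ?case
      by (simp add: fun_eq_iff conv_smult_right conv_val_closed triple[unfolded fun_eq_iff] that)
  qed (simp add: conv_val_closed)
  have 2: "cv (cv (e \<alpha>) g) h = cv (e \<alpha>) (cv g h)" if "\<alpha> \<in> Mor C" for \<alpha>
    using g
  proof (induction g rule: V_induct)
    case (add f g)
    note cl' = V_closed[OF add.hyps(1)] V_closed[OF add.hyps(2)]
    show ?case
      by (simp add: fun_eq_iff conv_add_right conv_add_left cl cl' conv_val_closed
          add.IH[unfolded fun_eq_iff])
  next
    case (basis c \<gamma>)
    then show ?case
      using 1[OF that] by (simp add: fun_eq_iff conv_smult_right conv_smult_left cl conv_val_closed)
  qed (simp add: conv_val_closed cl)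
  show ?thesis
    using f
  proof (induction f rule: V_induct)
    case (add f f')
    note cl' = V_closed[OF add.hyps(1)] V_closed[OF add.hyps(2)]
    show ?case
      by (simp add: fun_eq_iff conv_add_left cl cl' conv_val_closed
          add.IH[unfolded fun_eq_iff])
  next
    case (basis c \<gamma>)
    then show ?case
      using 2 by (simp add: fun_eq_iff conv_smult_left cl conv_val_closed)
  qed (simp add: conv_val_closed cl)
qed

lemma one_val_closed: "one A m \<in> carrier k"
  by (simp add: A_simps)

lemma one_closed_V: "one A \<in> carrier (V (Mor C))"
  using Id_closed by (auto simp: A_simps V_carrier)

lemma conv_one_left:
  assumes f: "f \<in> carrier (V (Mor C))"
  shows "cv (one A) f = f"
  using f
proof (induction f rule: V_induct)
  case (add f g)
  then show ?case
    by (simp add: fun_eq_iff conv_add_right one_val_closed V_closed)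
next
  case (basis c \<alpha>)
  have "cv (one A) (e \<alpha>) m = e \<alpha> m" for m
  proof (cases "m = \<alpha>")
    case True
    let ?i = "(Id C (Cod C \<alpha>), \<alpha>)"
    have mem: "?i \<in> pairs \<alpha>"
      using basis(2) by (auto simp: pairs_def Id_closed Cod_closed Dom_Id Id_Comp)
    have "cv (one A) (e \<alpha>) m = (\<Oplus>p\<in>pairs \<alpha>. if ?i = p then \<one> else \<zero>)"
      unfolding conv_eq True
      by (rule finsum_cong')
        (auto simp: e_val A_simps pairs_def Dom_Id Cod_closed basis(2))
    then show ?thesis
      using finsum_singleton[OF mem finite_pairs, of "\<lambda>_. \<one>"] True by (simp add: e_val)
  next
    case False
    have "cv (one A) (e \<alpha>) m = \<zero>"
      by (rule conv_zeroI)
        (use False in \<open>auto simp: e_val A_simps pairs_def Dom_Id Id_Comp\<close>)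
    then show ?thesis using False by (simp add: e_val)
  qed
  then show ?case
    using basis by (simp add: fun_eq_iff conv_smult_right one_val_closed)
qed (simp add: one_val_closed)

lemma conv_one_right:
  assumes f: "f \<in> carrier (V (Mor C))"
  shows "cv f (one A) = f"
  using f
proof (induction f rule: V_induct)
  case (add f g)
  then show ?case
    by (simp add: fun_eq_iff conv_add_left one_val_closed V_closed)
next
  case (basis c \<alpha>)
  have "cv (e \<alpha>) (one A) m = e \<alpha> m" for m
  proof (cases "m = \<alpha>")
    case True
    let ?i = "(\<alpha>, Id C (Dom C \<alpha>))"
    have mem: "?i \<in> pairs \<alpha>"
      using basis(2) by (auto simp: pairs_def Id_closed Dom_closed Cod_Id Comp_Id)
    have "cv (e \<alpha>) (one A) m = (\<Oplus>p\<in>pairs \<alpha>. if ?i = p then \<one> else \<zero>)"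
      unfolding conv_eq True
      by (rule finsum_cong')
        (auto simp: e_val A_simps pairs_def Cod_Id Dom_closed basis(2), metis Cod_closed imageI)
    then show ?thesis
      using finsum_singleton[OF mem finite_pairs, of "\<lambda>_. \<one>"] True by (simp add: e_val)
  next
    case False
    have "cv (e \<alpha>) (one A) m = \<zero>"
      by (rule conv_zeroI)
        (use False in \<open>auto simp: e_val A_simps pairs_def Cod_Id Comp_Id\<close>)
    then show ?thesis using False by (simp add: e_val)
  qed
  then show ?case
    using basis by (simp add: fun_eq_iff conv_smult_left one_val_closed)
qed (simp add: one_val_closed)

lemma ring_A: "ring A"
proof (rule ringI)
  interpret F: left_module k "V (Mor C)" by (rule left_module_free[OF ring_axioms])
  show "abelian_group A"
  proof (rule abelian_groupI)
    fix f assume "f \<in> carrier A"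
    then show "\<exists>g\<in>carrier A. g \<oplus>\<^bsub>A\<^esub> f = \<zero>\<^bsub>A\<^esub>"
      using F.M.l_neg[of f] F.M.a_inv_closed[of f] unfolding A_simps by auto
  qed (use F.M.a_closed F.M.zero_closed F.M.a_comm F.M.a_assoc F.M.l_zero in
      \<open>simp_all add: A_simps\<close>)
  show "Group.monoid A"
    by (rule monoidI)
      (simp_all add: A_simps(1,2) conv_closed one_closed_V conv_assoc conv_one_left conv_one_right)
qed (auto simp: A_simps conv_add_left conv_add_right V_closed)

sublocale A: ring A
  by (rule ring_A)

section \<open>The category algebra is Noetherian\<close>

definition scalar :: "'k \<Rightarrow> 'm \<Rightarrow> 'k"
  where "scalar c = (\<lambda>m. c \<otimes> one A m)"

lemma scalar_closed: "c \<in> carrier k \<Longrightarrow> scalar c \<in> carrier A"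
  using one_closed_V by (auto simp: scalar_def A_simps(1) V_carrier)

lemma scalar_conv:
  assumes "c \<in> carrier k" "f \<in> carrier (V (Mor C))"
  shows "cv (scalar c) f = (\<lambda>m. c \<otimes> f m)"
  unfolding scalar_def
  using assms conv_one_left[OF assms(2)] by (simp add: fun_eq_iff conv_smult_left one_val_closed V_closed)

text \<open>
  Gaussian elimination: a \<open>k\<close>-subspace of \<open>A\<^sup>n\<close> supported on a finite set \<open>X\<close> of coordinates is
  generated by a vector that does not vanish at a given coordinate of \<open>X\<close>, if there is one, together
  with generators of the subspace of vectors that do vanish there.
\<close>

lemma subspace_finitely_generated:
  fixes n :: nat
  assumes "finite X"
  shows "\<lbrakk>H \<subseteq> carrier (free_module A {..<n});
      \<And>f g. \<lbrakk>f \<in> H; g \<in> H\<rbrakk> \<Longrightarrow> f \<oplus>\<^bsub>free_module A {..<n}\<^esub> g \<in> H;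
      \<And>c f. \<lbrakk>c \<in> carrier k; f \<in> H\<rbrakk> \<Longrightarrow> scalar c \<odot>\<^bsub>free_module A {..<n}\<^esub> f \<in> H;
      \<And>f i m. \<lbrakk>f \<in> H; (i, m) \<notin> X\<rbrakk> \<Longrightarrow> f i m = \<zero>\<rbrakk> \<Longrightarrow>
    \<exists>B. finite B \<and> B \<subseteq> H \<and> (\<forall>f\<in>H. \<exists>c\<in>B \<rightarrow> carrier A.
      f = (\<Oplus>\<^bsub>free_module A {..<n}\<^esub>b\<in>B. c b \<odot>\<^bsub>free_module A {..<n}\<^esub> b))"
  using assms
proof (induction X arbitrary: H rule: finite_induct)
  case empty
  interpret F: left_module A "free_module A {..<n}" by (rule left_module_free[OF ring_A])
  have "f = (\<lambda>_ _. \<zero>)" if "f \<in> H" for f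
    using empty(4)[OF that] by (auto simp: fun_eq_iff)
  then show ?case
    by (intro exI[of _ "{}"]) (auto simp: A_simps)
next
  case (insert x X)
  let ?F = "free_module A {..<n}"
  interpret F: left_module A ?F by (rule left_module_free[OF ring_A])
  obtain i m where x: "x = (i, m)" by (cases x)
  note H = insert.prems
  have val: "f i m \<in> carrier k" "f i \<in> carrier (V (Mor C))" if "f \<in> H" for f i m
    using H(1) that by (auto simp: free_module_carrier A_simps(1) V_closed)
  show ?case
  proof (cases "\<forall>f\<in>H. f i m = \<zero>")
    case True
    have H4: "f j m' = \<zero>" if "f \<in> H" "(j, m') \<notin> X" for f j m'
      using True H(4)[of f j m'] that x by (cases "(j, m') = x") auto
    show ?thesis
      by (rule insert.IH) (fact H(1-3) H4)+
  next
    case False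
    then obtain f0 where f0: "f0 \<in> H" "f0 i m \<noteq> \<zero>" by blast
    let ?H0 = "{f \<in> H. f i m = \<zero>}"
    have scalar_val: "(scalar c \<odot>\<^bsub>?F\<^esub> f) j m' = c \<otimes> f j m'" if "c \<in> carrier k" "f \<in> H" for c f j m'
      using that val(2)[OF that(2)] by (simp add: A_simps(2) scalar_conv)
    have add_val: "(f \<oplus>\<^bsub>?F\<^esub> g) j m' = f j m' \<oplus> g j m'" for f g :: "nat \<Rightarrow> 'm \<Rightarrow> 'k" and j m'
      by (simp add: A_simps)
    have "\<exists>B. finite B \<and> B \<subseteq> ?H0 \<and> (\<forall>f\<in>?H0. \<exists>c\<in>B \<rightarrow> carrier A.
      f = (\<Oplus>\<^bsub>?F\<^esub>b\<in>B. c b \<odot>\<^bsub>?F\<^esub> b))"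
    proof (rule insert.IH)
      show "f \<oplus>\<^bsub>?F\<^esub> g \<in> ?H0" if "f \<in> ?H0" "g \<in> ?H0" for f g
        using that H(2)[of f g] add_val[of f g i m] by simp
      show "scalar c \<odot>\<^bsub>?F\<^esub> f \<in> ?H0" if "c \<in> carrier k" "f \<in> ?H0" for c f
        using that H(3)[of c f] scalar_val[of c f i m] by simp
      show "f j m' = \<zero>" if "f \<in> ?H0" "(j, m') \<notin> X" for f j m'
        using that H(4)[of f j m'] x by (cases "(j, m') = x") auto
    qed (use H(1) in auto)
    then obtain B where B: "finite B" "B \<subseteq> ?H0"
      and gen: "\<And>f. f \<in> ?H0 \<Longrightarrow> \<exists>c\<in>B \<rightarrow> carrier A. f = (\<Oplus>\<^bsub>?F\<^esub>b\<in>B. c b \<odot>\<^bsub>?F\<^esub> b)"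
      by blast
    have f0B: "f0 \<notin> B" using B(2) f0(2) by auto
    have "\<exists>c\<in>insert f0 B \<rightarrow> carrier A. f = (\<Oplus>\<^bsub>?F\<^esub>b\<in>insert f0 B. c b \<odot>\<^bsub>?F\<^esub> b)" if f: "f \<in> H" for f
    proof -
      define r where "r = f i m \<otimes> inv (f0 i m)"
      have unit: "f0 i m \<in> Units k" using f0 val(1)[OF f0(1)] by (simp add: field_Units)
      have r: "r \<in> carrier k" "r \<otimes> f0 i m = f i m"
        using val(1)[OF f] val(1)[OF f0(1)] unit by (simp_all add: r_def m_assoc)
      define g where "g = f \<oplus>\<^bsub>?F\<^esub> (scalar (\<ominus> r) \<odot>\<^bsub>?F\<^esub> f0)"
      have gv: "g j m' = f j m' \<oplus> \<ominus> r \<otimes> f0 j m'" for j m'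
        unfolding g_def add_val by (subst scalar_val) (use r f0 in auto)
      have "g i m = \<zero>"
        using r val(1)[OF f] val(1)[OF f0(1)] by (simp add: gv l_minus r_neg)
      moreover have "g \<in> H"
        unfolding g_def by (intro H(2) H(3) f f0) (use r in simp)
      ultimately obtain c where c: "c \<in> B \<rightarrow> carrier A" and gc: "g = (\<Oplus>\<^bsub>?F\<^esub>b\<in>B. c b \<odot>\<^bsub>?F\<^esub> b)"
        using gen by blast
      let ?c = "c(f0 := scalar r)"
      have c': "?c \<in> insert f0 B \<rightarrow> carrier A" using c scalar_closed[OF r(1)] by auto
      have "(\<Oplus>\<^bsub>?F\<^esub>b\<in>B. ?c b \<odot>\<^bsub>?F\<^esub> b) = (\<Oplus>\<^bsub>?F\<^esub>b\<in>B. c b \<odot>\<^bsub>?F\<^esub> b)"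
        by (rule F.M.finsum_cong')
          (use c f0B B H(1) in \<open>auto simp del: free_module_simps intro!: F.smult_closed\<close>)
      moreover have "(\<Oplus>\<^bsub>?F\<^esub>b\<in>insert f0 B. ?c b \<odot>\<^bsub>?F\<^esub> b) = ?c f0 \<odot>\<^bsub>?F\<^esub> f0 \<oplus>\<^bsub>?F\<^esub> (\<Oplus>\<^bsub>?F\<^esub>b\<in>B. ?c b \<odot>\<^bsub>?F\<^esub> b)"
      proof (rule F.M.finsum_insert[OF B(1) f0B])
        show "(\<lambda>b. ?c b \<odot>\<^bsub>?F\<^esub> b) \<in> B \<rightarrow> carrier ?F"
          using B(2) H(1) by (intro funcsetI F.smult_closed funcset_mem[OF c']) auto
        show "?c f0 \<odot>\<^bsub>?F\<^esub> f0 \<in> carrier ?F"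
          using f0(1) H(1) by (intro F.smult_closed funcset_mem[OF c']) auto
      qed
      ultimately have sum: "(\<Oplus>\<^bsub>?F\<^esub>b\<in>insert f0 B. ?c b \<odot>\<^bsub>?F\<^esub> b) = scalar r \<odot>\<^bsub>?F\<^esub> f0 \<oplus>\<^bsub>?F\<^esub> g"
        using gc by simp
      have "(scalar r \<odot>\<^bsub>?F\<^esub> f0 \<oplus>\<^bsub>?F\<^esub> g) j m' = f j m'" for j m'
        unfolding add_val gv scalar_val[OF r(1) f0(1)]
        using r val(1)[OF f] val(1)[OF f0(1)] by (simp add: l_minus r_neg a_lcomm)
      then have "scalar r \<odot>\<^bsub>?F\<^esub> f0 \<oplus>\<^bsub>?F\<^esub> g = f" by blast
      then show ?thesis
        using sum c' by (intro bexI[OF _ c']) simp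
    qed
    then show ?thesis
      using B f0(1) by (intro exI[of _ "insert f0 B"]) auto
  qed
qed

lemma left_noetherian_A: "left_noetherian A"
  unfolding left_noetherian_def
proof (intro allI impI, elim conjE)
  fix n :: nat and H
  assume H: "H \<subseteq> carrier (free_module A {..<n})"
    and add: "\<forall>x\<in>H. \<forall>y\<in>H. x \<oplus>\<^bsub>free_module A {..<n}\<^esub> y \<in> H"
    and smult: "\<forall>a\<in>carrier A. \<forall>x\<in>H. a \<odot>\<^bsub>free_module A {..<n}\<^esub> x \<in> H"
  show "\<exists>B. finite B \<and> B \<subseteq> H \<and> (\<forall>f\<in>H. \<exists>c\<in>B \<rightarrow> carrier A.
      f = (\<Oplus>\<^bsub>free_module A {..<n}\<^esub>b\<in>B. c b \<odot>\<^bsub>free_module A {..<n}\<^esub> b))"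
  proof (rule subspace_finitely_generated[where X = "{..<n} \<times> Mor C", OF _ H])
    show "f i m = \<zero>" if f: "f \<in> H" and im: "(i, m) \<notin> {..<n} \<times> Mor C" for f i m
    proof -
      have "f \<in> carrier (free_module A {..<n})" using f H by blast
      then have "f i \<in> carrier (V (Mor C))" "i \<ge> n \<longrightarrow> f i = (\<lambda>_. \<zero>)"
        by (auto simp: free_module_carrier A_simps)
      then show ?thesis using im V_zero by fastforce
    qed
  qed (use add smult finite_Mor in \<open>simp_all del: free_module_simps add: scalar_closed\<close>)
qed

end

section \<open>Subquotients spanned by morphisms\<close>

lemma with_action_simps [simp]:
  "carrier (with_action M s) = carrier M" "zero (with_action M s) = zero M"
  "add (with_action M s) = add M" "smult (with_action M s) = s"
  by (simp_all add: with_action_def)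

lemma abelian_group_with_action:
  assumes "abelian_group M" shows "abelian_group (with_action M s)"
proof -
  interpret abelian_group M by (rule assms)
  show ?thesis
    by (rule abelian_groupI) (auto simp: a_ac intro: l_neg)
qed

context EI_category_over_field
begin

definition restr :: "'m set \<Rightarrow> ('m \<Rightarrow> 'k) \<Rightarrow> 'm \<Rightarrow> 'k"
  where "restr X f = (\<lambda>m. if m \<in> X then f m else \<zero>)"

text \<open>
  For \<open>X\<close> convex, \<open>span X\<close> is a subquotient of the regular module: the span of the morphisms
  obtained from \<open>X\<close> by composing on the left, modulo the span of those outside \<open>X\<close>.
\<close>

definition span :: "'m set \<Rightarrow> ('m \<Rightarrow> 'k, 'm \<Rightarrow> 'k) module"
  where "span X = with_action (V X) (\<lambda>a v. restr X (cv a v))"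

definition convex :: "'m set \<Rightarrow> bool"
  where "convex X \<longleftrightarrow> X \<subseteq> Mor C \<and>
    (\<forall>\<alpha>\<in>Mor C. \<forall>\<beta>\<in>Mor C. \<forall>\<gamma>\<in>X. Dom C \<alpha> = Cod C \<beta> \<and> Dom C \<beta> = Cod C \<gamma> \<and>
      \<alpha> \<bullet>\<^bsub>C\<^esub> (\<beta> \<bullet>\<^bsub>C\<^esub> \<gamma>) \<in> X \<longrightarrow> \<beta> \<bullet>\<^bsub>C\<^esub> \<gamma> \<in> X)"

definition closed_in :: "'m set \<Rightarrow> 'm set \<Rightarrow> bool"
  where "closed_in X Y \<longleftrightarrow>
    (\<forall>\<alpha>\<in>Mor C. \<forall>\<beta>\<in>Y. Dom C \<alpha> = Cod C \<beta> \<and> \<alpha> \<bullet>\<^bsub>C\<^esub> \<beta> \<in> X \<longrightarrow> \<alpha> \<bullet>\<^bsub>C\<^esub> \<beta> \<in> Y)"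

lemma span_simps:
  "carrier (span X) = carrier (V X)" "\<zero>\<^bsub>span X\<^esub> = (\<lambda>_. \<zero>)"
  "add (span X) = (\<lambda>f g m. f m \<oplus> g m)" "smult (span X) = (\<lambda>a v. restr X (cv a v))"
  by (simp_all add: span_def)

lemma restr_closed: "X \<subseteq> Mor C \<Longrightarrow> (\<And>m. f m \<in> carrier k) \<Longrightarrow> restr X f \<in> carrier (V X)"
  by (auto simp: restr_def V_carrier)

lemma restr_id: "f \<in> carrier (V X) \<Longrightarrow> restr X f = f"
  by (auto simp: restr_def V_zero fun_eq_iff)

lemma convex_subset: "convex X \<Longrightarrow> X \<subseteq> Mor C"
  by (simp add: convex_def)

lemma span_module:
  assumes X: "convex X" shows "left_module A (span X)"
proof (rule left_moduleI[OF ring_A])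
  interpret F: left_module k "V X" by (rule left_module_free[OF ring_axioms])
  note sub = convex_subset[OF X]
  show "abelian_group (span X)"
    unfolding span_def by (rule abelian_group_with_action) unfold_locales
  fix a v assume a: "a \<in> carrier A" and v: "v \<in> carrier (span X)"
  have av: "\<And>m. a m \<in> carrier k" "\<And>m. v m \<in> carrier k" "v \<in> carrier (V (Mor C))"
    using a v sub by (auto simp: A_simps span_simps V_closed intro: V_mono)
  show "a \<odot>\<^bsub>span X\<^esub> v \<in> carrier (span X)"
    using av by (simp add: span_simps restr_closed[OF sub] conv_val_closed)
  show "a \<odot>\<^bsub>span X\<^esub> (v \<oplus>\<^bsub>span X\<^esub> w) = a \<odot>\<^bsub>span X\<^esub> v \<oplus>\<^bsub>span X\<^esub> a \<odot>\<^bsub>span X\<^esub> w"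
    if "w \<in> carrier (span X)" for w
    using that av by (auto simp: span_simps restr_def conv_add_right V_closed fun_eq_iff)
  fix b assume b: "b \<in> carrier A"
  have bv: "\<And>m. b m \<in> carrier k" "b \<in> carrier (V (Mor C))" using b by (auto simp: A_simps V_closed)
  show "(a \<oplus>\<^bsub>A\<^esub> b) \<odot>\<^bsub>span X\<^esub> v = a \<odot>\<^bsub>span X\<^esub> v \<oplus>\<^bsub>span X\<^esub> b \<odot>\<^bsub>span X\<^esub> v"
    using av bv by (auto simp: A_simps span_simps restr_def conv_add_left fun_eq_iff)
  have "cv a (cv b v) m = cv a (restr X (cv b v)) m" if m: "m \<in> X" for m
  proof (rule conv_cong)
    fix \<alpha> \<beta> assume p: "(\<alpha>, \<beta>) \<in> pairs m"
    show "a \<alpha> \<otimes> cv b v \<beta> = a \<alpha> \<otimes> restr X (cv b v) \<beta>"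
    proof (cases "\<beta> \<in> X")
      case False
      have "cv b v \<beta> = \<zero>"
      proof (rule conv_zeroI)
        fix \<beta>1 \<beta>2 assume q: "(\<beta>1, \<beta>2) \<in> pairs \<beta>"
        have "\<beta>2 \<notin> X"
        proof
          assume "\<beta>2 \<in> X"
          then have "\<beta>1 \<bullet>\<^bsub>C\<^esub> \<beta>2 \<in> X"
            using X p q m Dom_Comp Cod_Comp unfolding convex_def pairs_def by auto
          then show False using q False by (simp add: pairs_def)
        qed
        then show "b \<beta>1 \<otimes> v \<beta>2 = \<zero>"
          using v bv by (simp add: span_simps V_zero)
      qed
      then show ?thesis using False by (simp add: restr_def)
    qed (simp add: restr_def)
  qed (use av bv in \<open>auto simp: restr_def conv_val_closed\<close>)
  then show "(a \<otimes>\<^bsub>A\<^esub> b) \<odot>\<^bsub>span X\<^esub> v = a \<odot>\<^bsub>span X\<^esub> (b \<odot>\<^bsub>span X\<^esub> v)"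
    using a b av(3) by (auto simp: span_simps A_simps conv_assoc restr_def[of X "cv a _"] fun_eq_iff)
next
  fix v assume v: "v \<in> carrier (span X)"
  then have "v \<in> carrier (V (Mor C))"
    using convex_subset[OF X] by (auto simp: span_simps intro: V_mono)
  then show "\<one>\<^bsub>A\<^esub> \<odot>\<^bsub>span X\<^esub> v = v"
    using v by (simp add: span_simps conv_one_left restr_id)
qed

lemma span_inclusion:
  assumes "convex X" "Y \<subseteq> X" "closed_in X Y"
  shows "(\<lambda>v. v) \<in> mod_hom A (span Y) (span X)"
proof (rule mod_homI)
  fix a v assume a: "a \<in> carrier A" and v: "v \<in> carrier (span Y)"
  have "cv a v m = \<zero>" if "m \<in> X" "m \<notin> Y" for m
  proof (rule conv_zeroI)
    fix \<alpha> \<beta> assume "(\<alpha>, \<beta>) \<in> pairs m"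
    then have "\<beta> \<notin> Y"
      using assms(3) that unfolding closed_in_def pairs_def by auto
    then show "a \<alpha> \<otimes> v \<beta> = \<zero>"
      using a v by (simp add: span_simps V_zero A_simps V_closed)
  qed
  then show "a \<odot>\<^bsub>span Y\<^esub> v = a \<odot>\<^bsub>span X\<^esub> v"
    using assms(2) by (auto simp: span_simps restr_def fun_eq_iff)
qed (use assms(2) in \<open>auto simp: span_simps intro: V_mono\<close>)

lemma span_restriction:
  assumes "convex X" "Y \<subseteq> X" "closed_in X (X - Y)"
  shows "restr Y \<in> mod_hom A (span X) (span Y)"
proof (rule mod_homI)
  have sub: "X \<subseteq> Mor C" "Y \<subseteq> Mor C" using convex_subset[OF assms(1)] assms(2) by auto
  show "restr Y v \<in> carrier (span Y)" if "v \<in> carrier (span X)" for v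
    using that by (simp add: span_simps restr_closed[OF sub(2)] V_closed)
  show "restr Y (v \<oplus>\<^bsub>span X\<^esub> w) = restr Y v \<oplus>\<^bsub>span Y\<^esub> restr Y w"
    if "v \<in> carrier (span X)" "w \<in> carrier (span X)" for v w
    by (auto simp: span_simps restr_def fun_eq_iff)
  fix a v assume a: "a \<in> carrier A" and v: "v \<in> carrier (span X)"
  have av: "\<And>m. a m \<in> carrier k" "\<And>m. v m \<in> carrier k"
    using a v by (auto simp: A_simps span_simps V_closed)
  have "cv a v m = cv a (restr Y v) m" if m: "m \<in> Y" for m
  proof (rule conv_cong)
    fix \<alpha> \<beta> assume p: "(\<alpha>, \<beta>) \<in> pairs m"
    show "a \<alpha> \<otimes> v \<beta> = a \<alpha> \<otimes> restr Y v \<beta>"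
    proof (cases "\<beta> \<in> Y")
      case False
      then have "\<beta> \<notin> X"
        using assms(2,3) m p unfolding closed_in_def pairs_def by auto
      then show ?thesis
        using v av False by (simp add: span_simps V_zero restr_def)
    qed (simp add: restr_def)
  qed (use av in \<open>auto simp: restr_def\<close>)
  then have "restr Y (cv a v) = restr Y (cv a (restr Y v))"
    by (simp add: restr_def[of Y "cv a v"] restr_def[of Y "cv a (restr Y v)"] fun_eq_iff)
  moreover have "restr Y (restr X f) = restr Y f" for f
    using assms(2) by (auto simp: restr_def fun_eq_iff)
  ultimately show "restr Y (a \<odot>\<^bsub>span X\<^esub> v) = a \<odot>\<^bsub>span Y\<^esub> restr Y v"
    by (simp add: span_simps)
qed

text \<open>
  The exact sequence \<open>0 \<rightarrow> span Y \<rightarrow> span X \<rightarrow> span (X - Y) \<rightarrow> 0\<close> for \<open>Y\<close> closed in \<open>X\<close>.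
\<close>

lemma span_exact:
  assumes "convex X" "Y \<subseteq> X" "closed_in X Y"
  shows "restr (X - Y) \<in> mod_hom A (span X) (span (X - Y))"
    and "restr (X - Y) ` carrier (span X) = carrier (span (X - Y))"
    and "\<And>v. v \<in> carrier (span Y) \<Longrightarrow> restr (X - Y) v = \<zero>\<^bsub>span (X - Y)\<^esub>"
    and "\<And>v. v \<in> carrier (span X) \<Longrightarrow> restr (X - Y) v = \<zero>\<^bsub>span (X - Y)\<^esub> \<Longrightarrow> v \<in> (\<lambda>v. v) ` carrier (span Y)"
proof -
  have sub: "X \<subseteq> Mor C" "Y \<subseteq> Mor C" "X - Y \<subseteq> Mor C"
    using convex_subset[OF assms(1)] assms(2) by auto
  have "X - (X - Y) = Y" using assms(2) by blast
  then show hom: "restr (X - Y) \<in> mod_hom A (span X) (span (X - Y))"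
    using span_restriction[of X "X - Y"] assms by auto
  have "v \<in> restr (X - Y) ` carrier (span X)" if "v \<in> carrier (span (X - Y))" for v
    using that restr_id[of v "X - Y"] V_mono[of "X - Y" X v] by (auto simp: span_simps intro!: image_eqI[of v])
  then show "restr (X - Y) ` carrier (span X) = carrier (span (X - Y))"
    using mod_hom_closed[OF hom] by blast
  show "restr (X - Y) v = \<zero>\<^bsub>span (X - Y)\<^esub>" if "v \<in> carrier (span Y)" for v
    using that by (auto simp: restr_def span_simps V_zero fun_eq_iff)
  show "v \<in> (\<lambda>v. v) ` carrier (span Y)"
    if "v \<in> carrier (span X)" "restr (X - Y) v = \<zero>\<^bsub>span (X - Y)\<^esub>" for v
    using that sub by (auto simp: restr_def span_simps V_carrier fun_eq_iff) (metis)
qed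

end

section \<open>The partial order on objects\<close>

locale skeletal_EI_category_over_field = EI_category_over_field k C
  for k :: "('k, 'z) ring_scheme" (structure) and C :: "('o, 'm, 'y) cat_scheme" +
  assumes skeletal: "skeletal C"
begin

text \<open>
  With morphisms in both directions, both composites are endomorphisms and hence invertible, so
  \<open>\<alpha>\<close> has a left and a right inverse; isomorphic objects are equal by skeletality.
\<close>

lemma antisymmetric:
  assumes "\<alpha> \<in> Mor C" "\<beta> \<in> Mor C" "Dom C \<beta> = Cod C \<alpha>" "Cod C \<beta> = Dom C \<alpha>"
  shows "Dom C \<alpha> = Cod C \<alpha>"
proof -
  let ?x = "Dom C \<alpha>" and ?y = "Cod C \<alpha>"
  have ob: "?x \<in> Obj C" "?y \<in> Obj C" using assms Dom_closed Cod_closed by auto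
  have "isomorphism C (\<beta> \<bullet>\<^bsub>C\<^esub> \<alpha>)" "isomorphism C (\<alpha> \<bullet>\<^bsub>C\<^esub> \<beta>)"
    by (rule endo_iso[OF ob(1)], simp add: Hom_set_def assms Comp_closed Dom_Comp Cod_Comp)
      (rule endo_iso[OF ob(2)], simp add: Hom_set_def assms Comp_closed Dom_Comp Cod_Comp)
  then obtain u v where u: "u \<in> Hom_set C ?x ?x" "u \<bullet>\<^bsub>C\<^esub> (\<beta> \<bullet>\<^bsub>C\<^esub> \<alpha>) = Id C ?x"
    and v: "v \<in> Hom_set C ?y ?y" "(\<alpha> \<bullet>\<^bsub>C\<^esub> \<beta>) \<bullet>\<^bsub>C\<^esub> v = Id C ?y"
    unfolding isomorphism_def using assms by (auto simp: Dom_Comp Cod_Comp)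
  note uv = u(1)[unfolded Hom_set_def, simplified] v(1)[unfolded Hom_set_def, simplified]
  let ?l = "u \<bullet>\<^bsub>C\<^esub> \<beta>" and ?r = "\<beta> \<bullet>\<^bsub>C\<^esub> v"
  have l: "?l \<bullet>\<^bsub>C\<^esub> \<alpha> = Id C ?x" using u assms uv by (simp add: Comp_assoc)
  have r: "\<alpha> \<bullet>\<^bsub>C\<^esub> ?r = Id C ?y" using v assms uv by (simp add: Comp_assoc)
  have "?l = ?l \<bullet>\<^bsub>C\<^esub> (\<alpha> \<bullet>\<^bsub>C\<^esub> ?r)"
    unfolding r using Comp_Id[of ?l] assms uv by (simp add: Comp_closed Dom_Comp)
  also have "\<dots> = (?l \<bullet>\<^bsub>C\<^esub> \<alpha>) \<bullet>\<^bsub>C\<^esub> ?r"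
    using assms uv by (simp add: Comp_assoc Comp_closed Dom_Comp Cod_Comp)
  also have "\<dots> = ?r"
    unfolding l using Id_Comp[of ?r] assms uv by (simp add: Comp_closed Cod_Comp)
  finally have lr: "?l = ?r" .
  have "isomorphism C \<alpha>"
    unfolding isomorphism_def
  proof (intro conjI bexI[of _ ?r])
    show "?r \<bullet>\<^bsub>C\<^esub> \<alpha> = Id C ?x" using l unfolding lr .
  qed (use assms r uv in \<open>auto simp: Hom_set_def Comp_closed Dom_Comp Cod_Comp\<close>)
  then show ?thesis
    using skeletal ob assms(1) unfolding skeletal_def Hom_set_def by blast
qed

lemma finite_Obj: "finite (Obj C)"
proof (rule finite_subset[OF _ finite_imageI[OF finite_Mor, of "Dom C"]])
  show "Obj C \<subseteq> Dom C ` Mor C"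
    using Id_closed Dom_Id by (metis image_eqI subsetI)
qed

definition height :: "'o \<Rightarrow> nat"
  where "height x = card {w \<in> Obj C. Hom_set C x w \<noteq> {}}"

lemma height_less:
  assumes "\<alpha> \<in> Mor C" "Dom C \<alpha> \<noteq> Cod C \<alpha>"
  shows "height (Cod C \<alpha>) < height (Dom C \<alpha>)"
  unfolding height_def
proof (rule psubset_card_mono)
  let ?x = "Dom C \<alpha>" and ?y = "Cod C \<alpha>"
  show "finite {w \<in> Obj C. Hom_set C ?x w \<noteq> {}}" using finite_Obj by simp
  have "Hom_set C ?x w \<noteq> {}" if "\<beta> \<in> Hom_set C ?y w" for \<beta> w
    using that assms(1) Comp_closed[of \<beta> \<alpha>] Dom_Comp[of \<beta> \<alpha>] Cod_Comp[of \<beta> \<alpha>]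
    by (auto simp: Hom_set_def)
  then have "{w \<in> Obj C. Hom_set C ?y w \<noteq> {}} \<subseteq> {w \<in> Obj C. Hom_set C ?x w \<noteq> {}}" by blast
  moreover have "Id C ?x \<in> Hom_set C ?x ?x"
    using assms(1) by (simp add: Hom_set_def Id_closed Dom_closed Dom_Id Cod_Id)
  then have "?x \<in> {w \<in> Obj C. Hom_set C ?x w \<noteq> {}}" using assms(1) Dom_closed by blast
  moreover have "Hom_set C ?y ?x = {}"
    using antisymmetric[OF assms(1)] assms(2) by (auto simp: Hom_set_def)
  ultimately show "{w \<in> Obj C. Hom_set C ?y w \<noteq> {}} \<subset> {w \<in> Obj C. Hom_set C ?x w \<noteq> {}}" by blast
qed

end

section \<open>Modules of finite projective dimension\<close>

text \<open>
  A complex of projectives \<open>P\<close> for which \<open>Hom(P, A)\<close> is exact in positive degrees; for a resolution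
  of a Gorenstein-projective module this holds by definition.
\<close>

locale Hom_exact_complex =
  skeletal_EI_category_over_field k C + projective_complex "category_algebra k C" P d
  for k :: "('k, 'z) ring_scheme" (structure) and C :: "('o, 'm, 'y) cat_scheme"
    and P :: "nat \<Rightarrow> ('m \<Rightarrow> 'k, 'p) module" and d :: "nat \<Rightarrow> 'p \<Rightarrow> 'p" +
  assumes projective: "projective_over k C"
    and Hom_exact_regular: "Hom_exact (regular_module (category_algebra k C))"
begin

definition from_to :: "'o \<Rightarrow> 'o set \<Rightarrow> 'm set"
  where "from_to y T = {\<beta> \<in> Mor C. Dom C \<beta> = y \<and> Cod C \<beta> \<in> T}"

lemma from_to_endo: "y \<in> Obj C \<Longrightarrow> from_to y {y} = Aut C y"
  using endo_iso by (auto simp: from_to_def Aut_def Hom_set_def)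

lemma from_to_single: "from_to y {z} = Hom_set C y z"
  by (auto simp: from_to_def Hom_set_def)

text \<open>Interval-closed sets of objects, for the preorder given by existence of a morphism.\<close>

lemma convex_from_to:
  assumes "\<And>\<alpha> \<beta>. \<lbrakk>\<alpha> \<in> Mor C; \<beta> \<in> Mor C; Dom C \<alpha> = Cod C \<beta>; Dom C \<beta> \<in> T; Cod C \<alpha> \<in> T\<rbrakk> \<Longrightarrow> Dom C \<alpha> \<in> T"
  shows "convex (from_to y T)"
  unfolding convex_def
proof (intro conjI ballI impI)
  fix \<alpha> \<beta> \<gamma> assume "\<alpha> \<in> Mor C" "\<beta> \<in> Mor C" "\<gamma> \<in> from_to y T"
    and "Dom C \<alpha> = Cod C \<beta> \<and> Dom C \<beta> = Cod C \<gamma> \<and> \<alpha> \<bullet>\<^bsub>C\<^esub> (\<beta> \<bullet>\<^bsub>C\<^esub> \<gamma>) \<in> from_to y T"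
  then show "\<beta> \<bullet>\<^bsub>C\<^esub> \<gamma> \<in> from_to y T"
    using assms[of \<alpha> \<beta>] by (auto simp: from_to_def Comp_closed Dom_Comp Cod_Comp)
qed (auto simp: from_to_def)

lemma convex_from_to_upset:
  assumes "\<And>\<alpha>. \<lbrakk>\<alpha> \<in> Mor C; Dom C \<alpha> \<in> T\<rbrakk> \<Longrightarrow> Cod C \<alpha> \<in> T"
  shows "convex (from_to y T)"
proof (rule convex_from_to)
  fix \<alpha> \<beta> assume "\<beta> \<in> Mor C" "Dom C \<alpha> = Cod C \<beta>" "Dom C \<beta> \<in> T"
  then show "Dom C \<alpha> \<in> T" using assms[of \<beta>] by simp
qed

lemma convex_Hom_set: "convex (from_to y {z})"
  by (rule convex_from_to) (auto dest: antisymmetric)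

text \<open>
  Restriction to the automorphisms of \<open>z\<close> is compatible with the action on modules supported at
  \<open>z\<close>, because only automorphisms act on them.
\<close>

lemma span_action_at:
  assumes z: "z \<in> Obj C" and a: "a \<in> carrier A" and v: "v \<in> carrier (span (from_to y {z}))"
  shows "a \<odot>\<^bsub>span (from_to y {z})\<^esub> v = cv (restr (Aut C z) a) v"
proof
  fix m
  have cl: "\<And>m. a m \<in> carrier k" "\<And>m. v m \<in> carrier k"
    using a v by (auto simp: A_simps span_simps V_closed)
  show "(a \<odot>\<^bsub>span (from_to y {z})\<^esub> v) m = cv (restr (Aut C z) a) v m"
  proof (cases "m \<in> from_to y {z}")
    case True
    have "cv a v m = cv (restr (Aut C z) a) v m"
    proof (rule conv_cong)
      fix \<alpha> \<beta> assume p: "(\<alpha>, \<beta>) \<in> pairs m"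
      show "a \<alpha> \<otimes> v \<beta> = restr (Aut C z) a \<alpha> \<otimes> v \<beta>"
      proof (cases "\<beta> \<in> from_to y {z}")
        case True
        then have "\<alpha> \<in> from_to z {z}"
          using p \<open>m \<in> from_to y {z}\<close> by (auto simp: pairs_def from_to_def Cod_Comp)
        then show ?thesis by (simp add: from_to_endo[OF z] restr_def)
      qed (use cl v in \<open>simp add: restr_def span_simps V_zero\<close>)
    qed (use cl in \<open>auto simp: restr_def\<close>)
    then show ?thesis using True by (simp add: span_simps restr_def[of "from_to y {z}"])
  next
    case False
    have "cv (restr (Aut C z) a) v m = \<zero>"
    proof (rule conv_zeroI)
      fix \<alpha> \<beta> assume p: "(\<alpha>, \<beta>) \<in> pairs m"
      show "restr (Aut C z) a \<alpha> \<otimes> v \<beta> = \<zero>"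
      proof (cases "\<alpha> \<in> Aut C z \<and> \<beta> \<in> from_to y {z}")
        case True
        then have "m \<in> from_to y {z}"
          using p by (auto simp: pairs_def from_to_def Aut_def Hom_set_def Cod_Comp Dom_Comp Comp_closed)
        then show ?thesis using False by simp
      qed (use cl v in \<open>auto simp: restr_def span_simps V_zero\<close>)
    qed
    then show ?thesis using False by (simp add: span_simps restr_def)
  qed
qed

lemma Aut_sub: "Aut C z \<subseteq> Mor C"
  by (auto simp: Aut_def Hom_set_def)

lemma Aut_algebra_simps:
  "carrier (Aut_algebra k C z) = carrier (V (Aut C z))" "zero (Aut_algebra k C z) = (\<lambda>_. \<zero>)"
  "add (Aut_algebra k C z) = (\<lambda>f g m. f m \<oplus> g m)"
  by (simp_all add: Aut_algebra_def category_algebra_def)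

lemma Aut_algebra_mult:
  assumes "f \<in> carrier (V (Aut C z))" "g \<in> carrier (V (Aut C z))"
  shows "f \<otimes>\<^bsub>Aut_algebra k C z\<^esub> g = cv f g"
proof
  fix m
  let ?K = "{(\<alpha>, \<beta>). \<alpha> \<in> Aut C z \<and> \<beta> \<in> Aut C z \<and> Dom C \<alpha> = Cod C \<beta> \<and> \<alpha> \<bullet>\<^bsub>C\<^esub> \<beta> = m}"
  have "(\<Oplus>p\<in>?K. f (fst p) \<otimes> g (snd p)) = (\<Oplus>p\<in>pairs m. f (fst p) \<otimes> g (snd p))"
  proof (rule add.finprod_mono_neutral_cong_left)
    show "?K \<subseteq> pairs m" using Aut_sub by (auto simp: pairs_def)
    show "f (fst p) \<otimes> g (snd p) = \<zero>" if "p \<in> pairs m - ?K" for p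
      using that assms by (cases p) (auto simp: pairs_def V_zero V_closed)
  qed (use assms in \<open>auto simp: finite_pairs V_closed\<close>)
  then show "(f \<otimes>\<^bsub>Aut_algebra k C z\<^esub> g) m = cv f g m"
    by (simp add: Aut_algebra_def category_algebra_def conv_eq) (simp add: conv_def)
qed

text \<open>
  The coordinates of the embedding of \<open>k Hom(y, z)\<close> into a free \<open>k Aut(z)\<close>-module, given by
  projectivity, form a dual basis; finitely many suffice as \<open>k Hom(y, z)\<close> is finitely generated.
\<close>

lemma Hom_exact_Hom_set:
  assumes y: "y \<in> Obj C" and z: "z \<in> Obj C" and H: "Hom_exact (span (from_to z {z}))"
  shows "Hom_exact (span (from_to y {z}))"
proof -
  let ?G = "Aut_algebra k C z"
  let ?L = "hom_left_module k C y z"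
  let ?N = "span (from_to y {z})"
  let ?Q = "span (from_to z {z})"
  have L_simps: "carrier ?L = carrier (V (Hom_set C y z))" "zero ?L = (\<lambda>_. \<zero>)"
    "add ?L = (\<lambda>f g m. f m \<oplus> g m)" "smult ?L = cv"
    by (simp_all add: hom_left_module_def)
  have sub: "Hom_set C y z \<subseteq> Mor C" by (auto simp: Hom_set_def)
  have Q_carrier: "carrier ?Q = carrier ?G"
    by (simp add: span_simps Aut_algebra_simps from_to_endo[OF z])
  have N_carrier: "carrier ?N = carrier ?L"
    by (simp add: span_simps L_simps from_to_single)
  have "projective_module ?G ?L"
    using projective y z by (auto simp: projective_over_def)
  then obtain S :: "('m \<Rightarrow> 'k) set" and i p where L: "left_module ?G ?L"
    and i: "i \<in> mod_hom ?G ?L (free_module ?G S)" and p: "p \<in> mod_hom ?G (free_module ?G S) ?L"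
    and pi: "\<And>x. x \<in> carrier ?L \<Longrightarrow> p (i x) = x"
    unfolding projective_module_def by blast
  interpret L: left_module ?G ?L by (rule L)
  interpret N: left_module A ?N by (rule span_module[OF convex_Hom_set])
  interpret Q: left_module A ?Q by (rule span_module[OF convex_Hom_set])
  let ?F = "free_module ?G S"
  have F: "left_module ?G ?F" by (rule left_module_free[OF L.R.ring_axioms])
  have i_val: "i x s \<in> carrier ?G" if "x \<in> carrier ?L" for x s
    using mod_hom_closed[OF i that] by (auto simp: free_module_carrier)
  define S' where "S' = (\<Union>h\<in>Hom_set C y z. {s. i (e h) s \<noteq> \<zero>\<^bsub>?G\<^esub>})"
  have e_L: "e h \<in> carrier ?L" if "h \<in> Hom_set C y z" for h
    using that by (simp add: L_simps e_closed)
  have "finite {s. i (e h) s \<noteq> \<zero>\<^bsub>?G\<^esub>}" if "h \<in> Hom_set C y z" for h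
    using mod_hom_closed[OF i e_L[OF that]] by (simp add: free_module_carrier)
  then have fin: "finite S'"
    unfolding S'_def by (intro finite_UN_I finite_subset[OF sub finite_Mor])
  have "S' \<subseteq> S"
    using mod_hom_closed[OF i e_L] by (auto simp: S'_def free_module_carrier)
  have one: "\<one>\<^bsub>?G\<^esub> m = (if m = Id C z then \<one> else \<zero>)" for m
    by (simp add: Aut_algebra_def category_algebra_def)
  have i_supp: "i x s = \<zero>\<^bsub>?G\<^esub>" if x: "x \<in> carrier (V (Hom_set C y z))" and s: "s \<notin> S'" for x s
    using x
  proof (induction x rule: V_induct)
    case zero
    show ?case using mod_hom_zero[OF L F i] by (simp add: L_simps)
  next
    case (add f g)
    then show ?case using mod_hom_add[OF i, of f g] by (simp add: L_simps Aut_algebra_simps(2,3))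
  next
    case (basis c h)
    let ?c = "\<lambda>m. c \<otimes> \<one>\<^bsub>?G\<^esub> m"
    have c: "?c \<in> carrier ?G"
      using basis(1) L.R.one_closed by (auto simp: Aut_algebra_simps V_carrier[OF Aut_sub])
    have h: "e h \<in> carrier ?L" by (rule e_L[OF basis(2)])
    have oc: "\<one>\<^bsub>?G\<^esub> m \<in> carrier k" for m by (simp add: one)
    have "cv ?c (e h) = (\<lambda>m. c \<otimes> e h m)"
      using L.smult_one[OF h] by (simp add: fun_eq_iff conv_smult_left basis(1) oc L_simps(4))
    then have "i (\<lambda>m. c \<otimes> e h m) = ?c \<odot>\<^bsub>?F\<^esub> i (e h)"
      using mod_hom_smult[OF i c h] by (simp add: L_simps)
    moreover have "i (e h) s = \<zero>\<^bsub>?G\<^esub>"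
      using s basis(2) by (auto simp: S'_def)
    ultimately show ?case
      using c by simp
  qed
  have ps: "p (basis_vec ?G s) \<in> carrier ?L" if "s \<in> S" for s
    by (rule mod_hom_closed[OF p basis_vec_closed[OF L.R.ring_axioms that]])
  show ?thesis
  proof (rule Hom_exact_dual_basis[OF N.left_module_axioms Q.left_module_axioms _ _ _ H])
    show "(\<lambda>x. i x s) \<in> mod_hom A ?N ?Q" if "s \<in> S'" for s
    proof (rule mod_homI)
      fix x assume x: "x \<in> carrier ?N"
      then show "i x s \<in> carrier ?Q" using i_val by (simp add: N_carrier Q_carrier)
      show "i (x \<oplus>\<^bsub>?N\<^esub> y) s = i x s \<oplus>\<^bsub>?Q\<^esub> i y s" if "y \<in> carrier ?N" for y
        using mod_hom_add[OF i, of x y] x that 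
        by (simp add: N_carrier L_simps(3) span_simps(3) Aut_algebra_simps(3))
      fix a assume a: "a \<in> carrier A"
      have ra: "restr (Aut C z) a \<in> carrier ?G"
        using a by (simp add: Aut_algebra_simps restr_closed[OF Aut_sub] A_simps V_closed)
      have ixQ: "i x s \<in> carrier ?Q" using x i_val by (simp add: N_carrier Q_carrier)
      have "i (a \<odot>\<^bsub>?N\<^esub> x) s = (restr (Aut C z) a \<odot>\<^bsub>?F\<^esub> i x) s"
        using mod_hom_smult[OF i ra, of x] x unfolding span_action_at[OF z a x]
        by (simp add: N_carrier L_simps(4))
      also have "\<dots> = cv (restr (Aut C z) a) (i x s)"
        using ra ixQ by (simp add: Aut_algebra_mult Aut_algebra_simps(1) Q_carrier)
      also have "\<dots> = a \<odot>\<^bsub>?Q\<^esub> i x s"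
        by (rule span_action_at[OF z a ixQ, symmetric])
      finally show "i (a \<odot>\<^bsub>?N\<^esub> x) s = a \<odot>\<^bsub>?Q\<^esub> i x s" .
    qed
    show "(\<lambda>r. cv r (p (basis_vec ?G s))) \<in> mod_hom A ?Q ?N" if "s \<in> S'" for s
    proof (rule mod_homI)
      let ?v = "p (basis_vec ?G s)"
      have v: "?v \<in> carrier ?L" using ps that \<open>S' \<subseteq> S\<close> by blast
      fix r assume r: "r \<in> carrier ?Q"
      then have rG: "r \<in> carrier ?G" by (simp add: Q_carrier)
      have rv: "cv r ?v \<in> carrier ?N"
        using L.smult_closed[OF rG v] by (simp add: N_carrier L_simps(4))
      then show "cv r ?v \<in> carrier ?N" .
      show "cv (r \<oplus>\<^bsub>?Q\<^esub> t) ?v = cv r ?v \<oplus>\<^bsub>?N\<^esub> cv t ?v" if "t \<in> carrier ?Q" for t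
        using L.smult_l_distr[OF rG _ v, of t] that
        by (simp add: Q_carrier span_simps(3) Aut_algebra_simps(3) L_simps(3,4))
      fix a assume a: "a \<in> carrier A"
      have ra: "restr (Aut C z) a \<in> carrier ?G"
        using a by (simp add: Aut_algebra_simps restr_closed[OF Aut_sub] A_simps V_closed)
      have "a \<odot>\<^bsub>?Q\<^esub> r = restr (Aut C z) a \<otimes>\<^bsub>?G\<^esub> r"
        using span_action_at[OF z a r] ra rG by (simp add: Aut_algebra_mult Aut_algebra_simps(1))
      then show "cv (a \<odot>\<^bsub>?Q\<^esub> r) ?v = a \<odot>\<^bsub>?N\<^esub> cv r ?v"
        using L.smult_assoc1[OF ra rG v] span_action_at[OF z a rv] by (simp add: L_simps(4))
    qed
    show "x = (\<Oplus>\<^bsub>?N\<^esub>s\<in>S'. cv (i x s) (p (basis_vec ?G s)))" if x: "x \<in> carrier ?N" for x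
    proof -
      have xL: "x \<in> carrier ?L" using x by (simp add: N_carrier)
      have ix: "i x \<in> carrier ?F" by (rule mod_hom_closed[OF i xL])
      have q: "(\<lambda>s. p (basis_vec ?G s)) \<in> S \<rightarrow> carrier ?L" using ps by auto
      have "x = free_lift ?G ?L (\<lambda>s. p (basis_vec ?G s)) (i x)"
        using mod_hom_free_unique[OF L p ix] pi[OF xL] by simp
      also have "\<dots> = (\<Oplus>\<^bsub>?L\<^esub>s\<in>S'. i x s \<odot>\<^bsub>?L\<^esub> p (basis_vec ?G s))"
        using i_supp[of x] xL by (intro free_lift_eq[OF L q ix fin _ \<open>S' \<subseteq> S\<close>]) (auto simp: L_simps)
      also have "\<dots> = (\<Oplus>\<^bsub>?N\<^esub>s\<in>S'. cv (i x s) (p (basis_vec ?G s)))"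
      proof -
        have "finsum ?L = finsum ?N"
          unfolding finsum_def by (simp add: L_simps span_simps from_to_single)
        then show ?thesis unfolding L_simps(4) by (rule fun_cong[OF fun_cong])
      qed
      finally show ?thesis .
    qed
  qed
qed

text \<open>
  The morphisms starting at \<open>y\<close> and those starting elsewhere are both closed under composition on the
  left, so their spans are complementary left ideals.
\<close>

lemma Hom_exact_from:
  assumes y: "y \<in> Obj C" shows "Hom_exact (span (from_to y (Obj C)))"
proof -
  let ?X = "from_to y (Obj C)"
  have conv: "convex ?X" by (rule convex_from_to_upset) (rule Cod_closed)
  have "convex (Mor C)" by (auto simp: convex_def Comp_closed)
  have cl: "closed_in (Mor C) ?X" "closed_in (Mor C) (Mor C - ?X)"
    by (auto simp: closed_in_def from_to_def Dom_Comp Cod_Comp Cod_closed)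
  have sub: "?X \<subseteq> Mor C" by (auto simp: from_to_def)
  have span_Mor: "a \<odot>\<^bsub>span (Mor C)\<^esub> v = cv a v" if "a \<in> carrier A" "v \<in> carrier A" for a v
    using that by (simp add: span_simps A_simps restr_id conv_closed)
  have 1: "restr ?X \<in> mod_hom A (regular_module A) (span ?X)"
    by (rule mod_homI)
      (use span_restriction[OF \<open>convex (Mor C)\<close> sub cl(2)] span_Mor in
        \<open>auto simp: mod_hom_def span_simps(1,3) A_simps Pi_iff\<close>)
  have 2: "(\<lambda>v. v) \<in> mod_hom A (span ?X) (regular_module A)"
  proof (rule mod_homI)
    fix a v assume a: "a \<in> carrier A" and v: "v \<in> carrier (span ?X)"
    then have "v \<in> carrier A" using V_mono[OF sub] by (simp add: span_simps A_simps)
    then show "a \<odot>\<^bsub>span ?X\<^esub> v = a \<odot>\<^bsub>regular_module A\<^esub> v"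
      using mod_hom_smult[OF span_inclusion[OF \<open>convex (Mor C)\<close> sub cl(1)] a v] span_Mor[OF a]
      by (simp add: A_simps(2))
  qed (use V_mono[OF sub] in \<open>auto simp: span_simps A_simps\<close>)
  interpret N: left_module A "span ?X" by (rule span_module[OF conv])
  show ?thesis
  proof (rule Hom_exact_dual_basis[where S = "{()}" and \<phi> = "\<lambda>_ v. v" and \<psi> = "\<lambda>_. restr ?X",
        OF span_module[OF conv] left_module_regular[OF ring_A] 2 1 _ Hom_exact_regular])
    show "x = (\<Oplus>\<^bsub>span ?X\<^esub>s\<in>{()}. restr ?X x)" if "x \<in> carrier (span ?X)" for x
      using that restr_id[of x ?X] by (simp add: span_simps(1))
  qed
qed

text \<open>
  An up-set \<open>T\<close> of objects is filtered by splitting off an object of greatest height, to which no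
  other object of \<open>T\<close> has a morphism.
\<close>

lemma Hom_exact_upset:
  assumes y: "y \<in> Obj C"
    and H: "\<And>z. z \<in> T \<Longrightarrow> Hom_exact (span (from_to z {z}))"
    and T: "T \<subseteq> Obj C" "\<And>\<alpha>. \<lbrakk>\<alpha> \<in> Mor C; Dom C \<alpha> \<in> T\<rbrakk> \<Longrightarrow> Cod C \<alpha> \<in> T"
    and fin: "finite T"
  shows "Hom_exact (span (from_to y T))"
  using fin H T
proof (induction T rule: finite_psubset_induct)
  case (psubset T)
  show ?case
  proof (cases "T = {}")
    case True
    then have "v = (\<lambda>_. \<zero>)" if "v \<in> carrier (span (from_to y T))" for v
      using that by (auto simp: span_simps from_to_def V_zero fun_eq_iff)
    moreover have "convex (from_to y T)"
      by (rule convex_from_to_upset) (use True in auto)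
    ultimately show ?thesis
      by (intro Hom_exactI bexI[OF _ mod_hom_zero_map[OF span_module]])
        (auto simp: span_simps(2) dest: mod_hom_closed)
  next
    case False
    then have "Max (height ` T) \<in> height ` T"
      using psubset.hyps(1) by (intro Max_in) auto
    then obtain z where z: "z \<in> T" "height z = Max (height ` T)" by auto
    have z_max: "height u \<le> height z" if "u \<in> T" for u
      using that psubset.hyps(1) by (simp add: z(2))
    note z = z(1)
    let ?T = "T - {z}"
    let ?X = "from_to y T"
    have T': "Cod C \<alpha> \<in> ?T" if "\<alpha> \<in> Mor C" "Dom C \<alpha> \<in> ?T" for \<alpha>
      using that psubset.prems(3)[of \<alpha>] height_less[of \<alpha>] z_max[of "Dom C \<alpha>"] by force
    have conv: "convex ?X"
      by (rule convex_from_to_upset[OF psubset.prems(3)])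
    have conv': "convex (from_to y ?T)"
      by (rule convex_from_to_upset[OF T'])
    have sub: "from_to y ?T \<subseteq> ?X" by (auto simp: from_to_def)
    have closed: "closed_in ?X (from_to y ?T)"
      using T' by (auto simp: closed_in_def from_to_def Cod_Comp)
    have diff: "?X - from_to y ?T = from_to y {z}"
      using z by (auto simp: from_to_def)
    have IH: "Hom_exact (span (from_to y ?T))"
      by (rule psubset.IH) (use z psubset.prems T' in auto)
    have zO: "z \<in> Obj C" using z psubset.prems(2) by blast
    show ?thesis
      by (rule Hom_exact_extension[OF span_module[OF conv'] span_module[OF conv]
            span_module[OF convex_Hom_set[of y z]] span_inclusion[OF conv sub closed] _
            span_exact(1,2,4)[OF conv sub closed, unfolded diff] IH
            Hom_exact_Hom_set[OF y zO psubset.prems(1)[OF z]]]) simp_all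
  qed
qed

text \<open>
  The module \<open>k Aut(y)\<close> concentrated at \<open>y\<close> is the quotient of the projective module
  \<open>k Hom(y, -)\<close> by the span of the morphisms from \<open>y\<close> to other objects.  The latter is filtered by
  the modules \<open>k Hom(y, z)\<close> concentrated at \<open>z\<close>, which are direct summands of powers of
  \<open>k Aut(z)\<close>, and \<open>z\<close> has smaller height than \<open>y\<close>.  So by induction on the height exactness
  passes from the regular module to \<open>k Aut(y)\<close>, a module of finite projective dimension.
\<close>

theorem Hom_exact_Aut:
  assumes "y \<in> Obj C" shows "Hom_exact (span (Aut C y))"
proof -
  have "Hom_exact (span (from_to y {y}))"
    using assms
  proof (induction "height y" arbitrary: y rule: less_induct)
    case less
    let ?T = "{z \<in> Obj C. z \<noteq> y \<and> Hom_set C y z \<noteq> {}}"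
    let ?X = "from_to y (Obj C)"
    have up: "Cod C \<alpha> \<in> ?T" if a: "\<alpha> \<in> Mor C" and D: "Dom C \<alpha> \<in> ?T" for \<alpha>
    proof -
      obtain \<beta> where b: "\<beta> \<in> Mor C" "Dom C \<beta> = y" "Cod C \<beta> = Dom C \<alpha>" and "Dom C \<alpha> \<noteq> y"
        using D unfolding Hom_set_def by blast
      then have "Cod C \<alpha> \<noteq> y" using antisymmetric[OF b(1) a] by auto
      moreover have "\<alpha> \<bullet>\<^bsub>C\<^esub> \<beta> \<in> Hom_set C y (Cod C \<alpha>)"
        using a b by (auto simp: Hom_set_def Comp_closed Dom_Comp Cod_Comp)
      ultimately show ?thesis using Cod_closed[OF a] by auto
    qed
    have T: "Hom_exact (span (from_to y ?T))"
    proof (rule Hom_exact_upset[OF less.prems])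
      fix z assume z: "z \<in> ?T"
      then obtain \<beta> where "\<beta> \<in> Mor C" "Dom C \<beta> = y" "Cod C \<beta> = z" "z \<noteq> y" by (auto simp: Hom_set_def)
      then show "Hom_exact (span (from_to z {z}))"
        using less.hyps[of z] height_less[of \<beta>] z by auto
    qed (use up finite_Obj in auto)
    have conv: "convex ?X" by (rule convex_from_to_upset) (rule Cod_closed)
    have conv': "convex (from_to y ?T)"
      by (rule convex_from_to_upset[OF up])
    have sub: "from_to y ?T \<subseteq> ?X" by (auto simp: from_to_def)
    have closed: "closed_in ?X (from_to y ?T)"
      using up by (auto simp: closed_in_def from_to_def Cod_Comp)
    have diff: "?X - from_to y ?T = from_to y {y}"
      using less.prems by (auto simp: from_to_def Hom_set_def)
    show ?case
      by (rule Hom_exact_quotient[OF span_module[OF conv'] span_module[OF conv]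
            span_module[OF convex_Hom_set[of y y]] span_inclusion[OF conv sub closed] _
            span_exact[OF conv sub closed, unfolded diff] T Hom_exact_from[OF less.prems]]) simp_all
  qed
  then show ?thesis by (simp add: from_to_endo[OF assms])
qed

end

section \<open>Quotient modules and the tensor product\<close>

lemma left_module_image:
  assumes M: "left_module A M" and surj: "carrier Q = p ` carrier M" and zero: "\<zero>\<^bsub>Q\<^esub> = p \<zero>\<^bsub>M\<^esub>"
    and add: "\<And>x y. \<lbrakk>x \<in> carrier M; y \<in> carrier M\<rbrakk> \<Longrightarrow> p x \<oplus>\<^bsub>Q\<^esub> p y = p (x \<oplus>\<^bsub>M\<^esub> y)"
    and smult: "\<And>a x. \<lbrakk>a \<in> carrier A; x \<in> carrier M\<rbrakk> \<Longrightarrow> a \<odot>\<^bsub>Q\<^esub> p x = p (a \<odot>\<^bsub>M\<^esub> x)"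
  shows "left_module A Q"
proof -
  interpret M: left_module A M by (rule M)
  have "abelian_group Q"
  proof (rule abelian_groupI)
    fix x assume "x \<in> carrier Q"
    then obtain m where m: "m \<in> carrier M" "x = p m" using surj by auto
    then have "p (\<ominus>\<^bsub>M\<^esub> m) \<oplus>\<^bsub>Q\<^esub> x = \<zero>\<^bsub>Q\<^esub>" by (simp add: add zero M.M.l_neg)
    then show "\<exists>y\<in>carrier Q. y \<oplus>\<^bsub>Q\<^esub> x = \<zero>\<^bsub>Q\<^esub>" using m surj by blast
  qed (auto simp: surj zero add M.M.a_ac)
  then show ?thesis
    by (rule left_moduleI[OF M.R.ring_axioms])
      (auto simp: surj add smult M.smult_closed M.smult_l_distr M.smult_r_distr M.smult_assoc1
        M.smult_one)
qed

lemma submoduleI: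
  assumes M: "left_module A M" and sub: "H \<subseteq> carrier M" and zero: "\<zero>\<^bsub>M\<^esub> \<in> H"
    and add: "\<And>x y. \<lbrakk>x \<in> H; y \<in> H\<rbrakk> \<Longrightarrow> x \<oplus>\<^bsub>M\<^esub> y \<in> H"
    and smult: "\<And>a x. \<lbrakk>a \<in> carrier A; x \<in> H\<rbrakk> \<Longrightarrow> a \<odot>\<^bsub>M\<^esub> x \<in> H"
  shows "submodule H A M"
proof -
  interpret M: left_module A M by (rule M)
  have "\<ominus>\<^bsub>M\<^esub> x \<in> H" if "x \<in> H" for x
    using smult[of "\<ominus>\<^bsub>A\<^esub> \<one>\<^bsub>A\<^esub>" x] that sub by (auto simp: M.smult_minus_one)
  then have "subgroup H (add_monoid M)"
    by (intro subgroup.intro) (use sub zero add in \<open>auto simp: a_inv_def\<close>)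
  then show ?thesis
    by (intro submodule.intro submodule_axioms.intro smult)
qed

lemma submoduleD:
  assumes "submodule H A M"
  shows "H \<subseteq> carrier M" "\<zero>\<^bsub>M\<^esub> \<in> H" "\<lbrakk>x \<in> H; y \<in> H\<rbrakk> \<Longrightarrow> x \<oplus>\<^bsub>M\<^esub> y \<in> H"
    "\<lbrakk>a \<in> carrier A; x \<in> H\<rbrakk> \<Longrightarrow> a \<odot>\<^bsub>M\<^esub> x \<in> H"
proof -
  note sg = submodule.axioms(1)[OF assms]
  show "H \<subseteq> carrier M" "\<zero>\<^bsub>M\<^esub> \<in> H" "\<lbrakk>x \<in> H; y \<in> H\<rbrakk> \<Longrightarrow> x \<oplus>\<^bsub>M\<^esub> y \<in> H"
    using subgroup.subset[OF sg] subgroup.one_closed[OF sg] subgroup.m_closed[OF sg] by simp_all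
qed (rule submodule.smult_closed[OF assms])

lemma quotient_module_facts:
  assumes M: "left_module A M" and H: "submodule H A M"
  shows "left_module A (quotient_module M H)"
    and "(\<lambda>x. H +>\<^bsub>M\<^esub> x) \<in> mod_hom A M (quotient_module M H)"
    and "carrier (quotient_module M H) = (\<lambda>x. H +>\<^bsub>M\<^esub> x) ` carrier M"
    and "\<And>x y. \<lbrakk>x \<in> carrier M; y \<in> carrier M; x \<ominus>\<^bsub>M\<^esub> y \<in> H\<rbrakk> \<Longrightarrow> H +>\<^bsub>M\<^esub> x = H +>\<^bsub>M\<^esub> y"
proof -
  interpret M: left_module A M by (rule M)
  interpret H: abelian_subgroup H M
    by (rule abelian_subgroupI3[OF additive_subgroup.intro[OF submodule.axioms(1)[OF H]]])
      unfold_locales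
  let ?Q = "quotient_module M H"
  note D = submoduleD[OF H]
  show surj: "carrier ?Q = (\<lambda>x. H +>\<^bsub>M\<^esub> x) ` carrier M"
    by (auto simp: quotient_module_def A_RCOSETS_def')
  show eq: "H +>\<^bsub>M\<^esub> x = H +>\<^bsub>M\<^esub> y" if "x \<in> carrier M" "y \<in> carrier M" "x \<ominus>\<^bsub>M\<^esub> y \<in> H" for x y
  proof -
    have "x = (x \<ominus>\<^bsub>M\<^esub> y) \<oplus>\<^bsub>M\<^esub> y"
      using that by (simp add: a_minus_def M.M.a_assoc M.M.l_neg)
    then have "x \<in> H +>\<^bsub>M\<^esub> y" using that(3) by (auto simp: a_r_coset_def')
    then show ?thesis
      using M.a_repr_independence[OF _ that(2) H.a_subgroup] by simp
  qed
  have add: "(H +>\<^bsub>M\<^esub> x) \<oplus>\<^bsub>?Q\<^esub> (H +>\<^bsub>M\<^esub> y) = H +>\<^bsub>M\<^esub> (x \<oplus>\<^bsub>M\<^esub> y)"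
    if "x \<in> carrier M" "y \<in> carrier M" for x y
    using H.a_rcos_sum[OF that] by (simp add: quotient_module_def)
  have smult: "a \<odot>\<^bsub>?Q\<^esub> (H +>\<^bsub>M\<^esub> x) = H +>\<^bsub>M\<^esub> (a \<odot>\<^bsub>M\<^esub> x)"
    if a: "a \<in> carrier A" and x: "x \<in> carrier M" for a x
  proof -
    have "H +>\<^bsub>M\<^esub> (a \<odot>\<^bsub>M\<^esub> y) = H +>\<^bsub>M\<^esub> (a \<odot>\<^bsub>M\<^esub> x)" if y: "y \<in> H +>\<^bsub>M\<^esub> x" for y
    proof -
      obtain h where h: "h \<in> H" "y = h \<oplus>\<^bsub>M\<^esub> x" using y by (auto simp: a_r_coset_def')
      have hM: "h \<in> carrier M" using h D by blast
      have ah: "a \<odot>\<^bsub>M\<^esub> h \<in> H" by (rule D(4)[OF a h(1)])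
      show ?thesis
      proof (rule eq)
        show "a \<odot>\<^bsub>M\<^esub> y \<ominus>\<^bsub>M\<^esub> a \<odot>\<^bsub>M\<^esub> x \<in> H"
          using ah a x hM D(1) unfolding h(2)
          by (simp add: M.smult_r_distr M.smult_closed a_minus_def M.M.a_assoc M.M.r_neg)
      qed (use a x hM in \<open>simp_all add: h(2) M.smult_closed\<close>)
    qed
    then have "(\<Union>y\<in>H +>\<^bsub>M\<^esub> x. H +>\<^bsub>M\<^esub> (a \<odot>\<^bsub>M\<^esub> y)) = (\<Union>y\<in>H +>\<^bsub>M\<^esub> x. H +>\<^bsub>M\<^esub> (a \<odot>\<^bsub>M\<^esub> x))"
      by (rule SUP_cong[OF refl])
    moreover have "H +>\<^bsub>M\<^esub> x \<noteq> {}" using H.a_rcos_self[OF x] by blast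
    ultimately show ?thesis by (simp add: quotient_module_def)
  qed
  have zero: "\<zero>\<^bsub>?Q\<^esub> = H +>\<^bsub>M\<^esub> \<zero>\<^bsub>M\<^esub>"
    using D(1) by (simp add: quotient_module_def)
  show "left_module A ?Q"
    by (rule left_module_image[OF M surj zero add smult])
  show "(\<lambda>x. H +>\<^bsub>M\<^esub> x) \<in> mod_hom A M ?Q"
    by (rule mod_homI) (use surj add smult in auto)
qed

definition bilinear_map ::
    "('k, 'z) ring_scheme \<Rightarrow> ('k, 'v) module \<Rightarrow> ('k, 'w) module \<Rightarrow> ('k, 'u) module \<Rightarrow>
      ('v \<Rightarrow> 'w \<Rightarrow> 'u) \<Rightarrow> bool"
  where "bilinear_map k V W U B \<longleftrightarrow>
    (\<forall>w\<in>carrier W. (\<lambda>v. B v w) \<in> mod_hom k V U) \<and> (\<forall>v\<in>carrier V. B v \<in> mod_hom k W U)"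

text \<open>The linear map on \<open>V \<otimes> W\<close> induced by \<open>B\<close>, computed from an arbitrary representative.\<close>

definition tensor_lift ::
    "('k, 'z) ring_scheme \<Rightarrow> ('k, 'u) module \<Rightarrow> ('v \<Rightarrow> 'w \<Rightarrow> 'u) \<Rightarrow> ('v \<times> 'w \<Rightarrow> 'k) set \<Rightarrow> 'u"
  where "tensor_lift k U B X = the_elem (free_lift k U (\<lambda>p. B (fst p) (snd p)) ` X)"

lemma tensor_map_eq_lift:
  "tensor_map k V W V' W' f g =
    tensor_lift k (tensor_space k V' W') (\<lambda>v w. pure_tensor k V' W' (f v) (g w))"
  by (simp add: fun_eq_iff tensor_map_def tensor_lift_def free_lift_def)

locale tensor_product =
  fixes k :: "('k, 'z) ring_scheme" and V :: "('k, 'v) module" and W :: "('k, 'w) module"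
  assumes k: "cring k" and V: "left_module k V" and W: "left_module k W"
begin

abbreviation F :: "('k, 'v \<times> 'w \<Rightarrow> 'k) module"
  where "F \<equiv> free_module k (carrier V \<times> carrier W)"

abbreviation T :: "('k, ('v \<times> 'w \<Rightarrow> 'k) set) module"
  where "T \<equiv> tensor_space k V W"

abbreviation K :: "('v \<times> 'w \<Rightarrow> 'k) set"
  where "K \<equiv> tensor_kernel k V W"

lemma ring_k: "ring k"
  using k by (rule cring.axioms(1))

lemma F_module: "left_module k F"
  by (rule left_module_free[OF ring_k])

sublocale k: cring k by (rule k)
sublocale V: left_module k V by (rule V)
sublocale W: left_module k W by (rule W)
sublocale F: left_module k F by (rule F_module)

lemma pair_closed: "v \<in> carrier V \<Longrightarrow> w \<in> carrier W \<Longrightarrow> basis_vec k (v, w) \<in> carrier F"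
  by (rule basis_vec_closed[OF ring_k]) simp

lemma tensor_relationsE:
  assumes "r \<in> tensor_relations k V W"
  obtains (add_left) v v' w where "v \<in> carrier V" "v' \<in> carrier V" "w \<in> carrier W"
      "r = basis_vec k (v \<oplus>\<^bsub>V\<^esub> v', w) \<ominus>\<^bsub>F\<^esub> (basis_vec k (v, w) \<oplus>\<^bsub>F\<^esub> basis_vec k (v', w))"
    | (add_right) v w w' where "v \<in> carrier V" "w \<in> carrier W" "w' \<in> carrier W"
      "r = basis_vec k (v, w \<oplus>\<^bsub>W\<^esub> w') \<ominus>\<^bsub>F\<^esub> (basis_vec k (v, w) \<oplus>\<^bsub>F\<^esub> basis_vec k (v, w'))"
    | (smult_left) c v w where "c \<in> carrier k" "v \<in> carrier V" "w \<in> carrier W"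
      "r = basis_vec k (c \<odot>\<^bsub>V\<^esub> v, w) \<ominus>\<^bsub>F\<^esub> c \<odot>\<^bsub>F\<^esub> basis_vec k (v, w)"
    | (smult_right) c v w where "c \<in> carrier k" "v \<in> carrier V" "w \<in> carrier W"
      "r = basis_vec k (v, c \<odot>\<^bsub>W\<^esub> w) \<ominus>\<^bsub>F\<^esub> c \<odot>\<^bsub>F\<^esub> basis_vec k (v, w)"
  using assms unfolding tensor_relations_def Let_def
proof (elim UnE CollectE exE conjE)
qed (rule that, assumption, assumption, assumption, assumption)+

lemma relations_subset: "tensor_relations k V W \<subseteq> carrier F"
proof
  fix r assume "r \<in> tensor_relations k V W"
  then show "r \<in> carrier F"
    by (cases rule: tensor_relationsE)
      (simp_all del: free_module_simps add: pair_closed F.smult_closed V.smult_closed W.smult_closed)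
qed

lemma K_submodule: "submodule K k F"
proof (rule submoduleI[OF F_module])
  have "submodule (carrier F) k F"
    by (rule submoduleI[OF F_module]) (auto simp del: free_module_simps intro: F.smult_closed)
  then show "K \<subseteq> carrier F"
    using relations_subset by (auto simp: tensor_kernel_def)
qed (auto simp only: tensor_kernel_def Inter_iff mem_Collect_eq intro: submoduleD(2-4))

lemma relations_in_K: "tensor_relations k V W \<subseteq> K"
  by (auto simp: tensor_kernel_def)

lemma T_module: "left_module k T"
  unfolding tensor_space_def by (rule quotient_module_facts(1)[OF F_module K_submodule])

sublocale T: left_module k T by (rule T_module)

definition proj :: "('v \<times> 'w \<Rightarrow> 'k) \<Rightarrow> ('v \<times> 'w \<Rightarrow> 'k) set"
  where "proj t = K +>\<^bsub>F\<^esub> t"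

lemma proj_hom: "proj \<in> mod_hom k F T"
  unfolding tensor_space_def proj_def by (rule quotient_module_facts(2)[OF F_module K_submodule])

lemma T_carrier: "carrier T = proj ` carrier F"
  unfolding tensor_space_def proj_def by (rule quotient_module_facts(3)[OF F_module K_submodule])

lemma pure_eq: "pure_tensor k V W v w = proj (basis_vec k (v, w))"
  by (simp add: pure_tensor_def proj_def)

lemma proj_eq:
  assumes "x \<in> carrier F" "y \<in> carrier F" "x \<ominus>\<^bsub>F\<^esub> y \<in> tensor_relations k V W"
  shows "proj x = proj y"
  unfolding proj_def
  by (rule quotient_module_facts(4)[OF F_module K_submodule assms(1,2)])
    (use assms(3) relations_in_K in blast)

lemma pure_closed: "v \<in> carrier V \<Longrightarrow> w \<in> carrier W \<Longrightarrow> pure_tensor k V W v w \<in> carrier T"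
  unfolding pure_eq by (rule mod_hom_closed[OF proj_hom pair_closed])

lemma pure_bilinear: "bilinear_map k V W T (pure_tensor k V W)"
  unfolding bilinear_map_def
proof (intro conjI ballI)
  fix w assume w: "w \<in> carrier W"
  show "(\<lambda>v. pure_tensor k V W v w) \<in> mod_hom k V T"
  proof (rule mod_homI)
    fix v v' assume v: "v \<in> carrier V" "v' \<in> carrier V"
    have "proj (basis_vec k (v \<oplus>\<^bsub>V\<^esub> v', w)) = proj (basis_vec k (v, w) \<oplus>\<^bsub>F\<^esub> basis_vec k (v', w))"
    proof (rule proj_eq)
      show "basis_vec k (v \<oplus>\<^bsub>V\<^esub> v', w) \<ominus>\<^bsub>F\<^esub> (basis_vec k (v, w) \<oplus>\<^bsub>F\<^esub> basis_vec k (v', w)) \<in> tensor_relations k V W"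
        unfolding tensor_relations_def Let_def Un_iff using v w by blast
    qed (use v w in \<open>simp_all del: free_module_simps add: pair_closed\<close>)
    then show "pure_tensor k V W (v \<oplus>\<^bsub>V\<^esub> v') w = pure_tensor k V W v w \<oplus>\<^bsub>T\<^esub> pure_tensor k V W v' w"
      unfolding pure_eq mod_hom_add[OF proj_hom pair_closed[OF v(1) w] pair_closed[OF v(2) w]] .
  next
    fix c v assume c: "c \<in> carrier k" and v: "v \<in> carrier V"
    have "proj (basis_vec k (c \<odot>\<^bsub>V\<^esub> v, w)) = proj (c \<odot>\<^bsub>F\<^esub> basis_vec k (v, w))"
    proof (rule proj_eq)
      show "basis_vec k (c \<odot>\<^bsub>V\<^esub> v, w) \<ominus>\<^bsub>F\<^esub> c \<odot>\<^bsub>F\<^esub> basis_vec k (v, w) \<in> tensor_relations k V W"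
        unfolding tensor_relations_def Let_def Un_iff using c v w by blast
    qed (use c v w in \<open>simp_all del: free_module_simps add: pair_closed V.smult_closed F.smult_closed\<close>)
    then show "pure_tensor k V W (c \<odot>\<^bsub>V\<^esub> v) w = c \<odot>\<^bsub>T\<^esub> pure_tensor k V W v w"
      unfolding pure_eq mod_hom_smult[OF proj_hom c pair_closed[OF v w]] .
  qed (rule pure_closed[OF _ w])
next
  fix v assume v: "v \<in> carrier V"
  show "pure_tensor k V W v \<in> mod_hom k W T"
  proof (rule mod_homI)
    fix w w' assume w: "w \<in> carrier W" "w' \<in> carrier W"
    have "proj (basis_vec k (v, w \<oplus>\<^bsub>W\<^esub> w')) = proj (basis_vec k (v, w) \<oplus>\<^bsub>F\<^esub> basis_vec k (v, w'))"
    proof (rule proj_eq)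
      show "basis_vec k (v, w \<oplus>\<^bsub>W\<^esub> w') \<ominus>\<^bsub>F\<^esub> (basis_vec k (v, w) \<oplus>\<^bsub>F\<^esub> basis_vec k (v, w')) \<in> tensor_relations k V W"
        unfolding tensor_relations_def Let_def Un_iff using v w by blast
    qed (use v w in \<open>simp_all del: free_module_simps add: pair_closed\<close>)
    then show "pure_tensor k V W v (w \<oplus>\<^bsub>W\<^esub> w') = pure_tensor k V W v w \<oplus>\<^bsub>T\<^esub> pure_tensor k V W v w'"
      unfolding pure_eq mod_hom_add[OF proj_hom pair_closed[OF v w(1)] pair_closed[OF v w(2)]] .
  next
    fix c w assume c: "c \<in> carrier k" and w: "w \<in> carrier W"
    have "proj (basis_vec k (v, c \<odot>\<^bsub>W\<^esub> w)) = proj (c \<odot>\<^bsub>F\<^esub> basis_vec k (v, w))"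
    proof (rule proj_eq)
      show "basis_vec k (v, c \<odot>\<^bsub>W\<^esub> w) \<ominus>\<^bsub>F\<^esub> c \<odot>\<^bsub>F\<^esub> basis_vec k (v, w) \<in> tensor_relations k V W"
        unfolding tensor_relations_def Let_def Un_iff using c v w by blast
    qed (use c v w in \<open>simp_all del: free_module_simps add: pair_closed W.smult_closed F.smult_closed\<close>)
    then show "pure_tensor k V W v (c \<odot>\<^bsub>W\<^esub> w) = c \<odot>\<^bsub>T\<^esub> pure_tensor k V W v w"
      unfolding pure_eq mod_hom_smult[OF proj_hom c pair_closed[OF v w]] .
  qed (rule pure_closed[OF v])
qed

context
  fixes U :: "('k, 'u) module" and B :: "'v \<Rightarrow> 'w \<Rightarrow> 'u"
  assumes U: "left_module k U" and B: "bilinear_map k V W U B"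
begin

interpretation U: left_module k U by (rule U)

abbreviation lift :: "('v \<times> 'w \<Rightarrow> 'k) \<Rightarrow> 'u"
  where "lift \<equiv> free_lift k U (\<lambda>p. B (fst p) (snd p))"

lemma B_left: "w \<in> carrier W \<Longrightarrow> (\<lambda>v. B v w) \<in> mod_hom k V U"
  and B_right: "v \<in> carrier V \<Longrightarrow> B v \<in> mod_hom k W U"
  using B by (auto simp: bilinear_map_def)

lemma B_closed: "v \<in> carrier V \<Longrightarrow> w \<in> carrier W \<Longrightarrow> B v w \<in> carrier U"
  using mod_hom_closed[OF B_right] .

lemma B_funcset: "(\<lambda>p. B (fst p) (snd p)) \<in> carrier V \<times> carrier W \<rightarrow> carrier U"
  using B_closed by auto

lemma lift_hom: "lift \<in> mod_hom k F U"
  by (rule free_lift_hom[OF U B_funcset])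

lemma lift_basis: "v \<in> carrier V \<Longrightarrow> w \<in> carrier W \<Longrightarrow> lift (basis_vec k (v, w)) = B v w"
  using free_lift_basis[OF U B_funcset, of "(v, w)"] by simp

lemma lift_kills_kernel:
  assumes "t \<in> K" shows "lift t = \<zero>\<^bsub>U\<^esub>"
proof -
  let ?H = "{t \<in> carrier F. lift t = \<zero>\<^bsub>U\<^esub>}"
  have "submodule ?H k F"
    by (rule submoduleI[OF F_module])
      (use mod_hom_zero[OF F_module U lift_hom] in \<open>simp_all del: free_module_simps
        add: mod_hom_add[OF lift_hom] mod_hom_smult[OF lift_hom] F.smult_closed F.M.zero_closed\<close>)
  moreover have "r \<in> ?H" if "r \<in> tensor_relations k V W" for r
  proof -
    have diff: "lift (x \<ominus>\<^bsub>F\<^esub> y) = \<zero>\<^bsub>U\<^esub>" if "x \<in> carrier F" "y \<in> carrier F" "lift x = lift y" for x y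
      using mod_hom_diff[OF F_module U lift_hom that(1,2)] that(3) mod_hom_closed[OF lift_hom that(2)]
      by (simp add: a_minus_def U.M.r_neg)
    have "lift r = \<zero>\<^bsub>U\<^esub>"
      using that
    proof (cases rule: tensor_relationsE)
      case (add_left v v' w)
      show ?thesis
        unfolding add_left(4)
        by (rule diff) (use add_left(1-3) mod_hom_add[OF B_left] in \<open>simp_all del: free_module_simps
          add: pair_closed lift_basis mod_hom_add[OF lift_hom]\<close>)
    next
      case (add_right v w w')
      show ?thesis
        unfolding add_right(4)
        by (rule diff) (use add_right(1-3) mod_hom_add[OF B_right] in \<open>simp_all del: free_module_simps
          add: pair_closed lift_basis mod_hom_add[OF lift_hom]\<close>)
    next
      case (smult_left c v w)
      show ?thesis
        unfolding smult_left(4)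
        by (rule diff) (use smult_left(1-3) mod_hom_smult[OF B_left] in \<open>simp_all del: free_module_simps
          add: pair_closed lift_basis mod_hom_smult[OF lift_hom] V.smult_closed F.smult_closed\<close>)
    next
      case (smult_right c v w)
      show ?thesis
        unfolding smult_right(4)
        by (rule diff) (use smult_right(1-3) mod_hom_smult[OF B_right] in \<open>simp_all del: free_module_simps
          add: pair_closed lift_basis mod_hom_smult[OF lift_hom] W.smult_closed F.smult_closed\<close>)
    qed
    then show ?thesis using that relations_subset by blast
  qed
  ultimately have "K \<subseteq> ?H"
    unfolding tensor_kernel_def by blast
  then show ?thesis using assms by blast
qed

lemma tensor_lift_proj:
  assumes t: "t \<in> carrier F" shows "tensor_lift k U B (proj t) = lift t"
proof -
  have "lift x = lift t" if x: "x \<in> proj t" for x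
  proof -
    obtain h where h: "h \<in> K" "x = h \<oplus>\<^bsub>F\<^esub> t"
      using x unfolding proj_def a_r_coset_def' by auto
    have "h \<in> carrier F" using h(1) submoduleD(1)[OF K_submodule] by blast
    then show ?thesis
      using mod_hom_add[OF lift_hom _ t] lift_kills_kernel[OF h(1)] mod_hom_closed[OF lift_hom t]
      by (simp add: h(2) del: free_module_simps)
  qed
  moreover have "t \<in> proj t"
  proof -
    have "\<zero>\<^bsub>F\<^esub> \<oplus>\<^bsub>F\<^esub> t \<in> proj t"
      using submoduleD(2)[OF K_submodule] unfolding proj_def a_r_coset_def' by blast
    then show ?thesis using F.M.l_zero[OF t] by simp
  qed
  ultimately have "lift ` proj t = {lift t}" by blast
  then show ?thesis by (simp add: tensor_lift_def)
qed

lemma tensor_lift_hom: "tensor_lift k U B \<in> mod_hom k T U"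
proof (rule mod_homI)
  fix x assume "x \<in> carrier T"
  then obtain t where t: "t \<in> carrier F" "x = proj t" using T_carrier by auto
  show "tensor_lift k U B x \<in> carrier U"
    using tensor_lift_proj[OF t(1)] mod_hom_closed[OF lift_hom t(1)] by (simp add: t(2))
  show "tensor_lift k U B (c \<odot>\<^bsub>T\<^esub> x) = c \<odot>\<^bsub>U\<^esub> tensor_lift k U B x" if c: "c \<in> carrier k" for c
    using mod_hom_smult[OF proj_hom c t(1)] mod_hom_smult[OF lift_hom c t(1)]
      tensor_lift_proj[OF t(1)] tensor_lift_proj[OF F.smult_closed[OF c t(1)]] by (metis t(2))
  show "tensor_lift k U B (x \<oplus>\<^bsub>T\<^esub> y) = tensor_lift k U B x \<oplus>\<^bsub>U\<^esub> tensor_lift k U B y"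
    if "y \<in> carrier T" for y
  proof -
    obtain u where u: "u \<in> carrier F" "y = proj u" using \<open>y \<in> carrier T\<close> T_carrier by auto
    show ?thesis
      using mod_hom_add[OF proj_hom t(1) u(1)] mod_hom_add[OF lift_hom t(1) u(1)]
        tensor_lift_proj[OF t(1)] tensor_lift_proj[OF u(1)] tensor_lift_proj[OF F.M.a_closed[OF t(1) u(1)]]
      by (metis t(2) u(2))
  qed
qed

lemma tensor_lift_pure:
  "v \<in> carrier V \<Longrightarrow> w \<in> carrier W \<Longrightarrow> tensor_lift k U B (pure_tensor k V W v w) = B v w"
  using tensor_lift_proj[OF pair_closed] lift_basis by (simp add: pure_eq)

end

lemma tensor_hom_eqI:
  assumes U: "left_module k U" and f: "f \<in> mod_hom k T U" and g: "g \<in> mod_hom k T U"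
    and eq: "\<And>v w. \<lbrakk>v \<in> carrier V; w \<in> carrier W\<rbrakk> \<Longrightarrow>
      f (pure_tensor k V W v w) = g (pure_tensor k V W v w)"
    and x: "x \<in> carrier T"
  shows "f x = g x"
proof -
  obtain t where t: "t \<in> carrier F" "x = proj t" using x T_carrier by auto
  have "f (proj t) = g (proj t)"
    by (rule mod_hom_free_eqI[OF U mod_hom_compose[OF proj_hom f] mod_hom_compose[OF proj_hom g] _ t(1)])
      (auto simp: eq pure_eq[symmetric])
  then show ?thesis by (simp add: t(2))
qed

end

lemma tensor_map_facts:
  assumes k: "cring k" and V: "left_module k V" and W: "left_module k W"
    and V': "left_module k V'" and W': "left_module k W'"
    and f: "f \<in> mod_hom k V V'" and g: "g \<in> mod_hom k W W'"
  shows "tensor_map k V W V' W' f g \<in> mod_hom k (tensor_space k V W) (tensor_space k V' W')"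
    and "\<lbrakk>v \<in> carrier V; w \<in> carrier W\<rbrakk> \<Longrightarrow>
      tensor_map k V W V' W' f g (pure_tensor k V W v w) = pure_tensor k V' W' (f v) (g w)"
proof -
  interpret S: tensor_product k V W by (rule tensor_product.intro[OF k V W])
  interpret T: tensor_product k V' W' by (rule tensor_product.intro[OF k V' W'])
  have "bilinear_map k V W (tensor_space k V' W') (\<lambda>v w. pure_tensor k V' W' (f v) (g w))"
    using T.pure_bilinear mod_hom_closed[OF f] mod_hom_closed[OF g] f g
    unfolding bilinear_map_def by (auto intro: mod_hom_compose[OF f] mod_hom_compose[OF g])
  from S.tensor_lift_hom[OF T.T_module this] S.tensor_lift_pure[OF T.T_module this]
  show "tensor_map k V W V' W' f g \<in> mod_hom k (tensor_space k V W) (tensor_space k V' W')"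
    "\<lbrakk>v \<in> carrier V; w \<in> carrier W\<rbrakk> \<Longrightarrow>
      tensor_map k V W V' W' f g (pure_tensor k V W v w) = pure_tensor k V' W' (f v) (g w)"
    by (simp_all add: tensor_map_eq_lift)
qed

section \<open>Representable functors\<close>

lemma finitely_generated_free:
  assumes "field k" "finite S" shows "finitely_generated k (free_module k S)"
proof -
  interpret field k by (rule assms(1))
  let ?F = "free_module k S"
  interpret F: left_module k ?F by (rule left_module_free[OF ring_axioms])
  let ?b = "basis_vec k"
  have inj: "inj_on ?b S"
    by (rule inj_onI) (metis basis_vec_def one_not_zero)
  show ?thesis
    unfolding finitely_generated_def
  proof (intro exI[of _ "?b ` S"] conjI ballI)
    show "finite (?b ` S)" using assms(2) by simp
    show b: "?b ` S \<subseteq> carrier ?F" by (rule image_subsetI) (rule basis_vec_closed[OF ring_axioms])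
    fix t assume t: "t \<in> carrier ?F"
    let ?c = "\<lambda>b. t (inv_into S ?b b)"
    have tk: "t s \<in> carrier k" for s using t by (simp add: free_module_carrier)
    have "t = free_lift k ?F ?b t"
      using mod_hom_free_unique[OF F.left_module_axioms mod_hom_id t] .
    also have "\<dots> = (\<Oplus>\<^bsub>?F\<^esub>s\<in>S. t s \<odot>\<^bsub>?F\<^esub> ?b s)"
      by (rule free_lift_eq[OF F.left_module_axioms _ t assms(2)])
        (use b t in \<open>auto simp: free_module_carrier\<close>)
    also have "\<dots> = (\<Oplus>\<^bsub>?F\<^esub>s\<in>S. ?c (?b s) \<odot>\<^bsub>?F\<^esub> ?b s)"
      by (rule F.M.finsum_cong')
        (use b tk inj in \<open>auto simp del: free_module_simps intro!: F.smult_closed\<close>)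
    also have "\<dots> = (\<Oplus>\<^bsub>?F\<^esub>b\<in>?b ` S. ?c b \<odot>\<^bsub>?F\<^esub> b)"
      by (rule F.M.finsum_reindex[symmetric])
        (use b tk inj in \<open>auto simp del: free_module_simps intro!: F.smult_closed\<close>)
    finally show "\<exists>c\<in>?b ` S \<rightarrow> carrier k. t = (\<Oplus>\<^bsub>?F\<^esub>b\<in>?b ` S. c b \<odot>\<^bsub>?F\<^esub> b)"
      using tk by (intro bexI[of _ ?c]) auto
  qed
qed

context EI_category_over_field
begin

text \<open>
  Functors into vector spaces of sequences: morphisms are numbered, and \<open>enc\<close> and \<open>dec\<close> translate
  between sequences and functions on morphisms.
\<close>

definition idx :: "'m \<Rightarrow> nat"
  where "idx = (SOME f. inj_on f (Mor C))"

lemma inj_idx: "inj_on idx (Mor C)"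
  unfolding idx_def using finite_imp_inj_to_nat_seg[OF finite_Mor] by (metis someI)

definition dec :: "('m \<Rightarrow> 'k) \<Rightarrow> nat \<Rightarrow> 'k"
  where "dec f n = (if n \<in> idx ` Mor C then f (inv_into (Mor C) idx n) else \<zero>)"

definition enc :: "(nat \<Rightarrow> 'k) \<Rightarrow> 'm \<Rightarrow> 'k"
  where "enc v m = (if m \<in> Mor C then v (idx m) else \<zero>)"

lemma dec_idx [simp]: "m \<in> Mor C \<Longrightarrow> dec f (idx m) = f m"
  using inj_idx by (simp add: dec_def)

lemma enc_dec: "f \<in> carrier (V (Mor C)) \<Longrightarrow> enc (dec f) = f"
  by (auto simp: enc_def V_zero fun_eq_iff)

abbreviation S :: "'m set \<Rightarrow> ('k, nat \<Rightarrow> 'k) module"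
  where "S X \<equiv> free_module k (idx ` X)"

lemma S_carrier:
  assumes "X \<subseteq> Mor C"
  shows "v \<in> carrier (S X) \<longleftrightarrow> (\<forall>n. v n \<in> carrier k) \<and> (\<forall>n. n \<notin> idx ` X \<longrightarrow> v n = \<zero>)"
  by (rule free_module_carrier_finite) (use finite_subset[OF assms finite_Mor] in simp)

lemma enc_closed:
  assumes X: "X \<subseteq> Mor C" and v: "v \<in> carrier (S X)"
  shows "enc v \<in> carrier (V X)"
proof -
  have "v (idx m) = \<zero>" if "m \<in> Mor C" "m \<notin> X" for m
    using v that inj_on_image_mem_iff[OF inj_idx that(1) X] by (simp add: S_carrier[OF X])
  then show ?thesis
    using v by (auto simp: S_carrier[OF X] V_carrier[OF X] enc_def)
qed

lemma dec_closed: "X \<subseteq> Mor C \<Longrightarrow> f \<in> carrier (V X) \<Longrightarrow> dec f \<in> carrier (S X)"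
  by (auto simp: S_carrier V_carrier dec_def inv_into_f_f[OF inj_idx])

lemma dec_enc:
  assumes "X \<subseteq> Mor C" "v \<in> carrier (S X)"
  shows "dec (enc v) = v"
proof
  fix n
  show "dec (enc v) n = v n"
  proof (cases "n \<in> idx ` Mor C")
    case True
    then show ?thesis by (auto simp: enc_def)
  next
    case False
    then have "n \<notin> idx ` X" using assms(1) by auto
    then show ?thesis using assms False by (simp add: S_carrier dec_def)
  qed
qed

lemma Hom_sub: "Hom_set C x y \<subseteq> Mor C"
  by (auto simp: Hom_set_def)

lemma conv_e_closed:
  assumes "\<alpha> \<in> Mor C" "f \<in> carrier (V (Hom_set C w (Dom C \<alpha>)))"
  shows "cv (e \<alpha>) f \<in> carrier (V (Hom_set C w (Cod C \<alpha>)))"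
proof -
  have "cv (e \<alpha>) f m = \<zero>" if "m \<notin> Hom_set C w (Cod C \<alpha>)" for m
  proof (rule conv_zeroI)
    fix \<alpha>' \<beta> assume p: "(\<alpha>', \<beta>) \<in> pairs m"
    have "\<alpha>' \<noteq> \<alpha> \<or> \<beta> \<notin> Hom_set C w (Dom C \<alpha>)"
      using p that by (auto simp: pairs_def Hom_set_def Dom_Comp Cod_Comp Comp_closed)
    then show "e \<alpha> \<alpha>' \<otimes> f \<beta> = \<zero>"
      using assms by (auto simp: e_val V_zero V_closed)
  qed
  then show ?thesis
    using assms(2) by (auto simp: V_carrier[OF Hom_sub] conv_val_closed)
qed

lemma conv_e_Comp:
  assumes "\<beta> \<in> Mor C" "\<alpha> \<in> Mor C" "Dom C \<beta> = Cod C \<alpha>" "f \<in> carrier (V (Mor C))"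
  shows "cv (e (\<beta> \<bullet>\<^bsub>C\<^esub> \<alpha>)) f = cv (e \<beta>) (cv (e \<alpha>) f)"
  using conv_assoc[OF e_closed[OF assms(1)] e_closed[OF assms(2)] assms(4)] assms
  by (simp add: conv_basis)

lemma conv_e_Id:
  assumes "x \<in> Obj C" "f \<in> carrier (V (Hom_set C w x))"
  shows "cv (e (Id C x)) f = f"
  using assms(2)
proof (induction f rule: V_induct)
  case (add f g)
  then show ?case by (simp add: fun_eq_iff conv_add_right V_closed)
next
  case (basis c \<beta>)
  then have "\<beta> \<in> Mor C" "Cod C \<beta> = x" by (auto simp: Hom_set_def)
  then have "cv (e (Id C x)) (e \<beta>) = e \<beta>"
    using Id_Comp[of \<beta>] assms(1) by (simp add: conv_basis Id_closed Dom_Id)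
  then show ?case
    using basis by (simp add: fun_eq_iff conv_smult_right)
qed simp

definition rep :: "'o \<Rightarrow> ('o, 'm, 'k, nat \<Rightarrow> 'k) vect_functor"
  where "rep w = \<lparr>obj_map = (\<lambda>x. S (Hom_set C w x)), mor_map = (\<lambda>\<alpha> v. dec (cv (e \<alpha>) (enc v)))\<rparr>"

lemma rep_simps: "obj_map (rep w) x = S (Hom_set C w x)" "mor_map (rep w) \<alpha> v = dec (cv (e \<alpha>) (enc v))"
  by (simp_all add: rep_def)

lemma rep_mor_closed:
  assumes "\<alpha> \<in> Mor C" "v \<in> carrier (S (Hom_set C w (Dom C \<alpha>)))"
  shows "mor_map (rep w) \<alpha> v \<in> carrier (S (Hom_set C w (Cod C \<alpha>)))"
  unfolding rep_simps by (intro dec_closed Hom_sub conv_e_closed enc_closed assms)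

lemma enc_rep_mor:
  assumes "\<alpha> \<in> Mor C" "v \<in> carrier (S (Hom_set C w (Dom C \<alpha>)))"
  shows "enc (mor_map (rep w) \<alpha> v) = cv (e \<alpha>) (enc v)"
  unfolding rep_simps
  by (rule enc_dec, rule V_mono[OF Hom_sub], rule conv_e_closed[OF assms(1)], rule enc_closed[OF Hom_sub assms(2)])

lemma S_module: "left_module k (S X)"
  by (rule left_module_free[OF ring_axioms])

lemma S_closed: "v \<in> carrier (S X) \<Longrightarrow> v n \<in> carrier k"
  by (simp add: free_module_carrier)

lemma enc_val_closed: "(\<And>n. v n \<in> carrier k) \<Longrightarrow> enc v m \<in> carrier k"
  by (simp add: enc_def)

lemma rep_mor_hom:
  assumes \<alpha>: "\<alpha> \<in> Mor C"
  shows "mor_map (rep w) \<alpha> \<in> mod_hom k (S (Hom_set C w (Dom C \<alpha>))) (S (Hom_set C w (Cod C \<alpha>)))"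
proof (rule mod_homI)
  fix u v assume "u \<in> carrier (S (Hom_set C w (Dom C \<alpha>)))" "v \<in> carrier (S (Hom_set C w (Dom C \<alpha>)))"
  note cl = S_closed[OF this(1)] S_closed[OF this(2)]
  have eq: "enc (\<lambda>n. u n \<oplus> v n) = (\<lambda>m. enc u m \<oplus> enc v m)"
    by (auto simp: enc_def fun_eq_iff)
  show "mor_map (rep w) \<alpha> (u \<oplus>\<^bsub>S (Hom_set C w (Dom C \<alpha>))\<^esub> v) =
      mor_map (rep w) \<alpha> u \<oplus>\<^bsub>S (Hom_set C w (Cod C \<alpha>))\<^esub> mor_map (rep w) \<alpha> v"
    by (auto simp: rep_simps dec_def eq conv_add_right cl enc_val_closed)
next
  fix c v assume c: "c \<in> carrier k" and "v \<in> carrier (S (Hom_set C w (Dom C \<alpha>)))"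
  note cl = S_closed[OF this(2)]
  have eq: "enc (\<lambda>n. c \<otimes> v n) = (\<lambda>m. c \<otimes> enc v m)"
    using c by (auto simp: enc_def fun_eq_iff)
  show "mor_map (rep w) \<alpha> (c \<odot>\<^bsub>S (Hom_set C w (Dom C \<alpha>))\<^esub> v) =
      c \<odot>\<^bsub>S (Hom_set C w (Cod C \<alpha>))\<^esub> mor_map (rep w) \<alpha> v"
    using c by (auto simp: rep_simps dec_def eq conv_smult_right cl enc_val_closed)
qed (rule rep_mor_closed[OF \<alpha>])

lemma fd_functor_rep: "fd_functor k C (rep w)"
proof (intro fd_functor.intro fd_functor_axioms.intro)
  show "field k" "category C" by unfold_locales
  fix x assume x: "x \<in> Obj C"
  show "module k (obj_map (rep w) x)"
    unfolding rep_simps by (rule left_module_imp_module[OF _ S_module]) unfold_locales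
  show "finitely_generated k (obj_map (rep w) x)"
    unfolding rep_simps
    by (rule finitely_generated_free) (unfold_locales, use finite_subset[OF Hom_sub finite_Mor] in simp)
  fix v assume v: "v \<in> carrier (obj_map (rep w) x)"
  then show "mor_map (rep w) (Id C x) v = v"
    unfolding rep_simps using conv_e_Id[OF x enc_closed[OF Hom_sub]] dec_enc[OF Hom_sub] by metis
next
  fix \<alpha> assume "\<alpha> \<in> Mor C"
  then show "mor_map (rep w) \<alpha> \<in> mod_hom k (obj_map (rep w) (Dom C \<alpha>)) (obj_map (rep w) (Cod C \<alpha>))"
    using rep_mor_hom by (simp add: rep_simps(1))
next
  fix \<beta> \<alpha> v assume *: "\<beta> \<in> Mor C" "\<alpha> \<in> Mor C" "Dom C \<beta> = Cod C \<alpha>"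
    and v: "v \<in> carrier (obj_map (rep w) (Dom C \<alpha>))"
  have f: "enc v \<in> carrier (V (Hom_set C w (Dom C \<alpha>)))"
    using v by (simp add: rep_simps enc_closed[OF Hom_sub])
  have "enc (dec (cv (e \<alpha>) (enc v))) = cv (e \<alpha>) (enc v)"
    by (rule enc_dec) (rule V_mono[OF Hom_sub conv_e_closed[OF *(2) f]])
  then show "mor_map (rep w) (\<beta> \<bullet>\<^bsub>C\<^esub> \<alpha>) v = mor_map (rep w) \<beta> (mor_map (rep w) \<alpha> v)"
    using conv_e_Comp[OF * V_mono[OF Hom_sub f]] by (simp add: rep_simps)
qed

lemma conv_expand:
  assumes a: "a \<in> carrier A" and g: "\<And>m. g m \<in> carrier k"
  shows "cv a g m = (\<Oplus>\<alpha>\<in>Mor C. a \<alpha> \<otimes> cv (e \<alpha>) g m)"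
  using a unfolding A_simps
proof (induction a rule: V_induct)
  case zero
  have "(\<Oplus>\<alpha>\<in>Mor C. \<zero> \<otimes> cv (e \<alpha>) g m) = (\<Oplus>\<alpha>\<in>Mor C. \<zero>)"
    by (rule finsum_cong') (auto simp: g conv_val_closed)
  then show ?case by (simp add: g)
next
  case (add a b)
  note cl = V_closed[OF add(1)] V_closed[OF add(2)]
  have "(\<Oplus>\<alpha>\<in>Mor C. (a \<alpha> \<oplus> b \<alpha>) \<otimes> cv (e \<alpha>) g m) =
      (\<Oplus>\<alpha>\<in>Mor C. a \<alpha> \<otimes> cv (e \<alpha>) g m \<oplus> b \<alpha> \<otimes> cv (e \<alpha>) g m)"
    by (rule finsum_cong') (auto simp: cl g conv_val_closed l_distr)
  then show ?case
    using add cl g by (simp add: conv_add_left finsum_addf Pi_iff conv_val_closed)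
next
  case (basis c \<mu>)
  have "(\<Oplus>\<alpha>\<in>Mor C. c \<otimes> e \<mu> \<alpha> \<otimes> cv (e \<alpha>) g m) =
      (\<Oplus>\<alpha>\<in>Mor C. if \<mu> = \<alpha> then c \<otimes> cv (e \<alpha>) g m else \<zero>)"
    by (rule finsum_cong') (auto simp: g conv_val_closed e_val basis)
  also have "\<dots> = c \<otimes> cv (e \<mu>) g m"
    using finsum_singleton[OF basis(2) finite_Mor, of "\<lambda>\<alpha>. c \<otimes> cv (e \<alpha>) g m"] g basis
    by (simp add: conv_val_closed Pi_iff)
  finally show ?case
    using basis g by (simp add: conv_smult_left)
qed

lemma total_module_simps:
  "carrier (total_module C F) = (\<Pi>\<^sub>E x\<in>Obj C. carrier (obj_map F x))"
  "\<zero>\<^bsub>total_module C F\<^esub> = (\<lambda>x\<in>Obj C. \<zero>\<^bsub>obj_map F x\<^esub>)"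
  "v \<oplus>\<^bsub>total_module C F\<^esub> u = (\<lambda>x\<in>Obj C. v x \<oplus>\<^bsub>obj_map F x\<^esub> u x)"
  "a \<odot>\<^bsub>total_module C F\<^esub> v = (\<lambda>y\<in>Obj C. \<Oplus>\<^bsub>obj_map F y\<^esub>\<alpha>\<in>{\<alpha> \<in> Mor C. Cod C \<alpha> = y}.
    a \<alpha> \<odot>\<^bsub>obj_map F y\<^esub> mor_map F \<alpha> (v (Dom C \<alpha>)))"
  by (simp_all add: total_module_def)

text \<open>
  The representable functor at \<open>w\<close> corresponds to the left ideal \<open>A\<epsilon>\<close> generated by the identity
  \<open>\<epsilon>\<close> of \<open>w\<close>, and to the retraction \<open>a \<mapsto> a\<epsilon>\<close>.
\<close>

lemma Gorenstein_projective_rep: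
  assumes w: "w \<in> Obj C"
  shows "Gorenstein_projective A (total_module C (rep w))"
proof -
  let ?M = "total_module C (rep w)"
  let ?X = "{m \<in> Mor C. Dom C m = w}"
  have sub: "?X \<subseteq> Mor C" by auto
  have R: "left_module A (regular_module A)" by (rule left_module_regular[OF ring_A])
  define j :: "('o \<Rightarrow> nat \<Rightarrow> 'k) \<Rightarrow> 'm \<Rightarrow> 'k"
    where "j v m = (if m \<in> ?X then v (Cod C m) (idx m) else \<zero>)" for v m
  define q :: "('m \<Rightarrow> 'k) \<Rightarrow> 'o \<Rightarrow> nat \<Rightarrow> 'k"
    where "q a = (\<lambda>x\<in>Obj C. dec (restr (Hom_set C w x) a))" for a
  have comp: "v x \<in> carrier (S (Hom_set C w x))" if "v \<in> carrier ?M" "x \<in> Obj C" for v x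
    using that by (auto simp: total_module_simps rep_simps)
  have M_I: "v \<in> carrier ?M"
    if "v \<in> extensional (Obj C)" "\<And>x. x \<in> Obj C \<Longrightarrow> v x \<in> carrier (S (Hom_set C w x))" for v
    using that by (auto simp: total_module_simps rep_simps PiE_def Pi_iff)
  have val: "v x n \<in> carrier k" if "v \<in> carrier ?M" "x \<in> Obj C" for v x n
    by (rule S_closed[OF comp[OF that]])
  have j_V: "j v \<in> carrier (V ?X)" if "v \<in> carrier ?M" for v
    using val[OF that] Cod_closed by (auto simp: V_carrier[OF sub] j_def)
  have j_A: "j v \<in> carrier A" if "v \<in> carrier ?M" for v
    using V_mono[OF sub j_V[OF that]] by (simp add: A_simps)
  have q_M: "q a \<in> carrier ?M" if "a \<in> carrier A" for a
    unfolding q_def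
    by (rule M_I) (use that in \<open>auto intro!: dec_closed restr_closed Hom_sub simp: A_simps V_closed\<close>)
  have jq: "j (q a) = restr ?X a" if "a \<in> carrier A" for a
    by (auto simp: j_def q_def restr_def fun_eq_iff Cod_closed Hom_set_def)
  have qj: "q (j v) = v" if v: "v \<in> carrier ?M" for v
  proof (rule extensionalityI[of _ "Obj C"])
    show "v \<in> extensional (Obj C)" using v by (simp add: total_module_simps(1) PiE_def)
    fix x assume x: "x \<in> Obj C"
    have "restr (Hom_set C w x) (j v) m = enc (v x) m" for m
      using V_zero[OF enc_closed[OF Hom_sub comp[OF v x]], of m]
      by (cases "m \<in> Hom_set C w x") (auto simp: restr_def j_def enc_def Hom_set_def)
    then have "restr (Hom_set C w x) (j v) = enc (v x)" by blast
    then show "q (j v) x = v x"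
      using x dec_enc[OF Hom_sub comp[OF v x]] by (simp add: q_def)
  qed (simp add: q_def)
  have summand: "(\<lambda>\<alpha>. a \<alpha> \<odot>\<^bsub>S (Hom_set C w y)\<^esub> mor_map (rep w) \<alpha> (v (Dom C \<alpha>))) \<in>
      {\<alpha> \<in> Mor C. Cod C \<alpha> = y} \<rightarrow> carrier (S (Hom_set C w y))"
    if a: "a \<in> carrier A" and v: "v \<in> carrier ?M" for a v y
  proof
    fix \<alpha> assume "\<alpha> \<in> {\<alpha> \<in> Mor C. Cod C \<alpha> = y}"
    then show "a \<alpha> \<odot>\<^bsub>S (Hom_set C w y)\<^esub> mor_map (rep w) \<alpha> (v (Dom C \<alpha>)) \<in> carrier (S (Hom_set C w y))"
      using rep_mor_closed[of \<alpha> "v (Dom C \<alpha>)" w] comp[OF v Dom_closed[of \<alpha>]] a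
      by (intro left_module.smult_closed[OF S_module]) (auto simp: A_simps V_closed)
  qed
  have smult_M: "a \<odot>\<^bsub>?M\<^esub> v \<in> carrier ?M" if a: "a \<in> carrier A" and v: "v \<in> carrier ?M" for a v
  proof (rule M_I)
    fix y assume y: "y \<in> Obj C"
    interpret Sy: left_module k "S (Hom_set C w y)" by (rule S_module)
    show "(a \<odot>\<^bsub>?M\<^esub> v) y \<in> carrier (S (Hom_set C w y))"
      using y Sy.M.finsum_closed[OF summand[OF a v]] by (simp only: total_module_simps(4) rep_simps(1) restrict_apply' )
  qed (simp add: total_module_simps(4))
  have conv_j: "cv (e \<alpha>) (j v) m = (if Cod C m = Cod C \<alpha> then cv (e \<alpha>) (enc (v (Dom C \<alpha>))) m else \<zero>)"
    if \<alpha>: "\<alpha> \<in> Mor C" and m: "m \<in> ?X" and v: "v \<in> carrier ?M" for \<alpha> m v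
  proof (cases "Cod C m = Cod C \<alpha>")
    case True
    have vD: "\<And>n. v (Dom C \<alpha>) n \<in> carrier k" by (rule val[OF v Dom_closed[OF \<alpha>]])
    have "cv (e \<alpha>) (j v) m = cv (e \<alpha>) (enc (v (Dom C \<alpha>))) m"
    proof (rule conv_cong)
      fix \<alpha>' \<beta> assume "(\<alpha>', \<beta>) \<in> pairs m"
      then have "\<beta> \<in> ?X" "Dom C \<alpha>' = Cod C \<beta>" using m by (auto simp: pairs_def Dom_Comp)
      then show "e \<alpha> \<alpha>' \<otimes> j v \<beta> = e \<alpha> \<alpha>' \<otimes> enc (v (Dom C \<alpha>)) \<beta>"
        using vD val[OF v Cod_closed[of \<beta>]] by (auto simp: e_val j_def enc_def)
    qed (auto simp: enc_val_closed vD)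
    then show ?thesis using True by simp
  next
    case False
    then have "cv (e \<alpha>) (j v) m = \<zero>"
      using V_closed[OF j_V[OF v]] by (intro conv_zeroI) (auto simp: e_val pairs_def Cod_Comp)
    then show ?thesis using False by simp
  qed
  have j_smult: "j (a \<odot>\<^bsub>?M\<^esub> v) = cv a (j v)" if a: "a \<in> carrier A" and v: "v \<in> carrier ?M" for a v
  proof
    fix m
    note jv = V_closed[OF j_V[OF v]]
    have ak: "\<And>\<alpha>. a \<alpha> \<in> carrier k" using a by (simp add: A_simps V_closed)
    show "j (a \<odot>\<^bsub>?M\<^esub> v) m = cv a (j v) m"
    proof (cases "m \<in> ?X")
      case True
      let ?y = "Cod C m"
      let ?I = "{\<alpha> \<in> Mor C. Cod C \<alpha> = ?y}"
      have y: "?y \<in> Obj C" using True Cod_closed by auto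
      have "j (a \<odot>\<^bsub>?M\<^esub> v) m = (\<Oplus>\<alpha>\<in>?I. a \<alpha> \<otimes> mor_map (rep w) \<alpha> (v (Dom C \<alpha>)) (idx m))"
        using True y free_module_finsum_apply[OF ring_axioms summand[OF a v, of ?y], of "idx m"]
        by (simp add: j_def total_module_simps(4) rep_simps(1))
      also have "\<dots> = (\<Oplus>\<alpha>\<in>Mor C. a \<alpha> \<otimes> cv (e \<alpha>) (j v) m)"
      proof (rule add.finprod_mono_neutral_cong_left[OF finite_Mor])
        show "a \<alpha> \<otimes> cv (e \<alpha>) (j v) m = \<zero>" if "\<alpha> \<in> Mor C - ?I" for \<alpha>
          using conv_j[OF _ True v, of \<alpha>] that ak by auto
        show "a \<alpha> \<otimes> mor_map (rep w) \<alpha> (v (Dom C \<alpha>)) (idx m) = a \<alpha> \<otimes> cv (e \<alpha>) (j v) m" if "\<alpha> \<in> ?I" for \<alpha>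
          using conv_j[OF _ True v, of \<alpha>] that True by (simp add: rep_simps(2))
      qed (use ak jv conv_val_closed in auto)
      also have "\<dots> = cv a (j v) m"
        by (rule conv_expand[OF a jv, symmetric])
      finally show ?thesis .
    next
      case False
      have "cv a (j v) m = \<zero>"
      proof (rule conv_zeroI)
        fix \<alpha> \<beta> assume "(\<alpha>, \<beta>) \<in> pairs m"
        then have "\<beta> \<notin> ?X" using False by (auto simp: pairs_def Dom_Comp Comp_closed)
        then show "a \<alpha> \<otimes> j v \<beta> = \<zero>" using ak V_zero[OF j_V[OF v]] by simp
      qed
      then show ?thesis using False by (auto simp: j_def)
    qed
  qed
  have j_add: "j (v \<oplus>\<^bsub>?M\<^esub> u) = (\<lambda>m. j v m \<oplus> j u m)" for v u
    by (auto simp: j_def total_module_simps(3) rep_simps(1) Cod_closed fun_eq_iff)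
  have add_M: "v \<oplus>\<^bsub>?M\<^esub> u \<in> carrier ?M" if v: "v \<in> carrier ?M" and u: "u \<in> carrier ?M" for v u
  proof (rule M_I)
    fix x assume x: "x \<in> Obj C"
    interpret Sx: left_module k "S (Hom_set C w x)" by (rule S_module)
    show "(v \<oplus>\<^bsub>?M\<^esub> u) x \<in> carrier (S (Hom_set C w x))"
      using x Sx.M.a_closed[OF comp[OF v x] comp[OF u x]] by (simp add: total_module_simps(3) rep_simps(1))
  qed (simp add: total_module_simps(3))
  have inj: "inj_on j (carrier ?M)"
    by (rule inj_on_inverseI[of _ q]) (rule qj)
  have M: "left_module A ?M"
  proof (rule left_module_embed[OF R inj])
    show "\<zero>\<^bsub>?M\<^esub> \<in> carrier ?M"
    proof (rule M_I)
      fix x assume x: "x \<in> Obj C"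
      interpret Sx: left_module k "S (Hom_set C w x)" by (rule S_module)
      show "\<zero>\<^bsub>?M\<^esub> x \<in> carrier (S (Hom_set C w x))"
        using x Sx.M.zero_closed by (simp add: total_module_simps(2) rep_simps(1))
    qed (simp add: total_module_simps(2))
    show "j \<zero>\<^bsub>?M\<^esub> = \<zero>\<^bsub>regular_module A\<^esub>"
      by (auto simp: j_def total_module_simps(2) rep_simps(1) Cod_closed A_simps fun_eq_iff)
  qed (use j_A add_M smult_M j_add j_smult in \<open>simp_all add: A_simps(2,4)\<close>)
  have j: "j \<in> mod_hom A ?M (regular_module A)"
    by (rule mod_homI) (use j_A j_add j_smult in \<open>simp_all add: A_simps(2,4)\<close>)
  have q: "q \<in> mod_hom A (regular_module A) ?M"
  proof (rule mod_homI)
    interpret M: left_module A ?M by (rule M)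
    have eqI: "v = u" if "j v = j u" "v \<in> carrier ?M" "u \<in> carrier ?M" for v u
      using inj that by (auto dest: inj_onD)
    fix a b assume "a \<in> carrier (regular_module A)" "b \<in> carrier (regular_module A)"
    then have a: "a \<in> carrier A" and b: "b \<in> carrier A" by simp_all
    show "q (a \<oplus>\<^bsub>regular_module A\<^esub> b) = q a \<oplus>\<^bsub>?M\<^esub> q b"
    proof (rule eqI)
      show "j (q (a \<oplus>\<^bsub>regular_module A\<^esub> b)) = j (q a \<oplus>\<^bsub>?M\<^esub> q b)"
        using jq[OF a] jq[OF b] jq[of "a \<oplus>\<^bsub>A\<^esub> b"] a b
        by (auto simp: j_add A.a_closed) (auto simp: A_simps(4) restr_def fun_eq_iff)
    qed (use q_M[OF a] q_M[OF b] q_M[of "a \<oplus>\<^bsub>A\<^esub> b"] a b in simp_all)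
  next
    have eqI: "v = u" if "j v = j u" "v \<in> carrier ?M" "u \<in> carrier ?M" for v u
      using inj that by (auto dest: inj_onD)
    fix a b assume a: "a \<in> carrier A" and "b \<in> carrier (regular_module A)"
    then have b: "b \<in> carrier A" by simp
    note ab = a[unfolded A_simps(1), THEN V_closed] b[unfolded A_simps(1), THEN V_closed]
    show "q (a \<odot>\<^bsub>regular_module A\<^esub> b) = a \<odot>\<^bsub>?M\<^esub> q b"
    proof (rule eqI)
      have "restr ?X (cv a b) m = cv a (restr ?X b) m" for m
      proof (cases "m \<in> ?X")
        case True
        have "cv a b m = cv a (restr ?X b) m"
          by (rule conv_cong)
            (use True ab in \<open>auto simp: pairs_def restr_def Dom_Comp\<close>)
        then show ?thesis using True by (simp add: restr_def)
      next
        case False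
        have "cv a (restr ?X b) m = \<zero>"
          by (rule conv_zeroI)
            (use False ab in \<open>auto simp: pairs_def restr_def Dom_Comp Comp_closed\<close>)
        then show ?thesis using False by (auto simp: restr_def[of _ "cv a b"])
      qed
      then have "restr ?X (cv a b) = cv a (restr ?X b)" by blast
      then show "j (q (a \<odot>\<^bsub>regular_module A\<^esub> b)) = j (a \<odot>\<^bsub>?M\<^esub> q b)"
        using jq[OF b] jq[OF A.m_closed[OF a b]] by (simp add: j_smult[OF a q_M[OF b]] A_simps(2))
      show "q (a \<odot>\<^bsub>regular_module A\<^esub> b) \<in> carrier ?M"
        using q_M[OF A.m_closed[OF a b]] by simp
      show "a \<odot>\<^bsub>?M\<^esub> q b \<in> carrier ?M" by (rule smult_M[OF a q_M[OF b]])
    qed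
  qed (use q_M in simp)
  show ?thesis
    by (rule Gorenstein_projective_retract_regular[OF M j q]) (rule qj)
qed

end

section \<open>The tensor square of a representable functor\<close>

context EI_category_over_field
begin

abbreviation Sq :: "'o \<Rightarrow> ('o, 'm, 'k, (((nat \<Rightarrow> 'k) \<times> (nat \<Rightarrow> 'k)) \<Rightarrow> 'k) set) vect_functor"
  where "Sq w \<equiv> tensor_functor k C (rep w) (rep w)"

abbreviation T2 :: "'o \<Rightarrow> 'o \<Rightarrow> ('k, (((nat \<Rightarrow> 'k) \<times> (nat \<Rightarrow> 'k)) \<Rightarrow> 'k) set) module"
  where "T2 w x \<equiv> tensor_space k (S (Hom_set C w x)) (S (Hom_set C w x))"

abbreviation pure :: "'o \<Rightarrow> 'o \<Rightarrow> (nat \<Rightarrow> 'k) \<Rightarrow> (nat \<Rightarrow> 'k) \<Rightarrow> (((nat \<Rightarrow> 'k) \<times> (nat \<Rightarrow> 'k)) \<Rightarrow> 'k) set"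
  where "pure w x \<equiv> pure_tensor k (S (Hom_set C w x)) (S (Hom_set C w x))"

lemma Sq_obj: "obj_map (Sq w) x = T2 w x"
  by (simp add: tensor_functor_def rep_simps)

lemma tensor_product_S: "tensor_product k (S X) (S X)"
  by (intro tensor_product.intro S_module) unfold_locales

lemma T2_module: "left_module k (T2 w x)"
  by (rule tensor_product.T_module[OF tensor_product_S])

lemma pure_closed: "u \<in> carrier (S (Hom_set C w x)) \<Longrightarrow> v \<in> carrier (S (Hom_set C w x)) \<Longrightarrow>
    pure w x u v \<in> carrier (T2 w x)"
  by (rule tensor_product.pure_closed[OF tensor_product_S])

lemma Sq_mor:
  assumes "\<alpha> \<in> Mor C"
  shows "mor_map (Sq w) \<alpha> \<in> mod_hom k (T2 w (Dom C \<alpha>)) (T2 w (Cod C \<alpha>))"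
    and "\<lbrakk>u \<in> carrier (S (Hom_set C w (Dom C \<alpha>))); v \<in> carrier (S (Hom_set C w (Dom C \<alpha>)))\<rbrakk> \<Longrightarrow>
      mor_map (Sq w) \<alpha> (pure w (Dom C \<alpha>) u v) =
      pure w (Cod C \<alpha>) (mor_map (rep w) \<alpha> u) (mor_map (rep w) \<alpha> v)"
proof -
  have "cring k" by unfold_locales
  note facts = tensor_map_facts[OF this S_module S_module S_module S_module
      rep_mor_hom[OF assms, of w] rep_mor_hom[OF assms, of w]]
  show "mor_map (Sq w) \<alpha> \<in> mod_hom k (T2 w (Dom C \<alpha>)) (T2 w (Cod C \<alpha>))"
    using facts(1) by (simp add: tensor_functor_def rep_simps(1))
  show "mor_map (Sq w) \<alpha> (pure w (Dom C \<alpha>) u v) =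
      pure w (Cod C \<alpha>) (mor_map (rep w) \<alpha> u) (mor_map (rep w) \<alpha> v)"
    if "u \<in> carrier (S (Hom_set C w (Dom C \<alpha>)))" "v \<in> carrier (S (Hom_set C w (Dom C \<alpha>)))"
    using facts(2)[OF that] by (simp add: tensor_functor_def rep_simps(1))
qed

text \<open>The bilinear form for which the morphisms are orthonormal, and the induced functional.\<close>

definition form :: "(nat \<Rightarrow> 'k) \<Rightarrow> (nat \<Rightarrow> 'k) \<Rightarrow> 'k"
  where "form u v = (\<Oplus>\<beta>\<in>Mor C. enc u \<beta> \<otimes> enc v \<beta>)"

definition \<tau> :: "(((nat \<Rightarrow> 'k) \<times> (nat \<Rightarrow> 'k)) \<Rightarrow> 'k) set \<Rightarrow> 'k"
  where "\<tau> = tensor_lift k (regular_module k) form"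

lemma enc_linear:
  "(\<And>n. u n \<in> carrier k) \<Longrightarrow> (\<And>n. v n \<in> carrier k) \<Longrightarrow> enc (\<lambda>n. u n \<oplus> v n) m = enc u m \<oplus> enc v m"
  "c \<in> carrier k \<Longrightarrow> enc (\<lambda>n. c \<otimes> v n) m = c \<otimes> enc v m"
  by (auto simp: enc_def)

lemma form_closed:
  "(\<And>n. u n \<in> carrier k) \<Longrightarrow> (\<And>n. v n \<in> carrier k) \<Longrightarrow> form u v \<in> carrier k"
  unfolding form_def by (intro finsum_closed) (auto simp: enc_val_closed)

lemma form_commute:
  assumes "\<And>n. u n \<in> carrier k" "\<And>n. v n \<in> carrier k"
  shows "form u v = form v u"
  unfolding form_def
  by (rule finsum_cong') (use assms in \<open>auto simp: enc_val_closed m_comm\<close>)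

lemma form_add:
  assumes "\<And>n. u n \<in> carrier k" "\<And>n. u' n \<in> carrier k" "\<And>n. v n \<in> carrier k"
  shows "form (\<lambda>n. u n \<oplus> u' n) v = form u v \<oplus> form u' v"
proof -
  have "form (\<lambda>n. u n \<oplus> u' n) v = (\<Oplus>\<beta>\<in>Mor C. enc u \<beta> \<otimes> enc v \<beta> \<oplus> enc u' \<beta> \<otimes> enc v \<beta>)"
    unfolding form_def
    by (rule finsum_cong') (use assms in \<open>auto simp: enc_linear enc_val_closed l_distr\<close>)
  then show ?thesis
    unfolding form_def using assms by (simp add: finsum_addf Pi_iff enc_val_closed)
qed

lemma form_smult:
  assumes "c \<in> carrier k" "\<And>n. u n \<in> carrier k" "\<And>n. v n \<in> carrier k"
  shows "form (\<lambda>n. c \<otimes> u n) v = c \<otimes> form u v"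
proof -
  have "form (\<lambda>n. c \<otimes> u n) v = (\<Oplus>\<beta>\<in>Mor C. c \<otimes> (enc u \<beta> \<otimes> enc v \<beta>))"
    unfolding form_def
    by (rule finsum_cong') (use assms in \<open>auto simp: enc_linear enc_val_closed m_assoc\<close>)
  then show ?thesis
    unfolding form_def using assms finite_Mor by (simp add: finsum_rdistr Pi_iff enc_val_closed)
qed

lemma form_bilinear: "bilinear_map k (S X) (S X) (regular_module k) form"
proof -
  have 1: "(\<lambda>u. form u v) \<in> mod_hom k (S X) (regular_module k)" if "v \<in> carrier (S X)" for v
    by (rule mod_homI)
      (use S_closed[OF that] in \<open>simp_all add: form_closed form_add form_smult S_closed\<close>)
  have 2: "form v \<in> mod_hom k (S X) (regular_module k)" if "v \<in> carrier (S X)" for v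
  proof (rule mod_hom_cong[OF S_module 1[OF that]])
    fix u assume "u \<in> carrier (S X)"
    from form_commute[OF S_closed[OF that] S_closed[OF this]] show "form v u = form u v" .
  qed
  show ?thesis
    unfolding bilinear_map_def using 1 2 by blast
qed

lemma k_module: "left_module k (regular_module k)"
  by (rule left_module_regular[OF ring_axioms])

lemma \<tau>_hom: "\<tau> \<in> mod_hom k (T2 w x) (regular_module k)"
  unfolding \<tau>_def by (rule tensor_product.tensor_lift_hom[OF tensor_product_S k_module form_bilinear])

lemma \<tau>_closed: "t \<in> carrier (T2 w x) \<Longrightarrow> \<tau> t \<in> carrier k"
  using mod_hom_closed[OF \<tau>_hom] by fastforce

lemma \<tau>_pure:
  "u \<in> carrier (S (Hom_set C w x)) \<Longrightarrow> v \<in> carrier (S (Hom_set C w x)) \<Longrightarrow> \<tau> (pure w x u v) = form u v"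
  unfolding \<tau>_def by (rule tensor_product.tensor_lift_pure[OF tensor_product_S k_module form_bilinear])

lemma conv_e_mono:
  assumes \<alpha>: "monomorphism C \<alpha>" and \<beta>: "\<beta> \<in> Hom_set C w (Dom C \<alpha>)" and f: "\<And>m. f m \<in> carrier k"
  shows "cv (e \<alpha>) f (\<alpha> \<bullet>\<^bsub>C\<^esub> \<beta>) = f \<beta>"
proof -
  have \<alpha>M: "\<alpha> \<in> Mor C" using \<alpha> by (simp add: monomorphism_def)
  have mem: "(\<alpha>, \<beta>) \<in> pairs (\<alpha> \<bullet>\<^bsub>C\<^esub> \<beta>)"
    using \<alpha>M \<beta> by (auto simp: pairs_def Hom_set_def)
  have inj: "\<beta>' = \<beta>" if "(\<alpha>, \<beta>') \<in> pairs (\<alpha> \<bullet>\<^bsub>C\<^esub> \<beta>)" for \<beta>'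
  proof -
    have "Dom C \<beta>' = Dom C (\<alpha> \<bullet>\<^bsub>C\<^esub> \<beta>')" "Dom C (\<alpha> \<bullet>\<^bsub>C\<^esub> \<beta>) = w"
      using that \<alpha>M \<beta> Dom_Comp[of \<alpha> \<beta>'] Dom_Comp[of \<alpha> \<beta>] by (auto simp: pairs_def Hom_set_def)
    then have "\<beta>' \<in> Hom_set C w (Dom C \<alpha>)"
      using that by (auto simp: pairs_def Hom_set_def)
    moreover have "w \<in> Obj C" using \<beta> Dom_closed by (auto simp: Hom_set_def)
    ultimately show ?thesis
      using \<alpha> \<beta> that unfolding monomorphism_def pairs_def by auto
  qed
  have "cv (e \<alpha>) f (\<alpha> \<bullet>\<^bsub>C\<^esub> \<beta>) = (\<Oplus>p\<in>pairs (\<alpha> \<bullet>\<^bsub>C\<^esub> \<beta>). if (\<alpha>, \<beta>) = p then f \<beta> else \<zero>)"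
    unfolding conv_eq by (rule finsum_cong') (use f in \<open>auto simp: e_val dest: inj\<close>)
  then show ?thesis
    using finsum_singleton[OF mem finite_pairs, of "\<lambda>_. f \<beta>"] f by simp
qed

text \<open>Composition with a monomorphism \<open>\<alpha>\<close> maps the orthonormal basis at \<open>Dom \<alpha>\<close> injectively into that at \<open>Cod \<alpha>\<close>.\<close>

lemma form_mono:
  assumes \<alpha>: "monomorphism C \<alpha>"
    and u: "u \<in> carrier (S (Hom_set C w (Dom C \<alpha>)))" and v: "v \<in> carrier (S (Hom_set C w (Dom C \<alpha>)))"
  shows "form (mor_map (rep w) \<alpha> u) (mor_map (rep w) \<alpha> v) = form u v"
proof -
  let ?H = "Hom_set C w (Dom C \<alpha>)"
  let ?F = "\<lambda>\<gamma>. cv (e \<alpha>) (enc u) \<gamma> \<otimes> cv (e \<alpha>) (enc v) \<gamma>"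
  let ?G = "\<lambda>\<beta>. enc u \<beta> \<otimes> enc v \<beta>"
  have \<alpha>M: "\<alpha> \<in> Mor C" using \<alpha> by (simp add: monomorphism_def)
  have eu: "enc u \<in> carrier (V ?H)" "\<And>m. enc u m \<in> carrier k"
    using enc_closed[OF Hom_sub u] by (auto simp: V_closed)
  have ev: "enc v \<in> carrier (V ?H)" "\<And>m. enc v m \<in> carrier k"
    using enc_closed[OF Hom_sub v] by (auto simp: V_closed)
  have inj: "inj_on (\<lambda>\<beta>. \<alpha> \<bullet>\<^bsub>C\<^esub> \<beta>) ?H"
  proof (rule inj_onI)
    fix \<beta> \<gamma> assume "\<beta> \<in> ?H" "\<gamma> \<in> ?H" "\<alpha> \<bullet>\<^bsub>C\<^esub> \<beta> = \<alpha> \<bullet>\<^bsub>C\<^esub> \<gamma>"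
    moreover have "w \<in> Obj C" using \<open>\<beta> \<in> ?H\<close> Dom_closed by (auto simp: Hom_set_def)
    ultimately show "\<beta> = \<gamma>" using \<alpha> unfolding monomorphism_def by blast
  qed
  have Fc: "?F \<gamma> \<in> carrier k" for \<gamma>
    using eu ev by (simp add: conv_val_closed)
  have zero: "?F \<gamma> = \<zero>" if "\<gamma> \<notin> (\<lambda>\<beta>. \<alpha> \<bullet>\<^bsub>C\<^esub> \<beta>) ` ?H" for \<gamma>
  proof -
    have "cv (e \<alpha>) (enc u) \<gamma> = \<zero>"
    proof (rule conv_zeroI)
      fix \<alpha>' \<beta> assume "(\<alpha>', \<beta>) \<in> pairs \<gamma>"
      then have "\<alpha>' \<noteq> \<alpha> \<or> \<beta> \<notin> ?H" using that by (auto simp: pairs_def)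
      then show "e \<alpha> \<alpha>' \<otimes> enc u \<beta> = \<zero>" using eu V_zero[OF eu(1), of \<beta>] by (auto simp: e_val)
    qed
    then show ?thesis using ev by (simp add: conv_val_closed)
  qed
  have "form (mor_map (rep w) \<alpha> u) (mor_map (rep w) \<alpha> v) = (\<Oplus>\<gamma>\<in>Mor C. ?F \<gamma>)"
    unfolding form_def enc_rep_mor[OF \<alpha>M u] enc_rep_mor[OF \<alpha>M v] ..
  also have "\<dots> = (\<Oplus>\<gamma>\<in>(\<lambda>\<beta>. \<alpha> \<bullet>\<^bsub>C\<^esub> \<beta>) ` ?H. ?F \<gamma>)"
    by (rule add.finprod_mono_neutral_cong_left[symmetric, OF finite_Mor])
      (use zero Fc \<alpha>M in \<open>auto simp: Hom_set_def Comp_closed\<close>)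
  also have "\<dots> = (\<Oplus>\<beta>\<in>?H. ?F (\<alpha> \<bullet>\<^bsub>C\<^esub> \<beta>))"
    by (rule finsum_reindex[OF _ inj]) (use Fc in auto)
  also have "\<dots> = (\<Oplus>\<beta>\<in>?H. ?G \<beta>)"
    by (rule finsum_cong') (use conv_e_mono[OF \<alpha>] eu ev in auto)
  also have "\<dots> = (\<Oplus>\<beta>\<in>Mor C. ?G \<beta>)"
    by (rule add.finprod_mono_neutral_cong_left[OF finite_Mor Hom_sub])
      (use eu ev V_zero[OF eu(1)] in auto)
  finally show ?thesis unfolding form_def .
qed

lemma \<tau>_mono:
  assumes \<alpha>: "monomorphism C \<alpha>" and t: "t \<in> carrier (T2 w (Dom C \<alpha>))"
  shows "\<tau> (mor_map (Sq w) \<alpha> t) = \<tau> t"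
proof (rule tensor_product.tensor_hom_eqI[OF tensor_product_S k_module _ \<tau>_hom _ t])
  have \<alpha>M: "\<alpha> \<in> Mor C" using \<alpha> by (simp add: monomorphism_def)
  show "(\<lambda>t. \<tau> (mor_map (Sq w) \<alpha> t)) \<in> mod_hom k (T2 w (Dom C \<alpha>)) (regular_module k)"
    by (rule mod_hom_compose[OF Sq_mor(1)[OF \<alpha>M] \<tau>_hom])
  show "\<tau> (mor_map (Sq w) \<alpha> (pure w (Dom C \<alpha>) u v)) = \<tau> (pure w (Dom C \<alpha>) u v)"
    if "u \<in> carrier (S (Hom_set C w (Dom C \<alpha>)))" "v \<in> carrier (S (Hom_set C w (Dom C \<alpha>)))" for u v
    using that by (simp add: Sq_mor(2)[OF \<alpha>M] \<tau>_pure rep_mor_closed[OF \<alpha>M] form_mono[OF \<alpha>])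
qed

end

section \<open>A derivation that detects non-monomorphisms\<close>

text \<open>
  An object \<open>x \<noteq> y\<close> lies strictly below \<open>y\<close> if there is a morphism \<open>x \<rightarrow> y\<close>; all morphisms into such
  objects are assumed to be monomorphisms.  By invariance under monomorphisms, \<open>\<tau>\<close> is then a
  natural map from the tensor square to the functor that is constantly \<open>k\<close> strictly below \<open>y\<close> and
  zero elsewhere.  The functor that is constantly \<open>k\<close> at and below \<open>y\<close> is an extension of it by the
  trivial module \<open>k\<close> at \<open>y\<close>.  Pulled back along \<open>\<tau>\<close> and pushed out along the embedding of \<open>k\<close> into
  \<open>k Aut(y)\<close> by multiples of the norm element, this is an extension of the tensor square by
  \<open>k Aut(y)\<close>, and \<open>h\<close> is the derivation that describes it.
\<close>

locale mono_below = skeletal_EI_category_over_field k C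
  for k :: "('k, 'z) ring_scheme" (structure) and C :: "('o, 'm, 'y) cat_scheme" +
  fixes w y :: 'o
  assumes y: "y \<in> Obj C"
    and mono: "\<lbrakk>\<alpha> \<in> Mor C; Cod C \<alpha> \<noteq> y; Hom_set C (Cod C \<alpha>) y \<noteq> {}\<rbrakk> \<Longrightarrow> monomorphism C \<alpha>"
    and Sq_module: "left_module (category_algebra k C)
      (total_module C (tensor_functor k C (EI_category_over_field.rep k C w) (EI_category_over_field.rep k C w)))"
begin

abbreviation M :: "('m \<Rightarrow> 'k, 'o \<Rightarrow> (((nat \<Rightarrow> 'k) \<times> (nat \<Rightarrow> 'k)) \<Rightarrow> 'k) set) module"
  where "M \<equiv> total_module C (Sq w)"

sublocale M: left_module A M
  by (rule Sq_module)

abbreviation sc :: "'k \<Rightarrow> 'm \<Rightarrow> 'm \<Rightarrow> 'k"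
  where "sc c \<alpha> \<equiv> \<lambda>m. c \<otimes> e \<alpha> m"

text \<open>
  The value of the constant-functor extension on a morphism \<open>\<gamma>\<close> into \<open>y\<close>: it transports \<open>\<tau>\<close> from
  \<open>Dom \<gamma>\<close> to \<open>y\<close>, and automorphisms of \<open>y\<close> contribute nothing.
\<close>

definition \<phi> :: "('o \<Rightarrow> (((nat \<Rightarrow> 'k) \<times> (nat \<Rightarrow> 'k)) \<Rightarrow> 'k) set) \<Rightarrow> 'm \<Rightarrow> 'k"
  where "\<phi> v \<gamma> = (if Dom C \<gamma> \<noteq> y \<and> Hom_set C (Dom C \<gamma>) y \<noteq> {} then \<tau> (v (Dom C \<gamma>)) else \<zero>)"

definition \<sigma> :: "('m \<Rightarrow> 'k) \<Rightarrow> ('o \<Rightarrow> (((nat \<Rightarrow> 'k) \<times> (nat \<Rightarrow> 'k)) \<Rightarrow> 'k) set) \<Rightarrow> 'k"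
  where "\<sigma> a v = (\<Oplus>\<gamma>\<in>{\<gamma> \<in> Mor C. Cod C \<gamma> = y}. a \<gamma> \<otimes> \<phi> v \<gamma>)"

text \<open>The multiples of the norm element \<open>\<Sum>g\<in>Aut(y). g\<close> of \<open>k Aut(y)\<close>.\<close>

definition const :: "'k \<Rightarrow> 'm \<Rightarrow> 'k"
  where "const s = (\<lambda>g. if g \<in> Aut C y then s else \<zero>)"

lemma component: "v \<in> carrier M \<Longrightarrow> x \<in> Obj C \<Longrightarrow> v x \<in> carrier (T2 w x)"
  by (auto simp: total_module_simps Sq_obj)

lemma M_memI:
  "v \<in> extensional (Obj C) \<Longrightarrow> (\<And>x. x \<in> Obj C \<Longrightarrow> v x \<in> carrier (T2 w x)) \<Longrightarrow> v \<in> carrier M"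
  by (simp add: total_module_simps(1) Sq_obj PiE_def Pi_iff)

lemma M_add: "x \<in> Obj C \<Longrightarrow> (u \<oplus>\<^bsub>M\<^esub> v) x = u x \<oplus>\<^bsub>T2 w x\<^esub> v x"
  by (simp add: total_module_simps(3) Sq_obj)

lemma \<phi>_closed:
  assumes "v \<in> carrier M" "\<gamma> \<in> Mor C" shows "\<phi> v \<gamma> \<in> carrier k"
  using \<tau>_closed[OF component[OF assms(1) Dom_closed[OF assms(2)]]] by (simp add: \<phi>_def)

lemma \<sigma>_closed: "(\<And>m. a m \<in> carrier k) \<Longrightarrow> v \<in> carrier M \<Longrightarrow> \<sigma> a v \<in> carrier k"
  unfolding \<sigma>_def by (intro finsum_closed) (auto simp: \<phi>_closed)

lemma \<sigma>_add_left:
  assumes "\<And>m. a m \<in> carrier k" "\<And>m. b m \<in> carrier k" "v \<in> carrier M"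
  shows "\<sigma> (\<lambda>m. a m \<oplus> b m) v = \<sigma> a v \<oplus> \<sigma> b v"
proof -
  have "\<sigma> (\<lambda>m. a m \<oplus> b m) v = (\<Oplus>\<gamma>\<in>{\<gamma> \<in> Mor C. Cod C \<gamma> = y}. a \<gamma> \<otimes> \<phi> v \<gamma> \<oplus> b \<gamma> \<otimes> \<phi> v \<gamma>)"
    unfolding \<sigma>_def by (rule finsum_cong') (use assms \<phi>_closed in \<open>auto simp: l_distr\<close>)
  then show ?thesis
    unfolding \<sigma>_def using assms by (simp add: finsum_addf Pi_iff \<phi>_closed)
qed

lemma \<sigma>_add_right:
  assumes "\<And>m. a m \<in> carrier k" "u \<in> carrier M" "v \<in> carrier M"
  shows "\<sigma> a (u \<oplus>\<^bsub>M\<^esub> v) = \<sigma> a u \<oplus> \<sigma> a v"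
proof -
  have "\<phi> (u \<oplus>\<^bsub>M\<^esub> v) \<gamma> = \<phi> u \<gamma> \<oplus> \<phi> v \<gamma>" if "\<gamma> \<in> Mor C" for \<gamma>
    using mod_hom_add[OF \<tau>_hom component[OF assms(2) Dom_closed[OF that]] component[OF assms(3) Dom_closed[OF that]]]
    by (simp add: \<phi>_def M_add Dom_closed that)
  then have "\<sigma> a (u \<oplus>\<^bsub>M\<^esub> v) = (\<Oplus>\<gamma>\<in>{\<gamma> \<in> Mor C. Cod C \<gamma> = y}. a \<gamma> \<otimes> \<phi> u \<gamma> \<oplus> a \<gamma> \<otimes> \<phi> v \<gamma>)"
    unfolding \<sigma>_def by (intro finsum_cong') (use assms \<phi>_closed in \<open>auto simp: r_distr\<close>)
  then show ?thesis
    unfolding \<sigma>_def using assms by (simp add: finsum_addf Pi_iff \<phi>_closed)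
qed

lemma \<sigma>_zero: "v \<in> carrier M \<Longrightarrow> \<sigma> (\<lambda>_. \<zero>) v = \<zero>"
proof -
  assume v: "v \<in> carrier M"
  have "\<sigma> (\<lambda>_. \<zero>) v = (\<Oplus>\<gamma>\<in>{\<gamma> \<in> Mor C. Cod C \<gamma> = y}. \<zero>)"
    unfolding \<sigma>_def by (rule finsum_cong') (use v \<phi>_closed in auto)
  then show ?thesis by simp
qed

lemma \<sigma>_sc:
  assumes "c \<in> carrier k" "\<gamma> \<in> Mor C" "v \<in> carrier M"
  shows "\<sigma> (sc c \<gamma>) v = (if Cod C \<gamma> = y then c \<otimes> \<phi> v \<gamma> else \<zero>)"
proof -
  let ?I = "{\<gamma> \<in> Mor C. Cod C \<gamma> = y}"
  have fin: "finite ?I" using finite_Mor by simp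
  have "\<sigma> (sc c \<gamma>) v = (\<Oplus>\<gamma>'\<in>?I. if \<gamma> = \<gamma>' then c \<otimes> \<phi> v \<gamma>' else \<zero>)"
    unfolding \<sigma>_def by (rule finsum_cong') (use assms \<phi>_closed in \<open>auto simp: e_val\<close>)
  also have "\<dots> = (if Cod C \<gamma> = y then c \<otimes> \<phi> v \<gamma> else \<zero>)"
  proof (cases "Cod C \<gamma> = y")
    case True
    then show ?thesis
      using finsum_singleton[of \<gamma> ?I "\<lambda>\<gamma>'. c \<otimes> \<phi> v \<gamma>'", OF _ fin] assms \<phi>_closed by (simp add: Pi_iff)
  next
    case False
    have "(\<Oplus>\<gamma>'\<in>?I. if \<gamma> = \<gamma>' then c \<otimes> \<phi> v \<gamma>' else \<zero>) = (\<Oplus>\<gamma>'\<in>?I. \<zero>)"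
      by (rule finsum_cong') (use False in auto)
    then show ?thesis using False by simp
  qed
  finally show ?thesis .
qed

lemma sc_closed: "c \<in> carrier k \<Longrightarrow> \<alpha> \<in> Mor C \<Longrightarrow> sc c \<alpha> \<in> carrier A"
  by (auto simp: A_simps V_carrier e_val)

lemma M_sc:
  assumes c: "c \<in> carrier k" and \<beta>: "\<beta> \<in> Mor C" and v: "v \<in> carrier M" and x: "x \<in> Obj C"
  shows "(sc c \<beta> \<odot>\<^bsub>M\<^esub> v) x =
    (if x = Cod C \<beta> then c \<odot>\<^bsub>T2 w x\<^esub> mor_map (Sq w) \<beta> (v (Dom C \<beta>)) else \<zero>\<^bsub>T2 w x\<^esub>)"
proof -
  let ?I = "{\<gamma> \<in> Mor C. Cod C \<gamma> = x}"
  let ?f = "\<lambda>\<gamma>. mor_map (Sq w) \<gamma> (v (Dom C \<gamma>))"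
  interpret T: left_module k "T2 w x" by (rule T2_module)
  have f: "?f \<gamma> \<in> carrier (T2 w x)" if "\<gamma> \<in> ?I" for \<gamma>
    using mod_hom_closed[OF Sq_mor(1) component[OF v Dom_closed]] that by auto
  have fin: "finite ?I" using finite_Mor by simp
  have cf: "c \<odot>\<^bsub>T2 w x\<^esub> ?f \<gamma> \<in> carrier (T2 w x)" if "\<gamma> \<in> ?I" for \<gamma>
    by (rule T.smult_closed[OF c f[OF that]])
  have "(sc c \<beta> \<odot>\<^bsub>M\<^esub> v) x = (\<Oplus>\<^bsub>T2 w x\<^esub>\<gamma>\<in>?I. sc c \<beta> \<gamma> \<odot>\<^bsub>T2 w x\<^esub> ?f \<gamma>)"
    using x by (simp add: total_module_simps(4) Sq_obj)
  also have "\<dots> = (\<Oplus>\<^bsub>T2 w x\<^esub>\<gamma>\<in>?I. if \<beta> = \<gamma> then c \<odot>\<^bsub>T2 w x\<^esub> ?f \<gamma> else \<zero>\<^bsub>T2 w x\<^esub>)"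
  proof (rule T.M.finsum_cong')
    show "(\<lambda>\<gamma>. if \<beta> = \<gamma> then c \<odot>\<^bsub>T2 w x\<^esub> ?f \<gamma> else \<zero>\<^bsub>T2 w x\<^esub>) \<in> ?I \<rightarrow> carrier (T2 w x)"
      using cf by auto
    show "sc c \<beta> \<gamma> \<odot>\<^bsub>T2 w x\<^esub> ?f \<gamma> = (if \<beta> = \<gamma> then c \<odot>\<^bsub>T2 w x\<^esub> ?f \<gamma> else \<zero>\<^bsub>T2 w x\<^esub>)" if "\<gamma> \<in> ?I" for \<gamma>
      using f[OF that] c by (auto simp: e_val)
  qed simp
  also have "\<dots> = (if x = Cod C \<beta> then c \<odot>\<^bsub>T2 w x\<^esub> ?f \<beta> else \<zero>\<^bsub>T2 w x\<^esub>)"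
  proof (cases "x = Cod C \<beta>")
    case True
    then show ?thesis
      using T.M.finsum_singleton[of \<beta> ?I "\<lambda>\<gamma>. c \<odot>\<^bsub>T2 w x\<^esub> ?f \<gamma>", OF _ fin] \<beta> cf by (auto simp: Pi_iff)
  next
    case False
    have "(\<Oplus>\<^bsub>T2 w x\<^esub>\<gamma>\<in>?I. if \<beta> = \<gamma> then c \<odot>\<^bsub>T2 w x\<^esub> ?f \<gamma> else \<zero>\<^bsub>T2 w x\<^esub>) = (\<Oplus>\<^bsub>T2 w x\<^esub>\<gamma>\<in>?I. \<zero>\<^bsub>T2 w x\<^esub>)"
      by (rule T.M.finsum_cong') (use False in auto)
    then show ?thesis using False by simp
  qed
  finally show ?thesis .
qed

text \<open>
  If \<open>\<beta>\<close> ends strictly below \<open>y\<close> then it is a monomorphism and starts strictly below \<open>y\<close>, so \<open>\<tau>\<close>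
  takes the same value before and after applying \<open>\<beta>\<close>.
\<close>

lemma \<phi>_sc:
  assumes c: "c \<in> carrier k" and \<beta>: "\<beta> \<in> Mor C" and v: "v \<in> carrier M"
    and \<gamma>: "\<gamma> \<in> Mor C" "Cod C \<gamma> = y" "Dom C \<gamma> \<noteq> y"
  shows "\<phi> (sc c \<beta> \<odot>\<^bsub>M\<^esub> v) \<gamma> = (if Dom C \<gamma> = Cod C \<beta> then c \<otimes> \<phi> v (\<gamma> \<bullet>\<^bsub>C\<^esub> \<beta>) else \<zero>)"
proof -
  have ne: "Hom_set C (Dom C \<gamma>) y \<noteq> {}" using \<gamma> by (auto simp: Hom_set_def)
  note x = Dom_closed[OF \<gamma>(1)]
  have L: "\<phi> (sc c \<beta> \<odot>\<^bsub>M\<^esub> v) \<gamma> = \<tau> ((sc c \<beta> \<odot>\<^bsub>M\<^esub> v) (Dom C \<gamma>))"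
    using ne \<gamma>(3) by (simp add: \<phi>_def)
  show ?thesis
  proof (cases "Dom C \<gamma> = Cod C \<beta>")
    case True
    have vD: "v (Dom C \<beta>) \<in> carrier (T2 w (Dom C \<beta>))" by (rule component[OF v Dom_closed[OF \<beta>]])
    have "Dom C \<beta> \<noteq> y"
      using antisymmetric[OF \<beta> \<gamma>(1) True] \<gamma>(2,3) True by auto
    moreover have "\<gamma> \<bullet>\<^bsub>C\<^esub> \<beta> \<in> Hom_set C (Dom C \<beta>) y"
      using \<beta> \<gamma> True by (simp add: Hom_set_def Comp_closed Dom_Comp Cod_Comp)
    ultimately have "\<phi> v (\<gamma> \<bullet>\<^bsub>C\<^esub> \<beta>) = \<tau> (v (Dom C \<beta>))"
      using \<beta> \<gamma>(1) True by (auto simp: \<phi>_def Dom_Comp)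
    moreover have "\<tau> (c \<odot>\<^bsub>T2 w (Cod C \<beta>)\<^esub> mor_map (Sq w) \<beta> (v (Dom C \<beta>))) = c \<otimes> \<tau> (mor_map (Sq w) \<beta> (v (Dom C \<beta>)))"
      using mod_hom_smult[OF \<tau>_hom c mod_hom_closed[OF Sq_mor(1)[OF \<beta>] vD]] by simp
    moreover have "monomorphism C \<beta>"
      using mono[OF \<beta>] ne \<gamma>(3) True by simp
    then have "\<tau> (mor_map (Sq w) \<beta> (v (Dom C \<beta>))) = \<tau> (v (Dom C \<beta>))"
      by (rule \<tau>_mono[OF _ vD])
    ultimately show ?thesis
      unfolding L M_sc[OF c \<beta> v x] using True by simp
  next
    case False
    then show ?thesis
      unfolding L M_sc[OF c \<beta> v x] using mod_hom_zero[OF T2_module k_module \<tau>_hom] by simp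
  qed
qed

lemma Aut_y: "\<alpha> \<in> Aut C y \<longleftrightarrow> \<alpha> \<in> Mor C \<and> Dom C \<alpha> = y \<and> Cod C \<alpha> = y"
  using endo_iso[OF y] by (auto simp: Aut_def Hom_set_def)

text \<open>Left translation by an automorphism of \<open>y\<close> permutes \<open>Aut(y)\<close>, so norm elements are invariant.\<close>

lemma Aut_left_div:
  assumes "\<alpha> \<in> Aut C y" "g \<in> Aut C y"
  shows "\<exists>\<beta>\<in>Aut C y. (\<alpha>, \<beta>) \<in> pairs g \<and> (\<forall>\<beta>'. (\<alpha>, \<beta>') \<in> pairs g \<longrightarrow> \<beta>' = \<beta>)"
proof -
  note \<alpha> = assms(1)[unfolded Aut_y] and g = assms(2)[unfolded Aut_y]
  obtain i where i: "i \<in> Mor C" "Dom C i = y" "Cod C i = y" "i \<bullet>\<^bsub>C\<^esub> \<alpha> = Id C y" "\<alpha> \<bullet>\<^bsub>C\<^esub> i = Id C y"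
    using assms(1) \<alpha> unfolding Aut_def isomorphism_def by (auto simp: Hom_set_def)
  have "\<alpha> \<bullet>\<^bsub>C\<^esub> (i \<bullet>\<^bsub>C\<^esub> g) = g"
    using Comp_assoc[of \<alpha> i g] \<alpha> g i Id_Comp[of g] by simp
  then have "(\<alpha>, i \<bullet>\<^bsub>C\<^esub> g) \<in> pairs g"
    using \<alpha> g i by (simp add: pairs_def Comp_closed Cod_Comp)
  moreover have "\<beta> = i \<bullet>\<^bsub>C\<^esub> g" if "(\<alpha>, \<beta>) \<in> pairs g" for \<beta>
    using that Comp_assoc[of i \<alpha> \<beta>] \<alpha> i Id_Comp[of \<beta>] by (auto simp: pairs_def)
  moreover have "i \<bullet>\<^bsub>C\<^esub> g \<in> Aut C y"
    using i g by (simp add: Aut_y Comp_closed Dom_Comp Cod_Comp)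
  ultimately show ?thesis by (intro bexI[of _ "i \<bullet>\<^bsub>C\<^esub> g"] conjI allI impI)
qed

lemma sc_const:
  assumes c: "c \<in> carrier k" and \<alpha>: "\<alpha> \<in> Mor C" and s: "s \<in> carrier k"
  shows "sc c \<alpha> \<odot>\<^bsub>span (Aut C y)\<^esub> const s = (if \<alpha> \<in> Aut C y then const (c \<otimes> s) else const \<zero>)"
proof
  fix g
  have cs: "const s m \<in> carrier k" for m using s by (simp add: const_def)
  have val: "cv (sc c \<alpha>) (const s) g = (if \<alpha> \<in> Aut C y then c \<otimes> s else \<zero>)" if g: "g \<in> Aut C y"
  proof (cases "\<alpha> \<in> Aut C y")
    case True
    obtain \<beta> where \<beta>: "\<beta> \<in> Aut C y" and mem: "(\<alpha>, \<beta>) \<in> pairs g"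
      and uniq: "\<forall>\<beta>'. (\<alpha>, \<beta>') \<in> pairs g \<longrightarrow> \<beta>' = \<beta>"
      using Aut_left_div[OF True g] by blast
    have "cv (sc c \<alpha>) (const s) g = (\<Oplus>p\<in>pairs g. if (\<alpha>, \<beta>) = p then c \<otimes> s else \<zero>)"
      unfolding conv_eq
      by (rule finsum_cong') (use \<beta> c s cs in \<open>auto simp: e_val const_def dest: uniq[rule_format]\<close>)
    then show ?thesis
      using finsum_singleton[OF mem finite_pairs, of "\<lambda>_. c \<otimes> s"] c s True by simp
  next
    case False
    have "cv (sc c \<alpha>) (const s) g = \<zero>"
    proof (rule conv_zeroI)
      fix \<alpha>' \<beta> assume p: "(\<alpha>', \<beta>) \<in> pairs g"
      have "\<alpha>' \<noteq> \<alpha> \<or> \<beta> \<notin> Aut C y"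
        using p False g \<alpha> by (auto simp: pairs_def Aut_y Cod_Comp)
      then show "sc c \<alpha> \<alpha>' \<otimes> const s \<beta> = \<zero>" using c s by (auto simp: e_val const_def)
    qed
    then show ?thesis using False by simp
  qed
  show "(sc c \<alpha> \<odot>\<^bsub>span (Aut C y)\<^esub> const s) g = (if \<alpha> \<in> Aut C y then const (c \<otimes> s) else const \<zero>) g"
    using val by (auto simp: span_simps restr_def const_def)
qed

lemma const_closed: "s \<in> carrier k \<Longrightarrow> const s \<in> carrier (span (Aut C y))"
  by (auto simp: span_simps V_carrier const_def Aut_y subset_iff)

lemma convex_Aut: "convex (Aut C y)"
  unfolding convex_def
proof (intro conjI ballI impI)
  fix \<alpha> \<beta> \<gamma> assume "\<alpha> \<in> Mor C" "\<beta> \<in> Mor C" "\<gamma> \<in> Aut C y"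
    "Dom C \<alpha> = Cod C \<beta> \<and> Dom C \<beta> = Cod C \<gamma> \<and> \<alpha> \<bullet>\<^bsub>C\<^esub> (\<beta> \<bullet>\<^bsub>C\<^esub> \<gamma>) \<in> Aut C y"
  then show "\<beta> \<bullet>\<^bsub>C\<^esub> \<gamma> \<in> Aut C y"
    using antisymmetric[of \<beta> \<alpha>] by (auto simp: Aut_y Comp_closed Dom_Comp Cod_Comp)
qed (auto simp: Aut_y)

abbreviation N :: "('m \<Rightarrow> 'k, 'm \<Rightarrow> 'k) module"
  where "N \<equiv> span (Aut C y)"

sublocale N: left_module A N
  by (rule span_module[OF convex_Aut])

definition h :: "('m \<Rightarrow> 'k) \<Rightarrow> ('o \<Rightarrow> (((nat \<Rightarrow> 'k) \<times> (nat \<Rightarrow> 'k)) \<Rightarrow> 'k) set) \<Rightarrow> 'm \<Rightarrow> 'k"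
  where "h a v = const (\<sigma> a v)"

lemma A_val: "a \<in> carrier A \<Longrightarrow> a m \<in> carrier k"
  by (simp add: A_simps V_closed)

lemma h_closed: "a \<in> carrier A \<Longrightarrow> v \<in> carrier M \<Longrightarrow> h a v \<in> carrier N"
  unfolding h_def by (intro const_closed \<sigma>_closed A_val)

lemma h_add_left:
  "a \<in> carrier A \<Longrightarrow> b \<in> carrier A \<Longrightarrow> v \<in> carrier M \<Longrightarrow> h (a \<oplus>\<^bsub>A\<^esub> b) v = h a v \<oplus>\<^bsub>N\<^esub> h b v"
  using \<sigma>_add_left[of a b v] by (auto simp: h_def const_def span_simps A_simps(4) A_val fun_eq_iff)

lemma h_add_right:
  "a \<in> carrier A \<Longrightarrow> u \<in> carrier M \<Longrightarrow> v \<in> carrier M \<Longrightarrow> h a (u \<oplus>\<^bsub>M\<^esub> v) = h a u \<oplus>\<^bsub>N\<^esub> h a v"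
  using \<sigma>_add_right[of a u v] by (auto simp: h_def const_def span_simps A_val fun_eq_iff)

text \<open>
  If \<open>\<alpha>\<close> is an automorphism of \<open>y\<close>, only the first summand survives, since \<open>\<phi>\<close> depends on its
  morphism through the domain alone and norm elements are invariant.  If \<open>\<alpha>\<close> leads from strictly
  below \<open>y\<close> to \<open>y\<close>, it annihilates \<open>k Aut(y)\<close> and only the second summand survives.
\<close>

lemma h_sc:
  assumes c: "c \<in> carrier k" and c': "c' \<in> carrier k" and \<alpha>: "\<alpha> \<in> Mor C" and \<beta>: "\<beta> \<in> Mor C"
    and v: "v \<in> carrier M"
  shows "h (sc c \<alpha> \<otimes>\<^bsub>A\<^esub> sc c' \<beta>) v = sc c \<alpha> \<odot>\<^bsub>N\<^esub> h (sc c' \<beta>) v \<oplus>\<^bsub>N\<^esub> h (sc c \<alpha>) (sc c' \<beta> \<odot>\<^bsub>M\<^esub> v)"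
proof -
  have bv: "sc c' \<beta> \<odot>\<^bsub>M\<^esub> v \<in> carrier M" by (rule M.smult_closed[OF sc_closed[OF c' \<beta>] v])
  have "sc c \<alpha> \<otimes>\<^bsub>A\<^esub> sc c' \<beta> = (\<lambda>m. c \<otimes> (c' \<otimes> cv (e \<alpha>) (e \<beta>) m))"
    using c c' by (simp add: A_simps(2) conv_smult_left conv_smult_right fun_eq_iff)
  then have ab: "sc c \<alpha> \<otimes>\<^bsub>A\<^esub> sc c' \<beta> = (if Dom C \<alpha> = Cod C \<beta> then sc (c \<otimes> c') (\<alpha> \<bullet>\<^bsub>C\<^esub> \<beta>) else (\<lambda>_. \<zero>))"
    using c c' by (simp add: conv_basis[OF \<alpha> \<beta>] m_assoc)
  have s1: "\<sigma> (sc c' \<beta>) v = (if Cod C \<beta> = y then c' \<otimes> \<phi> v \<beta> else \<zero>)" by (rule \<sigma>_sc[OF c' \<beta> v])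
  have s2: "\<sigma> (sc c \<alpha>) (sc c' \<beta> \<odot>\<^bsub>M\<^esub> v) =
      (if Cod C \<alpha> = y \<and> Dom C \<alpha> \<noteq> y \<and> Dom C \<alpha> = Cod C \<beta> then c \<otimes> (c' \<otimes> \<phi> v (\<alpha> \<bullet>\<^bsub>C\<^esub> \<beta>)) else \<zero>)"
  proof (cases "Cod C \<alpha> = y \<and> Dom C \<alpha> \<noteq> y")
    case True
    then show ?thesis
      using \<phi>_sc[OF c' \<beta> v \<alpha>] \<sigma>_sc[OF c \<alpha> bv] c by auto
  next
    case False
    then have "Cod C \<alpha> = y \<Longrightarrow> \<phi> (sc c' \<beta> \<odot>\<^bsub>M\<^esub> v) \<alpha> = \<zero>" by (simp add: \<phi>_def)
    then show ?thesis using \<sigma>_sc[OF c \<alpha> bv] False c by auto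
  qed
  have s3: "\<sigma> (sc c \<alpha> \<otimes>\<^bsub>A\<^esub> sc c' \<beta>) v =
      (if Dom C \<alpha> = Cod C \<beta> \<and> Cod C \<alpha> = y then c \<otimes> (c' \<otimes> \<phi> v (\<alpha> \<bullet>\<^bsub>C\<^esub> \<beta>)) else \<zero>)"
  proof (cases "Dom C \<alpha> = Cod C \<beta>")
    case True
    then show ?thesis
      using \<sigma>_sc[of "c \<otimes> c'" "\<alpha> \<bullet>\<^bsub>C\<^esub> \<beta>" v] c c' v \<phi>_closed[OF v Comp_closed[OF \<alpha> \<beta> True]]
      by (simp add: ab Comp_closed[OF \<alpha> \<beta> True] Cod_Comp[OF \<alpha> \<beta> True] m_assoc)
  qed (simp add: ab \<sigma>_zero v)
  have p: "\<phi> v \<beta> \<in> carrier k" by (rule \<phi>_closed[OF v \<beta>])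
  have \<phi>_eq: "\<phi> v (\<alpha> \<bullet>\<^bsub>C\<^esub> \<beta>) = \<phi> v \<beta>" if "Dom C \<alpha> = Cod C \<beta>"
    using that by (simp add: \<phi>_def Dom_Comp[OF \<alpha> \<beta>])
  have pc: "(if Cod C \<beta> = y then c' \<otimes> \<phi> v \<beta> else \<zero>) \<in> carrier k" using c' p by simp
  have const_add: "const s \<oplus>\<^bsub>N\<^esub> const t = const (s \<oplus> t)" if "s \<in> carrier k" "t \<in> carrier k" for s t
    by (auto simp: const_def span_simps fun_eq_iff)
  show ?thesis
    unfolding h_def s1 s2 s3 sc_const[OF c \<alpha> pc]
    using c c' p \<alpha> by (auto simp: const_add Aut_y \<phi>_eq)
qed

text \<open>Both sides are biadditive in \<open>a\<close> and \<open>b\<close>, which reduces the claim to multiples of morphisms.\<close>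

lemma h_mult:
  assumes a: "a \<in> carrier A" and b: "b \<in> carrier A" and v: "v \<in> carrier M"
  shows "h (a \<otimes>\<^bsub>A\<^esub> b) v = a \<odot>\<^bsub>N\<^esub> h b v \<oplus>\<^bsub>N\<^esub> h a (b \<odot>\<^bsub>M\<^esub> v)"
proof -
  have h_zero: "h \<zero>\<^bsub>A\<^esub> u = \<zero>\<^bsub>N\<^esub>" if "u \<in> carrier M" for u
    using that by (auto simp: h_def A_simps(3) \<sigma>_zero const_def span_simps)
  have h_zero': "h x \<zero>\<^bsub>M\<^esub> = \<zero>\<^bsub>N\<^esub>" if "x \<in> carrier A" for x
    using h_add_right[OF that M.M.zero_closed M.M.zero_closed] h_closed[OF that M.M.zero_closed] by simp
  have 1: "h (sc c \<alpha> \<otimes>\<^bsub>A\<^esub> b) v = sc c \<alpha> \<odot>\<^bsub>N\<^esub> h b v \<oplus>\<^bsub>N\<^esub> h (sc c \<alpha>) (b \<odot>\<^bsub>M\<^esub> v)"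
    if c: "c \<in> carrier k" and \<alpha>: "\<alpha> \<in> Mor C" for c \<alpha>
  proof -
    note s = sc_closed[OF c \<alpha>]
    show ?thesis
      using b unfolding A_simps(1)
    proof (induction b rule: V_induct)
      case zero
      show ?case
        using h_zero[OF v] h_zero'[OF s] A.r_null[OF s] M.smult_zero_left[OF v] N.smult_zero_right[OF s]
        by (simp add: A_simps(3))
    next
      case (add f g)
      have f: "f \<in> carrier A" and g: "g \<in> carrier A" using add(1,2) by (simp_all add: A_simps(1))
      have eq: "(\<lambda>m. f m \<oplus> g m) = f \<oplus>\<^bsub>A\<^esub> g" by (simp add: A_simps(4))
      show ?case
        unfolding eq using add.IH s f g v
        by (simp add: A.r_distr h_add_left h_add_right h_closed M.smult_l_distr N.smult_r_distr
            M.smult_closed N.smult_closed N.M.a_ac)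
    qed (rule h_sc[OF c _ \<alpha> _ v])
  qed
  show ?thesis
    using a unfolding A_simps(1)
  proof (induction a rule: V_induct)
    case zero
    show ?case
      using h_zero[OF v] h_zero[OF M.smult_closed[OF b v]] A.l_null[OF b] N.smult_zero_left[OF h_closed[OF b v]]
      by (simp add: A_simps(3))
  next
    case (add f g)
    have f: "f \<in> carrier A" and g: "g \<in> carrier A" using add(1,2) by (simp_all add: A_simps(1))
    have eq: "(\<lambda>m. f m \<oplus> g m) = f \<oplus>\<^bsub>A\<^esub> g" by (simp add: A_simps(4))
    show ?case
      unfolding eq using add.IH b f g v
      by (simp add: A.l_distr h_add_left h_closed N.smult_l_distr M.smult_closed N.smult_closed N.M.a_ac)
  qed (rule 1)
qed

end

section \<open>All morphisms are monomorphisms\<close>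

context skeletal_EI_category_over_field
begin

text \<open>
  Suppose \<open>\<alpha> \<circ> \<beta> = \<alpha> \<circ> \<gamma>\<close>.  The derivation is inner, given by some \<open>s\<close>, and \<open>\<alpha>\<close> annihilates
  \<open>k Aut(y)\<close>, so \<open>h \<alpha> v = s (\<alpha> v)\<close> depends on \<open>\<alpha> v\<close> only.  But \<open>\<alpha>\<close> maps \<open>\<beta> \<otimes> \<beta>\<close> and
  \<open>\<beta> \<otimes> \<gamma>\<close> to the same element, while \<open>h \<alpha>\<close> maps them to the multiples of the norm element by
  \<open>\<tau> (\<beta> \<otimes> \<beta>) = 1\<close> and \<open>\<tau> (\<beta> \<otimes> \<gamma>)\<close>, and the latter is \<open>0\<close> unless \<open>\<beta> = \<gamma>\<close>.
\<close>

lemma monomorphism_if_mono_below: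
  assumes proj: "projective_over k C" and GPT: "GPT_closed k C" and \<alpha>: "\<alpha> \<in> Mor C"
    and below: "\<And>\<beta>. \<lbrakk>\<beta> \<in> Mor C; Cod C \<beta> \<noteq> Cod C \<alpha>; Hom_set C (Cod C \<beta>) (Cod C \<alpha>) \<noteq> {}\<rbrakk> \<Longrightarrow> monomorphism C \<beta>"
    and ne: "Dom C \<alpha> \<noteq> Cod C \<alpha>"
  shows "monomorphism C \<alpha>"
  unfolding monomorphism_def
proof (intro conjI ballI impI \<alpha>)
  let ?y = "Cod C \<alpha>" and ?z = "Dom C \<alpha>"
  fix w \<beta> \<gamma> assume w: "w \<in> Obj C" and \<beta>: "\<beta> \<in> Hom_set C w ?z" and \<gamma>: "\<gamma> \<in> Hom_set C w ?z"
    and eq: "\<alpha> \<bullet>\<^bsub>C\<^esub> \<beta> = \<alpha> \<bullet>\<^bsub>C\<^esub> \<gamma>"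
  have "Gorenstein_projective A (total_module C (Sq w))"
    using GPT fd_functor_rep Gorenstein_projective_rep[OF w] unfolding GPT_closed_def by blast
  then have G: "left_module A (total_module C (Sq w))" "finitely_generated A (total_module C (Sq w))"
    and ext: "\<And>i. i \<ge> 1 \<Longrightarrow> Ext_vanishes A i (total_module C (Sq w)) (regular_module A)"
    unfolding Gorenstein_projective_def by blast+
  interpret mono_below k C w ?y
    by (rule mono_below.intro[OF skeletal_EI_category_over_field_axioms
          mono_below_axioms.intro[OF Cod_closed[OF \<alpha>] below G(1)]])
  obtain P :: "nat \<Rightarrow> ('m \<Rightarrow> 'k, nat \<Rightarrow> 'm \<Rightarrow> 'k) module" and d \<epsilon>
    where res: "projective_resolution A M P d \<epsilon>"
    using free_resolution_exists[OF left_noetherian_A G] by blast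
  interpret PC: projective_complex A P d by (rule projective_resolution_complex[OF res])
  have "PC.Hom_exact (regular_module A)"
    unfolding PC.Hom_exact_def
    using ext Ext_vanishes_iff[OF left_module_regular[OF ring_A]] res
    by (metis le_add1 plus_1_eq_Suc)
  then interpret HE: Hom_exact_complex k C P d
    by (intro Hom_exact_complex.intro skeletal_EI_category_over_field_axioms
        PC.projective_complex_axioms Hom_exact_complex_axioms.intro proj)
  have exact: "Hom_exact_at A P d N 0"
    using HE.Hom_exact_Aut[OF Cod_closed[OF \<alpha>]] by (simp add: PC.Hom_exact_def)
  have "\<exists>s. (\<forall>v\<in>carrier M. s v \<in> carrier N) \<and>
      (\<forall>a\<in>carrier A. \<forall>v\<in>carrier M. s (a \<odot>\<^bsub>M\<^esub> v) = a \<odot>\<^bsub>N\<^esub> s v \<oplus>\<^bsub>N\<^esub> h a v)"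
    by (rule derivation_inner[where h = h, OF M.left_module_axioms N.left_module_axioms res exact])
      (fact h_closed h_add_left h_add_right h_mult)+
  then obtain s where s: "\<And>v. v \<in> carrier M \<Longrightarrow> s v \<in> carrier N"
    and s_mult: "\<And>a v. \<lbrakk>a \<in> carrier A; v \<in> carrier M\<rbrakk> \<Longrightarrow> s (a \<odot>\<^bsub>M\<^esub> v) = a \<odot>\<^bsub>N\<^esub> s v \<oplus>\<^bsub>N\<^esub> h a v"
    by blast
  note z = Dom_closed[OF \<alpha>]
  have e\<alpha>: "e \<alpha> \<in> carrier A" using e_closed[OF \<alpha>] by (simp add: A_simps)
  have kill: "e \<alpha> \<odot>\<^bsub>N\<^esub> r = \<zero>\<^bsub>N\<^esub>" if r: "r \<in> carrier N" for r
  proof -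
    have "cv (e \<alpha>) r g = \<zero>" if "g \<in> Aut C ?y" for g
    proof (rule conv_zeroI)
      fix \<alpha>' \<beta> assume "(\<alpha>', \<beta>) \<in> pairs g"
      then have "\<alpha>' \<noteq> \<alpha> \<or> \<beta> \<notin> Aut C ?y" using ne by (auto simp: pairs_def Aut_y)
      then show "e \<alpha> \<alpha>' \<otimes> r \<beta> = \<zero>"
        using r by (auto simp: e_val span_simps V_zero V_closed)
    qed
    then show ?thesis by (auto simp: span_simps restr_def)
  qed
  \<comment> \<open>\<open>v ?b\<close> and \<open>v ?c\<close> are \<open>\<beta> \<otimes> \<beta>\<close> and \<open>\<beta> \<otimes> \<gamma>\<close>, placed at the object \<open>?z\<close>.\<close>
  let ?b = "dec (e \<beta>)" and ?c = "dec (e \<gamma>)"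
  have b: "?b \<in> carrier (S (Hom_set C w ?z))" and c: "?c \<in> carrier (S (Hom_set C w ?z))"
    using \<beta> \<gamma> by (auto intro: dec_closed[OF Hom_sub] e_closed)
  define v where "v u = (\<lambda>x\<in>Obj C. if x = ?z then pure w x ?b u else \<zero>\<^bsub>T2 w x\<^esub>)" for u
  have v: "v u \<in> carrier M" if "u \<in> carrier (S (Hom_set C w ?z))" for u
  proof (rule M_memI)
    fix x assume x: "x \<in> Obj C"
    interpret T: left_module k "T2 w x" by (rule T2_module)
    show "v u x \<in> carrier (T2 w x)" using x pure_closed[OF b that] by (auto simp: v_def)
  qed (simp add: v_def)
  have enc_e: "enc (dec (e \<mu>)) = e \<mu>" if "\<mu> \<in> Hom_set C w ?z" for \<mu>
    using that Hom_sub by (intro enc_dec e_closed) blast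
  have "mor_map (rep w) \<alpha> ?b = mor_map (rep w) \<alpha> ?c"
  proof -
    have "cv (e \<alpha>) (e \<beta>) = cv (e \<alpha>) (e \<gamma>)"
      using \<beta> \<gamma> eq by (auto simp: conv_basis \<alpha> Hom_set_def)
    then show ?thesis by (simp add: rep_simps enc_e \<beta> \<gamma>)
  qed
  then have "mor_map (Sq w) \<alpha> (v ?b ?z) = mor_map (Sq w) \<alpha> (v ?c ?z)"
    using z Sq_mor(2)[OF \<alpha> b b] Sq_mor(2)[OF \<alpha> b c] by (simp add: v_def)
  then have "(sc \<one> \<alpha> \<odot>\<^bsub>M\<^esub> v ?b) x = (sc \<one> \<alpha> \<odot>\<^bsub>M\<^esub> v ?c) x" if "x \<in> Obj C" for x
    using M_sc[OF one_closed \<alpha> v[OF b] that] M_sc[OF one_closed \<alpha> v[OF c] that] by simp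
  moreover have sc_one: "sc \<one> \<alpha> = e \<alpha>" by simp
  ultimately have same: "e \<alpha> \<odot>\<^bsub>M\<^esub> v ?b = e \<alpha> \<odot>\<^bsub>M\<^esub> v ?c"
    by (intro extensionalityI[of _ "Obj C"]) (simp_all add: total_module_simps(4))
  have h_eq: "h (e \<alpha>) u = s (e \<alpha> \<odot>\<^bsub>M\<^esub> u)" if "u \<in> carrier M" for u
    using s_mult[OF e\<alpha> that] kill[OF s[OF that]] h_closed[OF e\<alpha> that] by simp
  \<comment> \<open>The identity of \<open>?y\<close> occurs in the norm element, so its coefficient recovers the scalar.\<close>
  have h_val: "h (e \<alpha>) (v u) (Id C ?y) = form ?b u" if "u \<in> carrier (S (Hom_set C w ?z))" for u
  proof -
    have "Id C ?y \<in> Aut C ?y"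
      using Cod_closed[OF \<alpha>] by (simp add: Aut_y Id_closed Dom_Id Cod_Id)
    moreover have "\<phi> (v u) \<alpha> = form ?b u"
      using ne \<alpha> z \<tau>_pure[OF b that] by (auto simp: \<phi>_def v_def Hom_set_def)
    moreover have "form ?b u \<in> carrier k"
      by (rule form_closed[OF S_closed[OF b] S_closed[OF that]])
    ultimately show ?thesis
      using \<sigma>_sc[OF one_closed \<alpha> v[OF that]] unfolding sc_one by (simp add: h_def const_def)
  qed
  have form_e: "form ?b (dec (e \<mu>)) = (if \<beta> = \<mu> then \<one> else \<zero>)" if \<mu>: "\<mu> \<in> Hom_set C w ?z" for \<mu>
  proof -
    have \<beta>M: "\<beta> \<in> Mor C" using \<beta> by (simp add: Hom_set_def)
    have "form ?b (dec (e \<mu>)) = (\<Oplus>\<nu>\<in>Mor C. if \<beta> = \<nu> then (if \<beta> = \<mu> then \<one> else \<zero>) else \<zero>)"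
      unfolding form_def enc_e[OF \<beta>] enc_e[OF \<mu>] by (rule finsum_cong') (auto simp: e_val)
    then show ?thesis
      using finsum_singleton[OF \<beta>M finite_Mor, of "\<lambda>_. if \<beta> = \<mu> then \<one> else \<zero>"] by simp
  qed
  have "form ?b ?b = form ?b ?c"
    using h_val[OF b] h_val[OF c] h_eq[OF v[OF b]] h_eq[OF v[OF c]] same by simp
  then show "\<beta> = \<gamma>"
    using form_e[OF \<beta>] form_e[OF \<gamma>] by (auto split: if_splits)
qed

lemma isomorphism_imp_monomorphism:
  assumes "isomorphism C \<alpha>" shows "monomorphism C \<alpha>"
  unfolding monomorphism_def
proof (intro conjI ballI impI)
  obtain i where i: "i \<in> Hom_set C (Cod C \<alpha>) (Dom C \<alpha>)" "i \<bullet>\<^bsub>C\<^esub> \<alpha> = Id C (Dom C \<alpha>)"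
    and \<alpha>: "\<alpha> \<in> Mor C"
    using assms unfolding isomorphism_def by blast
  then show "\<alpha> \<in> Mor C" by simp
  have cancel: "i \<bullet>\<^bsub>C\<^esub> (\<alpha> \<bullet>\<^bsub>C\<^esub> g) = g" if "g \<in> Hom_set C w (Dom C \<alpha>)" for g w
    using that i \<alpha> Comp_assoc[of i \<alpha> g] Id_Comp[of g] by (auto simp: Hom_set_def)
  show "\<beta> = \<gamma>" if "\<beta> \<in> Hom_set C w (Dom C \<alpha>)" "\<gamma> \<in> Hom_set C w (Dom C \<alpha>)" "\<alpha> \<bullet>\<^bsub>C\<^esub> \<beta> = \<alpha> \<bullet>\<^bsub>C\<^esub> \<gamma>" for w \<beta> \<gamma>
  proof -
    have "i \<bullet>\<^bsub>C\<^esub> (\<alpha> \<bullet>\<^bsub>C\<^esub> \<beta>) = i \<bullet>\<^bsub>C\<^esub> (\<alpha> \<bullet>\<^bsub>C\<^esub> \<gamma>)" using that(3) by simp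
    then show ?thesis unfolding cancel[OF that(1)] cancel[OF that(2)] .
  qed
qed

text \<open>
  Induction along the partial order, from the bottom: objects strictly below \<open>Cod \<alpha>\<close> have greater
  height, and heights are bounded by the number of objects.
\<close>

lemma all_monomorphisms:
  assumes "projective_over k C" "GPT_closed k C" "\<alpha> \<in> Mor C"
  shows "monomorphism C \<alpha>"
  using assms(3)
proof (induction "card (Obj C) - height (Cod C \<alpha>)" arbitrary: \<alpha> rule: less_induct)
  case less
  show ?case
  proof (cases "Dom C \<alpha> = Cod C \<alpha>")
    case True
    then show ?thesis
      using endo_iso[OF Cod_closed[OF less.prems], of \<alpha>] less.prems
      by (auto simp: Hom_set_def intro: isomorphism_imp_monomorphism)
  next
    case False
    have "monomorphism C \<beta>"
      if \<beta>: "\<beta> \<in> Mor C" "Cod C \<beta> \<noteq> Cod C \<alpha>" "Hom_set C (Cod C \<beta>) (Cod C \<alpha>) \<noteq> {}" for \<beta>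
    proof (rule less.hyps[OF _ \<beta>(1)])
      obtain \<gamma> where "\<gamma> \<in> Mor C" "Dom C \<gamma> = Cod C \<beta>" "Cod C \<gamma> = Cod C \<alpha>"
        using \<beta>(3) unfolding Hom_set_def by blast
      then have "height (Cod C \<alpha>) < height (Cod C \<beta>)"
        using height_less[of \<gamma>] \<beta>(2) by auto
      moreover have "height (Cod C \<beta>) \<le> card (Obj C)"
        unfolding height_def by (rule card_mono[OF finite_Obj]) auto
      ultimately show "card (Obj C) - height (Cod C \<beta>) < card (Obj C) - height (Cod C \<alpha>)"
        by linarith
    qed
    then show ?thesis
      by (rule monomorphism_if_mono_below[OF assms(1,2) less.prems _ False])
  qed
qed

end

theorem proposition1p1:
  fixes k :: "('k, 'z) ring_scheme" and C :: "('o, 'm) cat"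
  assumes "field k"
    and "finite_EI_category C"
    and "skeletal C"
    and "2 \<le> card (Obj C)"
    and "projective_over k C"
    and "GPT_closed k C"
  shows "\<forall>f \<in> Mor C. monomorphism C f"
proof -
  interpret skeletal_EI_category_over_field k C
    by (intro skeletal_EI_category_over_field.intro EI_category_over_field.intro
        skeletal_EI_category_over_field_axioms.intro assms)
  show ?thesis
    using all_monomorphisms[OF assms(5,6)] by blast
qed

end
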